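(* Let $\mathcal{C}$ be the monoidal category of finite dimensional complex $\mathfrak{sl}_2$-modules. Let $g\in\mathfrak{sl}_2$ be non-zero and let $\mathfrak{a}=\mathbb{C}g$, a one-dimensional Lie subalgebra of $\mathfrak{sl}_2$ with $U(\mathfrak{a})=\mathbb{C}[g]$. The category $\mathcal{C}$ acts on finite dimensional $\mathfrak{a}$-modules by $V\cdot N=\mathrm{Res}^{\mathfrak{sl}_2}_{\mathfrak{a}}(V)\otimes_{\mathbb{C}}N$. We have the following two cases: (a) Suppose $g$ is nilpotent. For $\lambda\in\mathbb{C}$ and $n\in\mathbb{Z}_{>0}$, let $M(n,\lambda)$ be the $n$-dimensional $\mathbb{C}[g]$-module on which $g$ acts via an $n\times n$ Jordan cell with eigenvalue $\lambda$; let $\mathcal{Y}(\lambda)$ be the additive closure of all $M(n,\lambda)$, $n\in\mathbb{Z}_{>0}$, and let $\widetilde{\mathcal{Y}}(\lambda)$ be the quotient of $\mathcal{Y}(\lambda)$ by its radical. Then, for each $\lambda\in\mathbb{C}$, the category $\mathcal{Y}(\lambda)$ is a transitive $\mathcal{C}$-module category of type $A_\infty$ with simple transitive quotient $\widetilde{\mathcal{Y}}(\lambda)$. (b) Suppose $g$ is semi-simple, with eigenvalues $\mu\neq0$ and $-\mu$. For $\nu\in\mathbb{C}$ let $\mathbb{C}_\nu$ be the one-dimensional $\mathbb{C}[g]$-module on which $g$ acts via $\nu$, and let $\mathcal{X}(\lambda)$ be the additive closure of all $\mathbb{C}_{\lambda+n\mu}$, $n\in\mathbb{Z}$. Then, for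 each $\lambda\in\mathbb{C}$, the category $\mathcal{X}(\lambda)$ is a simple transitive $\mathcal{C}$-module category of type $A_\infty^\infty$.
   Context: Everything is over $\mathbb{C}$. $\mathcal{C}$ is the monoidal category (under $\otimes_{\mathbb{C}}$) of finite dimensional $\mathfrak{sl}_2$-modules; $L(1)$ is the simple module of dimension $2$. "Nilpotent" and "semi-simple" refer to $g$ as a $2\times2$ matrix. The additive closure of a set of modules is the full subcategory of modules isomorphic to direct summands of finite direct sums of them. A $\mathcal{C}$-module category $\mathcal{M}$ is locally finitary if it is $\mathbb{C}$-linear, additive, idempotent split, Krull-Schmidt, has at most countably many indecomposable objects up to isomorphism, and has finite dimensional hom-spaces. It is transitive if for any indecomposable $X,Y\in\mathcal{M}$ there is $F\in\mathcal{C}$ such that $Y$ is isomorphic to a direct summand of $F(X)$. It is simple transitive if it has no non-trivial $\mathcal{C}$-invariant ideals (ideals other than $0$ and $\mathcal{M}$). The simple transitive quotient of a transitive $\mathcal{M}$ is its quotient by the maximal $\mathcal{C}$-invariant ideal different from $\mathcal{M}$. A locally finitary $\mathcal{C}$-module category is of type $A_\infty$ if its indecomposables, up to isomorphism, can be listed without repetition as $X_0,X_1,\dots$ so that $L(1)\cdot X_0\cong X_1$ and $L(1)\cdot X_i\cong X_{i-1}\oplus X_{i+1}$ for $i\geq1$; it is of type $A_\infty^\infty$ if they can be listed without repetition as $X_i$, $i\in\mathbb{Z}$, so that $L(1)\cdot X_i\cong X_{i-1}\oplus X_{i+1}$ for all $i\in\mathbb{Z}$. *)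

theory Defs
  imports
    "HOL-Library.FuncSet"
    "HOL-Library.Countable_Set"
    "Jordan_Normal_Form.Jordan_Normal_Form"
    "Jordan_Normal_Form.Spectral_Radius"
begin

section \<open>Complex linear categories\<close>

text \<open>The operations carry the objects involved: \<open>Comp C X Y Z g f\<close> is the composite of
  \<open>f : X \<rightarrow> Y\<close> followed by \<open>g : Y \<rightarrow> Z\<close>. This way hom-sets need not be disjoint, so that
  morphisms can be plain matrices, or cosets of matrices.\<close>

record ('o, 'm) lincat =
  Obj :: "'o set"
  Hom :: "'o \<Rightarrow> 'o \<Rightarrow> 'm set"
  Ident :: "'o \<Rightarrow> 'm"
  Comp :: "'o \<Rightarrow> 'o \<Rightarrow> 'o \<Rightarrow> 'm \<Rightarrow> 'm \<Rightarrow> 'm"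
  Zero :: "'o \<Rightarrow> 'o \<Rightarrow> 'm"
  Add :: "'o \<Rightarrow> 'o \<Rightarrow> 'm \<Rightarrow> 'm \<Rightarrow> 'm"
  Scale :: "'o \<Rightarrow> 'o \<Rightarrow> complex \<Rightarrow> 'm \<Rightarrow> 'm"

locale linear_category =
  fixes C :: "('o, 'm, 'z) lincat_scheme"
  assumes ident_closed: "X \<in> Obj C \<Longrightarrow> Ident C X \<in> Hom C X X"
    and comp_closed: "\<lbrakk>X \<in> Obj C; Y \<in> Obj C; Z \<in> Obj C; f \<in> Hom C X Y; g \<in> Hom C Y Z\<rbrakk>
      \<Longrightarrow> Comp C X Y Z g f \<in> Hom C X Z"
    and comp_ident_right: "\<lbrakk>X \<in> Obj C; Y \<in> Obj C; f \<in> Hom C X Y\<rbrakk>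
      \<Longrightarrow> Comp C X X Y f (Ident C X) = f"
    and comp_ident_left: "\<lbrakk>X \<in> Obj C; Y \<in> Obj C; f \<in> Hom C X Y\<rbrakk>
      \<Longrightarrow> Comp C X Y Y (Ident C Y) f = f"
    and comp_assoc: "\<lbrakk>W \<in> Obj C; X \<in> Obj C; Y \<in> Obj C; Z \<in> Obj C;
        f \<in> Hom C W X; g \<in> Hom C X Y; h \<in> Hom C Y Z\<rbrakk>
      \<Longrightarrow> Comp C W X Z (Comp C X Y Z h g) f = Comp C W Y Z h (Comp C W X Y g f)"
    and zero_closed: "\<lbrakk>X \<in> Obj C; Y \<in> Obj C\<rbrakk> \<Longrightarrow> Zero C X Y \<in> Hom C X Y"
    and add_closed: "\<lbrakk>X \<in> Obj C; Y \<in> Obj C; f \<in> Hom C X Y; g \<in> Hom C X Y\<rbrakk>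
      \<Longrightarrow> Add C X Y f g \<in> Hom C X Y"
    and scale_closed: "\<lbrakk>X \<in> Obj C; Y \<in> Obj C; f \<in> Hom C X Y\<rbrakk>
      \<Longrightarrow> Scale C X Y a f \<in> Hom C X Y"
    and add_assoc: "\<lbrakk>X \<in> Obj C; Y \<in> Obj C; f \<in> Hom C X Y; g \<in> Hom C X Y; h \<in> Hom C X Y\<rbrakk>
      \<Longrightarrow> Add C X Y (Add C X Y f g) h = Add C X Y f (Add C X Y g h)"
    and add_commute: "\<lbrakk>X \<in> Obj C; Y \<in> Obj C; f \<in> Hom C X Y; g \<in> Hom C X Y\<rbrakk>
      \<Longrightarrow> Add C X Y f g = Add C X Y g f"
    and add_zero: "\<lbrakk>X \<in> Obj C; Y \<in> Obj C; f \<in> Hom C X Y\<rbrakk>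
      \<Longrightarrow> Add C X Y f (Zero C X Y) = f"
    and add_inverse: "\<lbrakk>X \<in> Obj C; Y \<in> Obj C; f \<in> Hom C X Y\<rbrakk>
      \<Longrightarrow> Add C X Y f (Scale C X Y (- 1) f) = Zero C X Y"
    and scale_one: "\<lbrakk>X \<in> Obj C; Y \<in> Obj C; f \<in> Hom C X Y\<rbrakk> \<Longrightarrow> Scale C X Y 1 f = f"
    and scale_scale: "\<lbrakk>X \<in> Obj C; Y \<in> Obj C; f \<in> Hom C X Y\<rbrakk>
      \<Longrightarrow> Scale C X Y a (Scale C X Y b f) = Scale C X Y (a * b) f"
    and scale_add_left: "\<lbrakk>X \<in> Obj C; Y \<in> Obj C; f \<in> Hom C X Y\<rbrakk>
      \<Longrightarrow> Scale C X Y (a + b) f = Add C X Y (Scale C X Y a f) (Scale C X Y b f)"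
    and scale_add_right: "\<lbrakk>X \<in> Obj C; Y \<in> Obj C; f \<in> Hom C X Y; g \<in> Hom C X Y\<rbrakk>
      \<Longrightarrow> Scale C X Y a (Add C X Y f g) = Add C X Y (Scale C X Y a f) (Scale C X Y a g)"
    and comp_add_right: "\<lbrakk>X \<in> Obj C; Y \<in> Obj C; Z \<in> Obj C;
        f \<in> Hom C X Y; f' \<in> Hom C X Y; g \<in> Hom C Y Z\<rbrakk>
      \<Longrightarrow> Comp C X Y Z g (Add C X Y f f') = Add C X Z (Comp C X Y Z g f) (Comp C X Y Z g f')"
    and comp_add_left: "\<lbrakk>X \<in> Obj C; Y \<in> Obj C; Z \<in> Obj C;
        f \<in> Hom C X Y; g \<in> Hom C Y Z; g' \<in> Hom C Y Z\<rbrakk>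
      \<Longrightarrow> Comp C X Y Z (Add C Y Z g g') f = Add C X Z (Comp C X Y Z g f) (Comp C X Y Z g' f)"
    and comp_scale_right: "\<lbrakk>X \<in> Obj C; Y \<in> Obj C; Z \<in> Obj C; f \<in> Hom C X Y; g \<in> Hom C Y Z\<rbrakk>
      \<Longrightarrow> Comp C X Y Z g (Scale C X Y a f) = Scale C X Z a (Comp C X Y Z g f)"
    and comp_scale_left: "\<lbrakk>X \<in> Obj C; Y \<in> Obj C; Z \<in> Obj C; f \<in> Hom C X Y; g \<in> Hom C Y Z\<rbrakk>
      \<Longrightarrow> Comp C X Y Z (Scale C Y Z a g) f = Scale C X Z a (Comp C X Y Z g f)"

definition inverse_mor :: "('o, 'm, 'z) lincat_scheme \<Rightarrow> 'o \<Rightarrow> 'o \<Rightarrow> 'm \<Rightarrow> 'm \<Rightarrow> bool" where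
  "inverse_mor C X Y f g \<longleftrightarrow> f \<in> Hom C X Y \<and> g \<in> Hom C Y X \<and>
     Comp C X Y X g f = Ident C X \<and> Comp C Y X Y f g = Ident C Y"

definition iso_mor :: "('o, 'm, 'z) lincat_scheme \<Rightarrow> 'o \<Rightarrow> 'o \<Rightarrow> 'm \<Rightarrow> bool" where
  "iso_mor C X Y f \<longleftrightarrow> (\<exists>g. inverse_mor C X Y f g)"

definition iso_obj :: "('o, 'm, 'z) lincat_scheme \<Rightarrow> 'o \<Rightarrow> 'o \<Rightarrow> bool" where
  "iso_obj C X Y \<longleftrightarrow> (\<exists>f. iso_mor C X Y f)"

definition zero_obj :: "('o, 'm, 'z) lincat_scheme \<Rightarrow> 'o \<Rightarrow> bool" where
  "zero_obj C X \<longleftrightarrow> X \<in> Obj C \<and> Ident C X = Zero C X X"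

text \<open>\<open>biproduct C X Y Z\<close> says that \<open>X \<cong> Y \<oplus> Z\<close>. Biproducts are characterised only up to
  isomorphism, so this relation is invariant under isomorphism in all three objects.\<close>

definition biproduct :: "('o, 'm, 'z) lincat_scheme \<Rightarrow> 'o \<Rightarrow> 'o \<Rightarrow> 'o \<Rightarrow> bool" where
  "biproduct C X Y Z \<longleftrightarrow> X \<in> Obj C \<and> Y \<in> Obj C \<and> Z \<in> Obj C \<and>
     (\<exists>i \<in> Hom C Y X. \<exists>p \<in> Hom C X Y. \<exists>j \<in> Hom C Z X. \<exists>q \<in> Hom C X Z.
        Comp C Y X Y p i = Ident C Y \<and> Comp C Z X Z q j = Ident C Z \<and>
        Comp C Z X Y p j = Zero C Z Y \<and> Comp C Y X Z q i = Zero C Y Z \<and>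
        Add C X X (Comp C X Y X i p) (Comp C X Z X j q) = Ident C X)"

definition direct_summand :: "('o, 'm, 'z) lincat_scheme \<Rightarrow> 'o \<Rightarrow> 'o \<Rightarrow> bool" where
  "direct_summand C Y X \<longleftrightarrow> (\<exists>Z. biproduct C X Y Z)"

primrec direct_sum :: "('o, 'm, 'z) lincat_scheme \<Rightarrow> 'o \<Rightarrow> 'o list \<Rightarrow> bool" where
  "direct_sum C X [] \<longleftrightarrow> zero_obj C X"
| "direct_sum C X (Y # Ys) \<longleftrightarrow> (\<exists>Z. biproduct C X Y Z \<and> direct_sum C Z Ys)"

definition additive_category :: "('o, 'm, 'z) lincat_scheme \<Rightarrow> bool" where
  "additive_category C \<longleftrightarrow> linear_category C \<and> (\<exists>X. zero_obj C X) \<and>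
     (\<forall>Y\<in>Obj C. \<forall>Z\<in>Obj C. \<exists>X. biproduct C X Y Z)"

definition indecomposable :: "('o, 'm, 'z) lincat_scheme \<Rightarrow> 'o \<Rightarrow> bool" where
  "indecomposable C X \<longleftrightarrow> X \<in> Obj C \<and> \<not> zero_obj C X \<and>
     (\<forall>Y Z. biproduct C X Y Z \<longrightarrow> zero_obj C Y \<or> zero_obj C Z)"

definition idempotent_split :: "('o, 'm, 'z) lincat_scheme \<Rightarrow> bool" where
  "idempotent_split C \<longleftrightarrow>
     (\<forall>X\<in>Obj C. \<forall>e\<in>Hom C X X. Comp C X X X e e = e \<longrightarrow>
        (\<exists>Y\<in>Obj C. \<exists>p\<in>Hom C X Y. \<exists>i\<in>Hom C Y X.
           Comp C X Y X i p = e \<and> Comp C Y X Y p i = Ident C Y))"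

definition local_end :: "('o, 'm, 'z) lincat_scheme \<Rightarrow> 'o \<Rightarrow> bool" where
  "local_end C X \<longleftrightarrow> X \<in> Obj C \<and> Ident C X \<noteq> Zero C X X \<and>
     (\<forall>f\<in>Hom C X X. \<forall>g\<in>Hom C X X.
        iso_mor C X X (Add C X X f g) \<longrightarrow> iso_mor C X X f \<or> iso_mor C X X g)"

definition krull_schmidt :: "('o, 'm, 'z) lincat_scheme \<Rightarrow> bool" where
  "krull_schmidt C \<longleftrightarrow>
     (\<forall>X\<in>Obj C. \<exists>Ys. direct_sum C X Ys \<and> (\<forall>Y\<in>set Ys. local_end C Y))"

definition countably_many_indecomposables :: "('o, 'm, 'z) lincat_scheme \<Rightarrow> bool" where
  "countably_many_indecomposables C \<longleftrightarrow>
     (\<exists>S. countable S \<and> S \<subseteq> Obj C \<and> (\<forall>X. indecomposable C X \<longrightarrow> (\<exists>Y\<in>S. iso_obj C X Y)))"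

definition hom_subspace :: "('o, 'm, 'z) lincat_scheme \<Rightarrow> 'o \<Rightarrow> 'o \<Rightarrow> 'm set \<Rightarrow> bool" where
  "hom_subspace C X Y S \<longleftrightarrow> S \<subseteq> Hom C X Y \<and> Zero C X Y \<in> S \<and>
     (\<forall>f\<in>S. \<forall>g\<in>S. Add C X Y f g \<in> S) \<and> (\<forall>a. \<forall>f\<in>S. Scale C X Y a f \<in> S)"

definition finite_dim_homs :: "('o, 'm, 'z) lincat_scheme \<Rightarrow> bool" where
  "finite_dim_homs C \<longleftrightarrow>
     (\<forall>X\<in>Obj C. \<forall>Y\<in>Obj C. \<exists>B. finite B \<and> B \<subseteq> Hom C X Y \<and>
        (\<forall>S. hom_subspace C X Y S \<and> B \<subseteq> S \<longrightarrow> S = Hom C X Y))"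

definition additive_closure :: "('o, 'm, 'z) lincat_scheme \<Rightarrow> 'o set \<Rightarrow> 'o set" where
  "additive_closure C S =
     {X. \<exists>Ys Z. set Ys \<subseteq> S \<and> direct_sum C Z Ys \<and> direct_summand C X Z}"


section \<open>Ideals, radical and quotients\<close>

definition cat_ideal ::
    "('o, 'm, 'z) lincat_scheme \<Rightarrow> ('o \<Rightarrow> 'o \<Rightarrow> 'm set) \<Rightarrow> bool" where
  "cat_ideal C I \<longleftrightarrow>
     (\<forall>X\<in>Obj C. \<forall>Y\<in>Obj C. hom_subspace C X Y (I X Y)) \<and>
     (\<forall>X\<in>Obj C. \<forall>Y\<in>Obj C. \<forall>Z\<in>Obj C. \<forall>f\<in>I X Y. \<forall>g\<in>Hom C Y Z.
        Comp C X Y Z g f \<in> I X Z) \<and>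
     (\<forall>X\<in>Obj C. \<forall>Y\<in>Obj C. \<forall>Z\<in>Obj C. \<forall>f\<in>Hom C X Y. \<forall>g\<in>I Y Z.
        Comp C X Y Z g f \<in> I X Z)"

definition zero_ideal ::
    "('o, 'm, 'z) lincat_scheme \<Rightarrow> ('o \<Rightarrow> 'o \<Rightarrow> 'm set) \<Rightarrow> bool" where
  "zero_ideal C I \<longleftrightarrow> (\<forall>X\<in>Obj C. \<forall>Y\<in>Obj C. I X Y = {Zero C X Y})"

definition whole_ideal ::
    "('o, 'm, 'z) lincat_scheme \<Rightarrow> ('o \<Rightarrow> 'o \<Rightarrow> 'm set) \<Rightarrow> bool" where
  "whole_ideal C I \<longleftrightarrow> (\<forall>X\<in>Obj C. \<forall>Y\<in>Obj C. I X Y = Hom C X Y)"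

definition radical :: "('o, 'm, 'z) lincat_scheme \<Rightarrow> 'o \<Rightarrow> 'o \<Rightarrow> 'm set" where
  "radical C X Y = {f \<in> Hom C X Y. \<forall>g\<in>Hom C Y X.
     iso_mor C X X (Add C X X (Ident C X) (Scale C X X (- 1) (Comp C X Y X g f)))}"

definition ideal_coset ::
    "('o, 'm, 'z) lincat_scheme \<Rightarrow> ('o \<Rightarrow> 'o \<Rightarrow> 'm set) \<Rightarrow> 'o \<Rightarrow> 'o \<Rightarrow> 'm \<Rightarrow> 'm set" where
  "ideal_coset C I X Y f = Add C X Y f ` I X Y"


section \<open>Monoidal categories and module categories over them\<close>

text \<open>For \<open>f : V \<rightarrow> V'\<close> and \<open>g : W \<rightarrow> W'\<close>, the tensor product
  \<open>V \<otimes> W \<rightarrow> V' \<otimes> W'\<close> is \<open>TensMor C V V' W W' f g\<close>. The constraints are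
  \<open>TensAssoc C U V W : (U \<otimes> V) \<otimes> W \<rightarrow> U \<otimes> (V \<otimes> W)\<close>,
  \<open>LeftUnitor C V : \<one> \<otimes> V \<rightarrow> V\<close> and \<open>RightUnitor C V : V \<otimes> \<one> \<rightarrow> V\<close>.\<close>

record ('o, 'm) moncat = "('o, 'm) lincat" +
  TensUnit :: 'o
  Tens :: "'o \<Rightarrow> 'o \<Rightarrow> 'o"
  TensMor :: "'o \<Rightarrow> 'o \<Rightarrow> 'o \<Rightarrow> 'o \<Rightarrow> 'm \<Rightarrow> 'm \<Rightarrow> 'm"
  TensAssoc :: "'o \<Rightarrow> 'o \<Rightarrow> 'o \<Rightarrow> 'm"
  LeftUnitor :: "'o \<Rightarrow> 'm"
  RightUnitor :: "'o \<Rightarrow> 'm"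

locale monoidal_category = linear_category C
  for C :: "('v, 'w, 'z) moncat_scheme" +
  assumes unit_closed: "TensUnit C \<in> Obj C"
    and tens_closed: "\<lbrakk>V \<in> Obj C; W \<in> Obj C\<rbrakk> \<Longrightarrow> Tens C V W \<in> Obj C"
    and tens_mor_closed: "\<lbrakk>V \<in> Obj C; V' \<in> Obj C; W \<in> Obj C; W' \<in> Obj C;
        f \<in> Hom C V V'; g \<in> Hom C W W'\<rbrakk>
      \<Longrightarrow> TensMor C V V' W W' f g \<in> Hom C (Tens C V W) (Tens C V' W')"
    and tens_ident: "\<lbrakk>V \<in> Obj C; W \<in> Obj C\<rbrakk>
      \<Longrightarrow> TensMor C V V W W (Ident C V) (Ident C W) = Ident C (Tens C V W)"
    and tens_comp: "\<lbrakk>V \<in> Obj C; V' \<in> Obj C; V'' \<in> Obj C; W \<in> Obj C; W' \<in> Obj C; W'' \<in> Obj C;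
        f \<in> Hom C V V'; f' \<in> Hom C V' V''; g \<in> Hom C W W'; g' \<in> Hom C W' W''\<rbrakk>
      \<Longrightarrow> TensMor C V V'' W W'' (Comp C V V' V'' f' f) (Comp C W W' W'' g' g) =
        Comp C (Tens C V W) (Tens C V' W') (Tens C V'' W'')
          (TensMor C V' V'' W' W'' f' g') (TensMor C V V' W W' f g)"
    and tens_add_left: "\<lbrakk>V \<in> Obj C; V' \<in> Obj C; W \<in> Obj C; W' \<in> Obj C;
        f \<in> Hom C V V'; f' \<in> Hom C V V'; g \<in> Hom C W W'\<rbrakk>
      \<Longrightarrow> TensMor C V V' W W' (Add C V V' f f') g =
        Add C (Tens C V W) (Tens C V' W') (TensMor C V V' W W' f g) (TensMor C V V' W W' f' g)"
    and tens_add_right: "\<lbrakk>V \<in> Obj C; V' \<in> Obj C; W \<in> Obj C; W' \<in> Obj C;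
        f \<in> Hom C V V'; g \<in> Hom C W W'; g' \<in> Hom C W W'\<rbrakk>
      \<Longrightarrow> TensMor C V V' W W' f (Add C W W' g g') =
        Add C (Tens C V W) (Tens C V' W') (TensMor C V V' W W' f g) (TensMor C V V' W W' f g')"
    and tens_scale_left: "\<lbrakk>V \<in> Obj C; V' \<in> Obj C; W \<in> Obj C; W' \<in> Obj C;
        f \<in> Hom C V V'; g \<in> Hom C W W'\<rbrakk>
      \<Longrightarrow> TensMor C V V' W W' (Scale C V V' a f) g =
        Scale C (Tens C V W) (Tens C V' W') a (TensMor C V V' W W' f g)"
    and tens_scale_right: "\<lbrakk>V \<in> Obj C; V' \<in> Obj C; W \<in> Obj C; W' \<in> Obj C;
        f \<in> Hom C V V'; g \<in> Hom C W W'\<rbrakk>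
      \<Longrightarrow> TensMor C V V' W W' f (Scale C W W' a g) =
        Scale C (Tens C V W) (Tens C V' W') a (TensMor C V V' W W' f g)"
    and assoc_iso: "\<lbrakk>U \<in> Obj C; V \<in> Obj C; W \<in> Obj C\<rbrakk>
      \<Longrightarrow> iso_mor C (Tens C (Tens C U V) W) (Tens C U (Tens C V W)) (TensAssoc C U V W)"
    and assoc_natural: "\<lbrakk>U \<in> Obj C; U' \<in> Obj C; V \<in> Obj C; V' \<in> Obj C; W \<in> Obj C; W' \<in> Obj C;
        f \<in> Hom C U U'; g \<in> Hom C V V'; h \<in> Hom C W W'\<rbrakk>
      \<Longrightarrow> Comp C (Tens C (Tens C U V) W) (Tens C (Tens C U' V') W') (Tens C U' (Tens C V' W'))
          (TensAssoc C U' V' W')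
          (TensMor C (Tens C U V) (Tens C U' V') W W' (TensMor C U U' V V' f g) h) =
        Comp C (Tens C (Tens C U V) W) (Tens C U (Tens C V W)) (Tens C U' (Tens C V' W'))
          (TensMor C U U' (Tens C V W) (Tens C V' W') f (TensMor C V V' W W' g h))
          (TensAssoc C U V W)"
    and left_unitor_iso: "V \<in> Obj C \<Longrightarrow> iso_mor C (Tens C (TensUnit C) V) V (LeftUnitor C V)"
    and left_unitor_natural: "\<lbrakk>V \<in> Obj C; V' \<in> Obj C; f \<in> Hom C V V'\<rbrakk>
      \<Longrightarrow> Comp C (Tens C (TensUnit C) V) (Tens C (TensUnit C) V') V' (LeftUnitor C V')
          (TensMor C (TensUnit C) (TensUnit C) V V' (Ident C (TensUnit C)) f) =
        Comp C (Tens C (TensUnit C) V) V V' f (LeftUnitor C V)"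
    and right_unitor_iso: "V \<in> Obj C \<Longrightarrow> iso_mor C (Tens C V (TensUnit C)) V (RightUnitor C V)"
    and right_unitor_natural: "\<lbrakk>V \<in> Obj C; V' \<in> Obj C; f \<in> Hom C V V'\<rbrakk>
      \<Longrightarrow> Comp C (Tens C V (TensUnit C)) (Tens C V' (TensUnit C)) V' (RightUnitor C V')
          (TensMor C V V' (TensUnit C) (TensUnit C) f (Ident C (TensUnit C))) =
        Comp C (Tens C V (TensUnit C)) V V' f (RightUnitor C V)"
    and pentagon: "\<lbrakk>T \<in> Obj C; U \<in> Obj C; V \<in> Obj C; W \<in> Obj C\<rbrakk>
      \<Longrightarrow> Comp C (Tens C (Tens C (Tens C T U) V) W) (Tens C (Tens C T U) (Tens C V W))
            (Tens C T (Tens C U (Tens C V W)))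
          (TensAssoc C T U (Tens C V W)) (TensAssoc C (Tens C T U) V W) =
        Comp C (Tens C (Tens C (Tens C T U) V) W) (Tens C T (Tens C (Tens C U V) W))
            (Tens C T (Tens C U (Tens C V W)))
          (TensMor C T T (Tens C (Tens C U V) W) (Tens C U (Tens C V W))
            (Ident C T) (TensAssoc C U V W))
          (Comp C (Tens C (Tens C (Tens C T U) V) W) (Tens C (Tens C T (Tens C U V)) W)
              (Tens C T (Tens C (Tens C U V) W))
            (TensAssoc C T (Tens C U V) W)
            (TensMor C (Tens C (Tens C T U) V) (Tens C T (Tens C U V)) W W
              (TensAssoc C T U V) (Ident C W)))"
    and triangle: "\<lbrakk>V \<in> Obj C; W \<in> Obj C\<rbrakk>
      \<Longrightarrow> Comp C (Tens C (Tens C V (TensUnit C)) W) (Tens C V (Tens C (TensUnit C) W)) (Tens C V W)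
          (TensMor C V V (Tens C (TensUnit C) W) W (Ident C V) (LeftUnitor C W))
          (TensAssoc C V (TensUnit C) W) =
        TensMor C (Tens C V (TensUnit C)) V W W (RightUnitor C V) (Ident C W)"

text \<open>In a module category over \<open>C\<close> (objects of type \<open>'v\<close>, morphisms of type \<open>'w\<close>), the
  constraints are \<open>ActAssoc M V W X : (V \<otimes> W) \<cdot> X \<rightarrow> V \<cdot> (W \<cdot> X)\<close> and
  \<open>ActUnitor M X : \<one> \<cdot> X \<rightarrow> X\<close>.\<close>

record ('v, 'w, 'o, 'm) modcat = "('o, 'm) lincat" +
  Act :: "'v \<Rightarrow> 'o \<Rightarrow> 'o"
  ActMor :: "'v \<Rightarrow> 'v \<Rightarrow> 'o \<Rightarrow> 'o \<Rightarrow> 'w \<Rightarrow> 'm \<Rightarrow> 'm"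
  ActAssoc :: "'v \<Rightarrow> 'v \<Rightarrow> 'o \<Rightarrow> 'm"
  ActUnitor :: "'o \<Rightarrow> 'm"

locale module_category = monoidal_category C + M: linear_category M
  for C :: "('v, 'w, 'z) moncat_scheme"
    and M :: "('v, 'w, 'o, 'm, 'y) modcat_scheme" +
  assumes act_closed: "\<lbrakk>V \<in> Obj C; X \<in> Obj M\<rbrakk> \<Longrightarrow> Act M V X \<in> Obj M"
    and act_mor_closed: "\<lbrakk>V \<in> Obj C; V' \<in> Obj C; X \<in> Obj M; X' \<in> Obj M;
        f \<in> Hom C V V'; g \<in> Hom M X X'\<rbrakk>
      \<Longrightarrow> ActMor M V V' X X' f g \<in> Hom M (Act M V X) (Act M V' X')"
    and act_ident: "\<lbrakk>V \<in> Obj C; X \<in> Obj M\<rbrakk>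
      \<Longrightarrow> ActMor M V V X X (Ident C V) (Ident M X) = Ident M (Act M V X)"
    and act_comp: "\<lbrakk>V \<in> Obj C; V' \<in> Obj C; V'' \<in> Obj C; X \<in> Obj M; X' \<in> Obj M; X'' \<in> Obj M;
        f \<in> Hom C V V'; f' \<in> Hom C V' V''; g \<in> Hom M X X'; g' \<in> Hom M X' X''\<rbrakk>
      \<Longrightarrow> ActMor M V V'' X X'' (Comp C V V' V'' f' f) (Comp M X X' X'' g' g) =
        Comp M (Act M V X) (Act M V' X') (Act M V'' X'')
          (ActMor M V' V'' X' X'' f' g') (ActMor M V V' X X' f g)"
    and act_add_left: "\<lbrakk>V \<in> Obj C; V' \<in> Obj C; X \<in> Obj M; X' \<in> Obj M;
        f \<in> Hom C V V'; f' \<in> Hom C V V'; g \<in> Hom M X X'\<rbrakk>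
      \<Longrightarrow> ActMor M V V' X X' (Add C V V' f f') g =
        Add M (Act M V X) (Act M V' X') (ActMor M V V' X X' f g) (ActMor M V V' X X' f' g)"
    and act_add_right: "\<lbrakk>V \<in> Obj C; V' \<in> Obj C; X \<in> Obj M; X' \<in> Obj M;
        f \<in> Hom C V V'; g \<in> Hom M X X'; g' \<in> Hom M X X'\<rbrakk>
      \<Longrightarrow> ActMor M V V' X X' f (Add M X X' g g') =
        Add M (Act M V X) (Act M V' X') (ActMor M V V' X X' f g) (ActMor M V V' X X' f g')"
    and act_scale_left: "\<lbrakk>V \<in> Obj C; V' \<in> Obj C; X \<in> Obj M; X' \<in> Obj M;
        f \<in> Hom C V V'; g \<in> Hom M X X'\<rbrakk>
      \<Longrightarrow> ActMor M V V' X X' (Scale C V V' a f) g =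
        Scale M (Act M V X) (Act M V' X') a (ActMor M V V' X X' f g)"
    and act_scale_right: "\<lbrakk>V \<in> Obj C; V' \<in> Obj C; X \<in> Obj M; X' \<in> Obj M;
        f \<in> Hom C V V'; g \<in> Hom M X X'\<rbrakk>
      \<Longrightarrow> ActMor M V V' X X' f (Scale M X X' a g) =
        Scale M (Act M V X) (Act M V' X') a (ActMor M V V' X X' f g)"
    and act_assoc_iso: "\<lbrakk>V \<in> Obj C; W \<in> Obj C; X \<in> Obj M\<rbrakk>
      \<Longrightarrow> iso_mor M (Act M (Tens C V W) X) (Act M V (Act M W X)) (ActAssoc M V W X)"
    and act_assoc_natural: "\<lbrakk>V \<in> Obj C; V' \<in> Obj C; W \<in> Obj C; W' \<in> Obj C; X \<in> Obj M; X' \<in> Obj M;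
        f \<in> Hom C V V'; f' \<in> Hom C W W'; g \<in> Hom M X X'\<rbrakk>
      \<Longrightarrow> Comp M (Act M (Tens C V W) X) (Act M (Tens C V' W') X') (Act M V' (Act M W' X'))
          (ActAssoc M V' W' X')
          (ActMor M (Tens C V W) (Tens C V' W') X X' (TensMor C V V' W W' f f') g) =
        Comp M (Act M (Tens C V W) X) (Act M V (Act M W X)) (Act M V' (Act M W' X'))
          (ActMor M V V' (Act M W X) (Act M W' X') f (ActMor M W W' X X' f' g))
          (ActAssoc M V W X)"
    and act_unitor_iso: "X \<in> Obj M \<Longrightarrow> iso_mor M (Act M (TensUnit C) X) X (ActUnitor M X)"
    and act_unitor_natural: "\<lbrakk>X \<in> Obj M; X' \<in> Obj M; g \<in> Hom M X X'\<rbrakk>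
      \<Longrightarrow> Comp M (Act M (TensUnit C) X) (Act M (TensUnit C) X') X' (ActUnitor M X')
          (ActMor M (TensUnit C) (TensUnit C) X X' (Ident C (TensUnit C)) g) =
        Comp M (Act M (TensUnit C) X) X X' g (ActUnitor M X)"
    and act_pentagon: "\<lbrakk>U \<in> Obj C; V \<in> Obj C; W \<in> Obj C; X \<in> Obj M\<rbrakk>
      \<Longrightarrow> Comp M (Act M (Tens C (Tens C U V) W) X) (Act M (Tens C U V) (Act M W X))
            (Act M U (Act M V (Act M W X)))
          (ActAssoc M U V (Act M W X)) (ActAssoc M (Tens C U V) W X) =
        Comp M (Act M (Tens C (Tens C U V) W) X) (Act M U (Act M (Tens C V W) X))
            (Act M U (Act M V (Act M W X)))
          (ActMor M U U (Act M (Tens C V W) X) (Act M V (Act M W X))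
            (Ident C U) (ActAssoc M V W X))
          (Comp M (Act M (Tens C (Tens C U V) W) X) (Act M (Tens C U (Tens C V W)) X)
              (Act M U (Act M (Tens C V W) X))
            (ActAssoc M U (Tens C V W) X)
            (ActMor M (Tens C (Tens C U V) W) (Tens C U (Tens C V W)) X X
              (TensAssoc C U V W) (Ident M X)))"
    and act_triangle: "\<lbrakk>V \<in> Obj C; X \<in> Obj M\<rbrakk>
      \<Longrightarrow> Comp M (Act M (Tens C V (TensUnit C)) X) (Act M V (Act M (TensUnit C) X)) (Act M V X)
          (ActMor M V V (Act M (TensUnit C) X) X (Ident C V) (ActUnitor M X))
          (ActAssoc M V (TensUnit C) X) =
        ActMor M (Tens C V (TensUnit C)) V X X (RightUnitor C V) (Ident M X)"

definition locally_finitary ::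
    "('v, 'w, 'z) moncat_scheme \<Rightarrow> ('v, 'w, 'o, 'm, 'y) modcat_scheme \<Rightarrow> bool" where
  "locally_finitary C M \<longleftrightarrow> module_category C M \<and> additive_category M \<and> idempotent_split M \<and>
     krull_schmidt M \<and> countably_many_indecomposables M \<and> finite_dim_homs M"

definition transitive_modcat ::
    "('v, 'w, 'z) moncat_scheme \<Rightarrow> ('v, 'w, 'o, 'm, 'y) modcat_scheme \<Rightarrow> bool" where
  "transitive_modcat C M \<longleftrightarrow> (\<forall>X Y. indecomposable M X \<and> indecomposable M Y \<longrightarrow>
     (\<exists>F\<in>Obj C. direct_summand M Y (Act M F X)))"

definition invariant_ideal ::
    "('v, 'w, 'z) moncat_scheme \<Rightarrow> ('v, 'w, 'o, 'm, 'y) modcat_scheme \<Rightarrow>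
      ('o \<Rightarrow> 'o \<Rightarrow> 'm set) \<Rightarrow> bool" where
  "invariant_ideal C M I \<longleftrightarrow> cat_ideal M I \<and>
     (\<forall>F\<in>Obj C. \<forall>X\<in>Obj M. \<forall>Y\<in>Obj M. \<forall>f\<in>I X Y.
        ActMor M F F X Y (Ident C F) f \<in> I (Act M F X) (Act M F Y))"

definition simple_transitive ::
    "('v, 'w, 'z) moncat_scheme \<Rightarrow> ('v, 'w, 'o, 'm, 'y) modcat_scheme \<Rightarrow> bool" where
  "simple_transitive C M \<longleftrightarrow> transitive_modcat C M \<and>
     (\<forall>I. invariant_ideal C M I \<longrightarrow> zero_ideal M I \<or> whole_ideal M I)"

definition maximal_invariant_ideal ::
    "('v, 'w, 'z) moncat_scheme \<Rightarrow> ('v, 'w, 'o, 'm, 'y) modcat_scheme \<Rightarrow>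
      ('o \<Rightarrow> 'o \<Rightarrow> 'm set) \<Rightarrow> bool" where
  "maximal_invariant_ideal C M I \<longleftrightarrow> invariant_ideal C M I \<and> \<not> whole_ideal M I \<and>
     (\<forall>J. invariant_ideal C M J \<and> \<not> whole_ideal M J \<longrightarrow>
        (\<forall>X\<in>Obj M. \<forall>Y\<in>Obj M. J X Y \<subseteq> I X Y))"

text \<open>The quotient \<open>M/I\<close>, whose morphisms are cosets. Each operation is the union of the
  cosets of the results on representatives; if \<open>I\<close> is a \<open>C\<close>-invariant ideal then all
  of these cosets coincide.\<close>

definition quotient_modcat ::
    "('v, 'w, 'z) moncat_scheme \<Rightarrow> ('v, 'w, 'o, 'm, 'y) modcat_scheme \<Rightarrow>
      ('o \<Rightarrow> 'o \<Rightarrow> 'm set) \<Rightarrow> ('v, 'w, 'o, 'm set) modcat" where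
  "quotient_modcat C M I =
    \<lparr>Obj = Obj M,
     Hom = (\<lambda>X Y. ideal_coset M I X Y ` Hom M X Y),
     Ident = (\<lambda>X. ideal_coset M I X X (Ident M X)),
     Comp = (\<lambda>X Y Z G F. \<Union>g\<in>G. \<Union>f\<in>F. ideal_coset M I X Z (Comp M X Y Z g f)),
     Zero = (\<lambda>X Y. ideal_coset M I X Y (Zero M X Y)),
     Add = (\<lambda>X Y F G. \<Union>f\<in>F. \<Union>g\<in>G. ideal_coset M I X Y (Add M X Y f g)),
     Scale = (\<lambda>X Y a F. \<Union>f\<in>F. ideal_coset M I X Y (Scale M X Y a f)),
     Act = Act M,
     ActMor = (\<lambda>V W X Y f G.
       \<Union>g\<in>G. ideal_coset M I (Act M V X) (Act M W Y) (ActMor M V W X Y f g)),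
     ActAssoc = (\<lambda>V W X.
       ideal_coset M I (Act M (Tens C V W) X) (Act M V (Act M W X)) (ActAssoc M V W X)),
     ActUnitor = (\<lambda>X. ideal_coset M I (Act M (TensUnit C) X) X (ActUnitor M X))\<rparr>"

definition simple_transitive_quotient ::
    "('v, 'w, 'z) moncat_scheme \<Rightarrow> ('v, 'w, 'o, 'm, 'y) modcat_scheme \<Rightarrow>
      ('v, 'w, 'o, 'm set) modcat \<Rightarrow> bool" where
  "simple_transitive_quotient C M Q \<longleftrightarrow>
     (\<exists>I. maximal_invariant_ideal C M I \<and> Q = quotient_modcat C M I)"

definition full_submodcat ::
    "('v, 'w, 'o, 'm, 'y) modcat_scheme \<Rightarrow> 'o set \<Rightarrow> ('v, 'w, 'o, 'm, 'y) modcat_scheme" where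
  "full_submodcat M S = M\<lparr>Obj := S\<rparr>"


section \<open>Finite dimensional modules over Lie algebras of matrices\<close>

text \<open>Every finite dimensional module is isomorphic to one with underlying space \<open>\<complex>\<^sup>n\<close>. We
  use the category of these: a module is a pair \<open>(n, \<rho>)\<close>, and a homomorphism is a matrix.
  The map \<open>\<rho>\<close> is required to be \<open>undefined\<close> outside the Lie algebra. The case
  \<open>n = 0\<close> is the zero module.\<close>

type_synonym lie_module = "nat \<times> (complex mat \<Rightarrow> complex mat)"

definition bracket :: "complex mat \<Rightarrow> complex mat \<Rightarrow> complex mat" where
  "bracket x y = x * y - y * x"

definition sl2 :: "complex mat set" where
  "sl2 = {x \<in> carrier_mat 2 2. x $$ (0, 0) + x $$ (1, 1) = 0}"

definition line :: "complex mat \<Rightarrow> complex mat set" where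
  "line g = {c \<cdot>\<^sub>m g | c. True}"

definition lie_modules :: "complex mat set \<Rightarrow> lie_module set" where
  "lie_modules L = {(n, \<rho>). \<rho> \<in> extensional L \<and>
     (\<forall>x\<in>L. \<rho> x \<in> carrier_mat n n) \<and>
     (\<forall>x\<in>L. \<forall>y\<in>L. \<rho> (x + y) = \<rho> x + \<rho> y) \<and>
     (\<forall>c. \<forall>x\<in>L. \<rho> (c \<cdot>\<^sub>m x) = c \<cdot>\<^sub>m \<rho> x) \<and>
     (\<forall>x\<in>L. \<forall>y\<in>L. \<rho> (bracket x y) = bracket (\<rho> x) (\<rho> y))}"

definition module_homs ::
    "complex mat set \<Rightarrow> lie_module \<Rightarrow> lie_module \<Rightarrow> complex mat set" where
  "module_homs L V W = {T \<in> carrier_mat (fst W) (fst V). \<forall>x\<in>L. T * snd V x = snd W x * T}"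

text \<open>The Kronecker product: the matrix of the tensor product of two linear maps with respect
  to the basis \<open>e\<^sub>i \<otimes> e\<^sub>j\<close> of \<open>\<complex>\<^sup>m \<otimes> \<complex>\<^sup>n = \<complex>\<^sup>m\<^sup>n\<close>, ordered lexicographically. With
  this identification the tensor product of modules is strictly associative and unital, so
  that the associativity and unit constraints are identity matrices.\<close>

definition kron :: "complex mat \<Rightarrow> complex mat \<Rightarrow> complex mat" where
  "kron A B = mat (dim_row A * dim_row B) (dim_col A * dim_col B)
     (\<lambda>(i, j). A $$ (i div dim_row B, j div dim_col B) * B $$ (i mod dim_row B, j mod dim_col B))"

definition module_tensor ::
    "complex mat set \<Rightarrow> lie_module \<Rightarrow> lie_module \<Rightarrow> lie_module" where
  "module_tensor L V W = (fst V * fst W,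
     \<lambda>x\<in>L. kron (snd V x) (1\<^sub>m (fst W)) + kron (1\<^sub>m (fst V)) (snd W x))"

definition module_restrict :: "complex mat set \<Rightarrow> lie_module \<Rightarrow> lie_module" where
  "module_restrict L V = (fst V, restrict (snd V) L)"

definition trivial_module :: "complex mat set \<Rightarrow> lie_module" where
  "trivial_module L = (1, \<lambda>x\<in>L. 0\<^sub>m 1 1)"

definition sl2_mod :: "(lie_module, complex mat) moncat" where
  "sl2_mod =
    \<lparr>Obj = lie_modules sl2,
     Hom = module_homs sl2,
     Ident = (\<lambda>V. 1\<^sub>m (fst V)),
     Comp = (\<lambda>U V W T S. T * S),
     Zero = (\<lambda>V W. 0\<^sub>m (fst W) (fst V)),
     Add = (\<lambda>V W S T. S + T),
     Scale = (\<lambda>V W c T. c \<cdot>\<^sub>m T),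
     TensUnit = trivial_module sl2,
     Tens = module_tensor sl2,
     TensMor = (\<lambda>V V' W W' S T. kron S T),
     TensAssoc = (\<lambda>U V W. 1\<^sub>m (fst U * fst V * fst W)),
     LeftUnitor = (\<lambda>V. 1\<^sub>m (fst V)),
     RightUnitor = (\<lambda>V. 1\<^sub>m (fst V))\<rparr>"

text \<open>The simple module \<open>L(1)\<close> of dimension \<open>2\<close> is the natural module.\<close>

definition natural_module :: lie_module where
  "natural_module = (2, \<lambda>x\<in>sl2. x)"

text \<open>All finite dimensional modules over a Lie subalgebra \<open>L\<close> of \<open>sl2\<close>, acted upon by
  \<open>V \<cdot> N = Res V \<otimes> N\<close>.\<close>

definition sub_mod ::
    "complex mat set \<Rightarrow> (lie_module, complex mat, lie_module, complex mat) modcat" where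
  "sub_mod L =
    \<lparr>Obj = lie_modules L,
     Hom = module_homs L,
     Ident = (\<lambda>N. 1\<^sub>m (fst N)),
     Comp = (\<lambda>N P Q T S. T * S),
     Zero = (\<lambda>N P. 0\<^sub>m (fst P) (fst N)),
     Add = (\<lambda>N P S T. S + T),
     Scale = (\<lambda>N P c T. c \<cdot>\<^sub>m T),
     Act = (\<lambda>V N. module_tensor L (module_restrict L V) N),
     ActMor = (\<lambda>V W N P S T. kron S T),
     ActAssoc = (\<lambda>V W N. 1\<^sub>m (fst V * fst W * fst N)),
     ActUnitor = (\<lambda>N. 1\<^sub>m (fst N))\<rparr>"

definition type_A_inf ::
    "(lie_module, complex mat, 'o, 'm, 'y) modcat_scheme \<Rightarrow> bool" where
  "type_A_inf M \<longleftrightarrow> (\<exists>X :: nat \<Rightarrow> 'o.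
     (\<forall>i. indecomposable M (X i)) \<and>
     (\<forall>i j. iso_obj M (X i) (X j) \<longrightarrow> i = j) \<and>
     (\<forall>Y. indecomposable M Y \<longrightarrow> (\<exists>i. iso_obj M Y (X i))) \<and>
     iso_obj M (Act M natural_module (X 0)) (X 1) \<and>
     (\<forall>i\<ge>1. biproduct M (Act M natural_module (X i)) (X (i - 1)) (X (i + 1))))"

definition type_A_inf_inf ::
    "(lie_module, complex mat, 'o, 'm, 'y) modcat_scheme \<Rightarrow> bool" where
  "type_A_inf_inf M \<longleftrightarrow> (\<exists>X :: int \<Rightarrow> 'o.
     (\<forall>i. indecomposable M (X i)) \<and>
     (\<forall>i j. iso_obj M (X i) (X j) \<longrightarrow> i = j) \<and>
     (\<forall>Y. indecomposable M Y \<longrightarrow> (\<exists>i. iso_obj M Y (X i))) \<and>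
     (\<forall>i. biproduct M (Act M natural_module (X i)) (X (i - 1)) (X (i + 1))))"


section \<open>The module categories attached to an element of \<open>sl2\<close>\<close>

definition nilpotent_mat :: "complex mat \<Rightarrow> bool" where
  "nilpotent_mat g \<longleftrightarrow> (\<exists>k. g ^\<^sub>m k = 0\<^sub>m (dim_row g) (dim_row g))"

definition semisimple_mat :: "complex mat \<Rightarrow> bool" where
  "semisimple_mat g \<longleftrightarrow> (\<exists>D. diagonal_mat D \<and> similar_mat g D)"

text \<open>For \<open>g \<noteq> 0\<close> and a square matrix \<open>A\<close>: the module over the line spanned by \<open>g\<close>, that is,
  over \<open>\<complex>[g]\<close>, on which \<open>g\<close> acts as \<open>A\<close>.\<close>

definition line_module :: "complex mat \<Rightarrow> complex mat \<Rightarrow> lie_module" where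
  "line_module g A = (dim_row A, \<lambda>x\<in>line g. (THE c. x = c \<cdot>\<^sub>m g) \<cdot>\<^sub>m A)"

definition jordan_module :: "complex mat \<Rightarrow> nat \<Rightarrow> complex \<Rightarrow> lie_module" where
  "jordan_module g n \<alpha> = line_module g (jordan_block n \<alpha>)"

definition one_dim_module :: "complex mat \<Rightarrow> complex \<Rightarrow> lie_module" where
  "one_dim_module g \<nu> = line_module g (mat 1 1 (\<lambda>_. \<nu>))"

definition Y_cat ::
    "complex mat \<Rightarrow> complex \<Rightarrow> (lie_module, complex mat, lie_module, complex mat) modcat" where
  "Y_cat g \<alpha> = full_submodcat (sub_mod (line g))
     (additive_closure (sub_mod (line g)) {jordan_module g n \<alpha> | n. n > 0})"

definition Y_tilde_cat ::
    "complex mat \<Rightarrow> complex \<Rightarrow> (lie_module, complex mat, lie_module, complex mat set) modcat" where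
  "Y_tilde_cat g \<alpha> = quotient_modcat sl2_mod (Y_cat g \<alpha>) (radical (Y_cat g \<alpha>))"

definition X_cat ::
    "complex mat \<Rightarrow> complex \<Rightarrow> complex \<Rightarrow>
      (lie_module, complex mat, lie_module, complex mat) modcat" where
  "X_cat g \<mu> \<alpha> = full_submodcat (sub_mod (line g))
     (additive_closure (sub_mod (line g)) {one_dim_module g (\<alpha> + of_int n * \<mu>) | n :: int. True})"

end

theory Submission
  imports Defs
begin

text \<open>The modules over the line spanned by \<open>g\<close> are classified by the Jordan normal form of the action of
  \<open>g\<close>, and the additive closures in question consist of the modules on which \<open>g\<close> has eigenvalues in
  \<open>\<Lambda>\<close>, and is diagonalisable in case (b); here \<open>\<Lambda> = {\<alpha>}\<close>, respectively \<open>\<Lambda> = \<alpha> + \<int>\<mu>\<close>. They are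
  stable under the action because, completing \<open>g\<close> to an \<open>sl2\<close>-triple, a nilpotent \<open>g\<close> acts nilpotently
  on every finite dimensional \<open>sl2\<close>-module, and a semisimple one acts diagonalisably with eigenvalues in
  \<open>\<int>\<mu>\<close>. The type of the module category is the Clebsch--Gordan rule for \<open>J\<^sub>2(0) \<otimes> 1 + 1 \<otimes> J\<^sub>n(\<alpha>)\<close>,
  respectively for \<open>diag(\<mu>, - \<mu>)\<close> tensored with a one-dimensional module, and transitivity follows.

  A morphism \<open>f\<close> lies in the radical iff \<open>tr (h f) = 0\<close> for all \<open>h\<close> in the opposite direction. A
  partial trace turns \<open>tr (h (1 \<otimes> f))\<close> into such an expression, so the radical is an invariant ideal.
  An ideal not contained in the radical contains the identity of some indecomposable, hence by
  transitivity all of them, so the radical is the maximal invariant ideal. In case (b) it is zero.\<close>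

subsection \<open>Matrices\<close>

text \<open>The action of a semisimple element is controlled without complete reducibility or the
  classification of simple modules. What is used of an \<open>sl2\<close>-triple is that
  \<open>E\<close> and \<open>F\<close> act nilpotently, because traces of commutators vanish, and
  that \<open>F^n E^n\<close> and \<open>E^n F^n\<close> are products of commuting linear
  polynomials in \<open>H\<close> and \<open>K = F E\<close>. Vanishing of both products forces
  integral eigenvalues of \<open>H\<close> and excludes Jordan chains of length two. Membership in
  an additive closure is awkward to test directly. A condition on eigenvectors and chains of length
  two makes stability under summands, sums and tensor products a matter of transporting vectors
  along intertwiners. Invertibility of \<open>1 - h f\<close> for all \<open>h\<close> says little
  about \<open>1 \<otimes> f\<close>, since a morphism between tensor products need not be a tensor
  product of morphisms; the trace condition is linear and does not have this defect. A nonzero trace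
  also suffices for invertibility on a Jordan module, because all diagonal entries of its
  endomorphisms are equal.\<close>

lemma mat_mult_index:
  "i < dim_row A \<Longrightarrow> j < dim_col B \<Longrightarrow> dim_col A = dim_row B \<Longrightarrow>
    (A * B) $$ (i, j) = (\<Sum>k<dim_row B. A $$ (i, k) * B $$ (k, j))"
  for A B :: "'a::comm_semiring_0 mat"
  by (simp add: scalar_prod_def lessThan_atLeast0)

lemma mat_assoc:
  "dim_col A = dim_row B \<Longrightarrow> dim_col B = dim_row C \<Longrightarrow> A * B * C = A * (B * C)"
  for A B C :: "'a::comm_semiring_0 mat"
  by (rule assoc_mult_mat[of _ "dim_row A" "dim_row B" _ "dim_row C" _ "dim_col C"]) auto

lemma mat_distribs:
  fixes A B C :: "'a::comm_ring_1 mat"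
  shows "dim_row B = dim_row C \<Longrightarrow> dim_col B = dim_col C \<Longrightarrow> dim_col A = dim_row C \<Longrightarrow>
      A * (B + C) = A * B + A * C"
    and "dim_row B = dim_row C \<Longrightarrow> dim_col B = dim_col C \<Longrightarrow> dim_col A = dim_row C \<Longrightarrow>
      A * (B - C) = A * B - A * C"
    and "dim_row B = dim_row C \<Longrightarrow> dim_col B = dim_col C \<Longrightarrow> dim_col C = dim_row A \<Longrightarrow>
      (B + C) * A = B * A + C * A"
    and "dim_row B = dim_row C \<Longrightarrow> dim_col B = dim_col C \<Longrightarrow> dim_col C = dim_row A \<Longrightarrow>
      (B - C) * A = B * A - C * A"
    and "dim_col A = dim_row B \<Longrightarrow> A * (k \<cdot>\<^sub>m B) = k \<cdot>\<^sub>m (A * B)"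
    and "dim_col A = dim_row B \<Longrightarrow> (k \<cdot>\<^sub>m A) * B = k \<cdot>\<^sub>m (A * B)"
  by (auto simp: mat_mult_index algebra_simps sum.distrib sum_subtractf sum_distrib_left
      simp del: index_mult_mat(1) intro!: eq_matI)

lemma mat_vec_simps:
  fixes A B :: "'a::field mat"
  shows "dim_col A = dim_row B \<Longrightarrow> dim_vec v = dim_col B \<Longrightarrow> A * B *\<^sub>v v = A *\<^sub>v (B *\<^sub>v v)"
    and "dim_row A = dim_row B \<Longrightarrow> dim_col A = dim_col B \<Longrightarrow> dim_vec v = dim_col B \<Longrightarrow>
      (A + B) *\<^sub>v v = A *\<^sub>v v + B *\<^sub>v v"
    and "dim_row A = dim_row B \<Longrightarrow> dim_col A = dim_col B \<Longrightarrow> dim_vec v = dim_col B \<Longrightarrow>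
      (A - B) *\<^sub>v v = A *\<^sub>v v - B *\<^sub>v v"
    and "dim_vec v = dim_col A \<Longrightarrow> (k \<cdot>\<^sub>m A) *\<^sub>v v = k \<cdot>\<^sub>v (A *\<^sub>v v)"
    and "dim_vec v = dim_col A \<Longrightarrow> dim_vec w = dim_col A \<Longrightarrow> A *\<^sub>v (v + w) = A *\<^sub>v v + A *\<^sub>v w"
    and "dim_vec v = dim_col A \<Longrightarrow> dim_vec w = dim_col A \<Longrightarrow> A *\<^sub>v (v - w) = A *\<^sub>v v - A *\<^sub>v w"
    and "dim_vec v = dim_col A \<Longrightarrow> A *\<^sub>v (k \<cdot>\<^sub>v v) = k \<cdot>\<^sub>v (A *\<^sub>v v)"
    and "dim_vec v = n \<Longrightarrow> 1\<^sub>m n *\<^sub>v v = v"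
    and "dim_vec v = n \<Longrightarrow> 0\<^sub>m m n *\<^sub>v v = 0\<^sub>v m"
    and "dim_col A = n \<Longrightarrow> A *\<^sub>v 0\<^sub>v n = 0\<^sub>v (dim_row A)"
proof -
  note c = carrier_vecI carrier_matI
  show "dim_col A = dim_row B \<Longrightarrow> dim_vec v = dim_col B \<Longrightarrow> A * B *\<^sub>v v = A *\<^sub>v (B *\<^sub>v v)"
    by (rule assoc_mult_mat_vec[of _ "dim_row A" "dim_row B" _ "dim_col B"]) (auto intro: c)
  show "dim_row A = dim_row B \<Longrightarrow> dim_col A = dim_col B \<Longrightarrow> dim_vec v = dim_col B \<Longrightarrow>
      (A + B) *\<^sub>v v = A *\<^sub>v v + B *\<^sub>v v"
    by (rule add_mult_distrib_mat_vec[of _ "dim_row B" "dim_col B"]) (auto intro: c)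
  show "dim_row A = dim_row B \<Longrightarrow> dim_col A = dim_col B \<Longrightarrow> dim_vec v = dim_col B \<Longrightarrow>
      (A - B) *\<^sub>v v = A *\<^sub>v v - B *\<^sub>v v"
    by (rule minus_mult_distrib_mat_vec[of _ "dim_row B" "dim_col B"]) (auto intro: c)
  show "dim_vec v = dim_col A \<Longrightarrow> (k \<cdot>\<^sub>m A) *\<^sub>v v = k \<cdot>\<^sub>v (A *\<^sub>v v)"
    by (rule eq_vecI) (auto simp: scalar_prod_def sum_distrib_left mult.assoc)
  show "dim_vec v = dim_col A \<Longrightarrow> dim_vec w = dim_col A \<Longrightarrow> A *\<^sub>v (v + w) = A *\<^sub>v v + A *\<^sub>v w"
    by (rule mult_add_distrib_mat_vec[of _ "dim_row A" "dim_col A"]) (auto intro: c)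
  show "dim_vec v = dim_col A \<Longrightarrow> dim_vec w = dim_col A \<Longrightarrow> A *\<^sub>v (v - w) = A *\<^sub>v v - A *\<^sub>v w"
    by (rule mult_minus_distrib_mat_vec[of _ "dim_row A" "dim_col A"]) (auto intro: c)
  show "dim_vec v = dim_col A \<Longrightarrow> A *\<^sub>v (k \<cdot>\<^sub>v v) = k \<cdot>\<^sub>v (A *\<^sub>v v)"
    by (rule mult_mat_vec[of _ "dim_row A" "dim_col A"]) (auto intro: c)
  show "dim_vec v = n \<Longrightarrow> 1\<^sub>m n *\<^sub>v v = v"
    by (rule one_mult_mat_vec) (rule c)
  show "dim_vec v = n \<Longrightarrow> 0\<^sub>m m n *\<^sub>v v = 0\<^sub>v m"
    by (rule eq_vecI) (auto simp: scalar_prod_def)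
  show "dim_col A = n \<Longrightarrow> A *\<^sub>v 0\<^sub>v n = 0\<^sub>v (dim_row A)"
    by (rule eq_vecI) (auto simp: scalar_prod_def)
qed

section \<open>Kronecker products\<close>

lemma sum_div_mod:
  "(\<Sum>k<m * n. f (k div n) (k mod n)) = (\<Sum>a<m. \<Sum>b<n. f a b)" for n :: nat
proof -
  have "(\<Sum>k = a * n..<a * n + n. f (k div n) (k mod n)) = (\<Sum>b<n. f a b)" for a
    by (subst sum.shift_bounds_nat_ivl[of _ 0 "a * n" n, simplified add.commute[of _ "a * n"], simplified])
      (auto intro!: sum.cong simp: lessThan_atLeast0)
  then show ?thesis
    by (simp flip: sum.nat_group)
qed

lemma div_mod_bounds: "i < m * n \<Longrightarrow> i div n < m \<and> i mod n < n" for i m n :: nat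
  by (metis less_mult_imp_div_less mod_less_divisor mult_0_right not_gr_zero not_less_zero)

lemma dim_kron [simp]:
  "dim_row (kron A B) = dim_row A * dim_row B" "dim_col (kron A B) = dim_col A * dim_col B"
  by (simp_all add: kron_def)

lemma kron_index:
  "i < dim_row A * dim_row B \<Longrightarrow> j < dim_col A * dim_col B \<Longrightarrow> kron A B $$ (i, j) =
    A $$ (i div dim_row B, j div dim_col B) * B $$ (i mod dim_row B, j mod dim_col B)"
  by (simp add: kron_def)

text \<open>Mixed product rule: with lexicographic indices the inner sum runs over all pairs
  \<open>(a, b)\<close>, and each summand is a factor in \<open>a\<close> times a factor in
  \<open>b\<close>. It reduces brackets and intertwining relations on tensor products to the two
  factors.\<close>

lemma kron_mult:
  assumes "dim_col A = dim_row C" "dim_col B = dim_row D"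
  shows "kron A B * kron C D = kron (A * C) (B * D)"
proof (rule eq_matI)
  fix i j assume ij: "i < dim_row (kron (A * C) (B * D))" "j < dim_col (kron (A * C) (B * D))"
  note bd = div_mod_bounds[of i] div_mod_bounds[of j]
  have "(kron A B * kron C D) $$ (i, j) = (\<Sum>k<dim_row C * dim_row D.
      (A $$ (i div dim_row B, k div dim_row D) * C $$ (k div dim_row D, j div dim_col D)) *
      (B $$ (i mod dim_row B, k mod dim_row D) * D $$ (k mod dim_row D, j mod dim_col D)))"
    using ij assms by (subst mat_mult_index) (auto intro!: sum.cong simp: kron_index)
  also have "\<dots> = (\<Sum>a<dim_row C. \<Sum>b<dim_row D.
      (A $$ (i div dim_row B, a) * C $$ (a, j div dim_col D)) *
      (B $$ (i mod dim_row B, b) * D $$ (b, j mod dim_col D)))"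
    by (rule sum_div_mod[where f = "\<lambda>a b. (A $$ (i div dim_row B, a) * C $$ (a, j div dim_col D)) *
      (B $$ (i mod dim_row B, b) * D $$ (b, j mod dim_col D))"])
  also have "\<dots> = kron (A * C) (B * D) $$ (i, j)"
    using ij bd assms by (simp add: kron_index mat_mult_index sum_product del: index_mult_mat(1))
  finally show "(kron A B * kron C D) $$ (i, j) = kron (A * C) (B * D) $$ (i, j)" .
qed (use assms in auto)

lemma kron_linear:
  "dim_row A = dim_row A' \<Longrightarrow> dim_col A = dim_col A' \<Longrightarrow> kron (A + A') B = kron A B + kron A' B"
  "dim_row B = dim_row B' \<Longrightarrow> dim_col B = dim_col B' \<Longrightarrow> kron A (B + B') = kron A B + kron A B'"
  "dim_row A = dim_row A' \<Longrightarrow> dim_col A = dim_col A' \<Longrightarrow> kron (A - A') B = kron A B - kron A' B"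
  "dim_row B = dim_row B' \<Longrightarrow> dim_col B = dim_col B' \<Longrightarrow> kron A (B - B') = kron A B - kron A B'"
  "kron (c \<cdot>\<^sub>m A) B = c \<cdot>\<^sub>m kron A B"
  "kron A (c \<cdot>\<^sub>m B) = c \<cdot>\<^sub>m kron A B"
  by (auto intro!: eq_matI simp: kron_index div_mod_bounds algebra_simps)

lemma kron_zero [simp]:
  "kron (0\<^sub>m m n) B = 0\<^sub>m (m * dim_row B) (n * dim_col B)"
  "kron A (0\<^sub>m m n) = 0\<^sub>m (dim_row A * m) (dim_col A * n)"
  by (auto intro!: eq_matI simp: kron_index div_mod_bounds)

lemma kron_one_one [simp]: "kron (1\<^sub>m m) (1\<^sub>m n) = 1\<^sub>m (m * n)"
proof (rule eq_matI)
  fix i j assume "i < dim_row (1\<^sub>m (m * n) :: complex mat)" "j < dim_col (1\<^sub>m (m * n) :: complex mat)"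
  then have ij: "i < m * n" "j < m * n" by auto
  then have "i div n < m" "j div n < m" "i mod n < n" "j mod n < n"
    using div_mod_bounds[of i m n] div_mod_bounds[of j m n] by simp_all
  moreover have "i = j \<longleftrightarrow> i div n = j div n \<and> i mod n = j mod n"
    using div_mult_mod_eq[of i n] div_mult_mod_eq[of j n] by metis
  ultimately show "kron (1\<^sub>m m) (1\<^sub>m n) $$ (i, j) = 1\<^sub>m (m * n) $$ (i, j)"
    using ij by (auto simp: kron_index)
qed auto

lemma kron_unit [simp]: "kron (1\<^sub>m (Suc 0)) A = A" "kron A (1\<^sub>m (Suc 0)) = A"
  by (auto intro!: eq_matI simp: kron_index)

text \<open>An index of the triple product has the same three lexicographic digits under both
  bracketings; \<open>split\<close> reads off the middle digit in the two possible ways. This strict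
  equality is what permits identity matrices as associativity constraints.\<close>

lemma kron_assoc: "kron (kron A B) C = kron A (kron B C)"
proof (rule eq_matI)
  fix i j assume "i < dim_row (kron A (kron B C))" "j < dim_col (kron A (kron B C))"
  then have ij: "i < dim_row A * dim_row B * dim_row C" "j < dim_col A * dim_col B * dim_col C"
    by (auto simp: mult.assoc)
  have "0 < dim_row C" "0 < dim_col C" using ij by (auto intro: Nat.gr0I)
  have split: "k mod (m * n) div n = k div n mod m" "k mod (m * n) mod n = k mod n"
    "k div (m * n) = k div n div m" if "0 < n" for k m n :: nat
    using that mod_mult2_eq[of k n m] div_mult2_eq[of k n m] by (simp_all only: mult.commute[of m n]) auto
  note eqs = split[OF \<open>0 < dim_row C\<close>] split[OF \<open>0 < dim_col C\<close>]
  have b: "i div dim_row C < dim_row A * dim_row B" "j div dim_col C < dim_col A * dim_col B"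
    "i mod (dim_row B * dim_row C) < dim_row B * dim_row C"
    "j mod (dim_col B * dim_col C) < dim_col B * dim_col C"
    using div_mod_bounds[OF ij(1)] div_mod_bounds[OF ij(2)]
      div_mod_bounds[OF ij(1)[unfolded mult.assoc]] div_mod_bounds[OF ij(2)[unfolded mult.assoc]]
    by blast+
  have "kron (kron A B) C $$ (i, j) =
      kron A B $$ (i div dim_row C, j div dim_col C) * C $$ (i mod dim_row C, j mod dim_col C)"
    by (rule kron_index[of i "kron A B" C j, unfolded dim_kron, OF ij])
  also have "kron A B $$ (i div dim_row C, j div dim_col C) =
      A $$ (i div dim_row C div dim_row B, j div dim_col C div dim_col B) *
      B $$ (i div dim_row C mod dim_row B, j div dim_col C mod dim_col B)"
    by (rule kron_index[OF b(1,2)])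
  also have "A $$ (i div dim_row C div dim_row B, j div dim_col C div dim_col B) *
      B $$ (i div dim_row C mod dim_row B, j div dim_col C mod dim_col B) *
      C $$ (i mod dim_row C, j mod dim_col C) =
      A $$ (i div dim_row C div dim_row B, j div dim_col C div dim_col B) *
      kron B C $$ (i mod (dim_row B * dim_row C), j mod (dim_col B * dim_col C))"
    unfolding kron_index[OF b(3,4)] eqs(1,2,4,5) by (rule mult.assoc)
  also have "\<dots> = kron A (kron B C) $$ (i, j)"
    unfolding kron_index[of i A "kron B C" j, unfolded dim_kron, OF ij[unfolded mult.assoc]] eqs(3,6) ..
  finally show "kron (kron A B) C $$ (i, j) = kron A (kron B C) $$ (i, j)" .
qed (simp_all add: mult.assoc)

section \<open>The trace\<close>

definition mtrace :: "complex mat \<Rightarrow> complex" where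
  "mtrace A = (\<Sum>i<dim_row A. A $$ (i, i))"

lemma mtrace_add [simp]:
  "dim_row A = dim_row B \<Longrightarrow> dim_col A = dim_col B \<Longrightarrow> dim_row B = dim_col B \<Longrightarrow>
    mtrace (A + B) = mtrace A + mtrace B"
  by (simp add: mtrace_def sum.distrib)

lemma mtrace_smult [simp]: "dim_row A = dim_col A \<Longrightarrow> mtrace (c \<cdot>\<^sub>m A) = c * mtrace A"
  by (simp add: mtrace_def sum_distrib_left)

lemma mtrace_zero [simp]: "mtrace (0\<^sub>m n n) = 0"
  by (simp add: mtrace_def)

lemma mtrace_comm:
  assumes "dim_row A = dim_col B" "dim_row B = dim_col A"
  shows "mtrace (A * B) = mtrace (B * A)"
proof -
  have "mtrace (A * B) = (\<Sum>i<dim_row A. \<Sum>k<dim_row B. A $$ (i, k) * B $$ (k, i))"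
    unfolding mtrace_def by (rule sum.cong) (use assms in \<open>auto simp: mat_mult_index simp del: index_mult_mat(1)\<close>)
  also have "\<dots> = (\<Sum>k<dim_row B. \<Sum>i<dim_row A. A $$ (i, k) * B $$ (k, i))"
    by (rule sum.swap)
  also have "\<dots> = mtrace (B * A)"
    unfolding mtrace_def by (rule sum.cong)
      (use assms in \<open>auto simp: mat_mult_index mult.commute simp del: index_mult_mat(1)\<close>)
  finally show ?thesis .
qed

subsection \<open>Modules over matrix Lie algebras\<close>

locale matrix_lie_algebra =
  fixes L :: "complex mat set"
  assumes add_mem: "x \<in> L \<Longrightarrow> y \<in> L \<Longrightarrow> x + y \<in> L"
    and smult_mem: "x \<in> L \<Longrightarrow> c \<cdot>\<^sub>m x \<in> L"
    and bracket_mem: "x \<in> L \<Longrightarrow> y \<in> L \<Longrightarrow> bracket x y \<in> L"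

lemma lie_module_dims:
  assumes "V \<in> lie_modules L" "x \<in> L"
  shows "dim_row (snd V x) = fst V" "dim_col (snd V x) = fst V"
  using assms by (auto simp: lie_modules_def)

lemma lie_module_hom:
  assumes "V \<in> lie_modules L" "x \<in> L" "y \<in> L"
  shows "snd V (x + y) = snd V x + snd V y" "snd V (c \<cdot>\<^sub>m x) = c \<cdot>\<^sub>m snd V x"
    "snd V (bracket x y) = bracket (snd V x) (snd V y)"
  using assms by (auto simp: lie_modules_def)

lemma lie_modules_extensional: "V \<in> lie_modules L \<Longrightarrow> snd V \<in> extensional L"
  by (auto simp: lie_modules_def)

lemma lie_modulesI:
  assumes "snd V \<in> extensional L"
    "\<And>x. x \<in> L \<Longrightarrow> dim_row (snd V x) = fst V" "\<And>x. x \<in> L \<Longrightarrow> dim_col (snd V x) = fst V"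
    "\<And>x y. x \<in> L \<Longrightarrow> y \<in> L \<Longrightarrow> snd V (x + y) = snd V x + snd V y"
    "\<And>x c. x \<in> L \<Longrightarrow> snd V (c \<cdot>\<^sub>m x) = c \<cdot>\<^sub>m snd V x"
    "\<And>x y. x \<in> L \<Longrightarrow> y \<in> L \<Longrightarrow> snd V (bracket x y) = bracket (snd V x) (snd V y)"
  shows "V \<in> lie_modules L"
  using assms unfolding lie_modules_def by (cases V) (auto intro!: carrier_matI)

lemma module_homsD:
  assumes "T \<in> module_homs L V W"
  shows "dim_row T = fst W" "dim_col T = fst V" "x \<in> L \<Longrightarrow> T * snd V x = snd W x * T"
  using assms by (auto simp: module_homs_def)

lemma module_homsI:
  assumes "dim_row T = fst W" "dim_col T = fst V" "\<And>x. x \<in> L \<Longrightarrow> T * snd V x = snd W x * T"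
  shows "T \<in> module_homs L V W"
  using assms by (auto simp: module_homs_def)

lemma module_homs_ident [simp]: "V \<in> lie_modules L \<Longrightarrow> 1\<^sub>m (fst V) \<in> module_homs L V V"
  by (rule module_homsI) (simp_all add: lie_module_dims)

lemma module_homs_comp:
  assumes "U \<in> lie_modules L" "V \<in> lie_modules L" "W \<in> lie_modules L"
    "S \<in> module_homs L U V" "T \<in> module_homs L V W"
  shows "T * S \<in> module_homs L U W"
proof (rule module_homsI)
  fix x assume x: "x \<in> L"
  note d = module_homsD(1,2)[OF assms(4)] module_homsD(1,2)[OF assms(5)]
    lie_module_dims[OF assms(1) x] lie_module_dims[OF assms(2) x] lie_module_dims[OF assms(3) x]
  have "T * S * snd U x = T * (snd V x * S)"
    using d module_homsD(3)[OF assms(4) x] by (simp add: mat_assoc)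
  also have "\<dots> = T * snd V x * S"
    using d by (simp add: mat_assoc)
  also have "\<dots> = snd W x * (T * S)"
    using d module_homsD(3)[OF assms(5) x] by (simp add: mat_assoc)
  finally show "T * S * snd U x = snd W x * (T * S)" .
qed (use assms in \<open>auto dest: module_homsD\<close>)

lemma module_homs_add:
  assumes "V \<in> lie_modules L" "W \<in> lie_modules L"
    "S \<in> module_homs L V W" "T \<in> module_homs L V W"
  shows "S + T \<in> module_homs L V W"
  using assms(3,4) lie_module_dims[OF assms(1)] lie_module_dims[OF assms(2)]
  by (intro module_homsI) (simp_all add: module_homsD mat_distribs)

lemma module_homs_smult:
  assumes "V \<in> lie_modules L" "W \<in> lie_modules L" "T \<in> module_homs L V W"
  shows "c \<cdot>\<^sub>m T \<in> module_homs L V W"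
  using assms(3) lie_module_dims[OF assms(1)] lie_module_dims[OF assms(2)]
  by (intro module_homsI) (simp_all add: module_homsD mat_distribs)

lemma module_homs_zero:
  assumes "V \<in> lie_modules L" "W \<in> lie_modules L"
  shows "0\<^sub>m (fst W) (fst V) \<in> module_homs L V W"
  using lie_module_dims[OF assms(1)] lie_module_dims[OF assms(2)]
  by (intro module_homsI) simp_all

text \<open>Formulated for an arbitrary record with the matrix operations, so that it serves both
  the monoidal category and the full subcategories of modules over a subalgebra.\<close>

lemma linear_category_modules:
  assumes "Obj C \<subseteq> lie_modules L" "Hom C = module_homs L" "Ident C = (\<lambda>V. 1\<^sub>m (fst V))"
    "Comp C = (\<lambda>U V W T S. T * S)" "Zero C = (\<lambda>V W. 0\<^sub>m (fst W) (fst V))"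
    "Add C = (\<lambda>V W S T. S + T)" "Scale C = (\<lambda>V W c T. c \<cdot>\<^sub>m T)"
  shows "linear_category C"
proof
  have mem: "X \<in> lie_modules L" if "X \<in> Obj C" for X
    using assms(1) that by blast
  fix W X Y Z a b f f' g g' h
  assume X: "X \<in> Obj C" "X \<in> Obj C"
  show "Ident C X \<in> Hom C X X"
    using X by (simp add: assms mem)
  assume Y: "Y \<in> Obj C"
  note XY = mem[OF X(1)] mem[OF Y]
  show "Zero C X Y \<in> Hom C X Y"
    using module_homs_zero[OF XY] by (simp add: assms)
  assume f: "f \<in> Hom C X Y"
  then have f': "dim_row f = fst Y" "dim_col f = fst X"
    by (simp_all add: assms module_homsD)
  show "Scale C X Y a f \<in> Hom C X Y"
    using module_homs_smult[OF XY] f by (simp add: assms)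
  show "Scale C X Y (a + b) f = Add C X Y (Scale C X Y a f) (Scale C X Y b f)"
    "Add C X Y f (Zero C X Y) = f" "Add C X Y f (Scale C X Y (- 1) f) = Zero C X Y"
    "Scale C X Y 1 f = f" "Scale C X Y a (Scale C X Y b f) = Scale C X Y (a * b) f"
    "Comp C X X Y f (Ident C X) = f" "Comp C X Y Y (Ident C Y) f = f"
    using f' by (auto simp: assms algebra_simps intro!: eq_matI)
  show "Add C X Y f g \<in> Hom C X Y" if "g \<in> Hom C X Y"
    using module_homs_add[OF XY] f that by (simp add: assms)
  show "Add C X Y f g = Add C X Y g f"
    "Scale C X Y a (Add C X Y f g) = Add C X Y (Scale C X Y a f) (Scale C X Y a g)"
    if "g \<in> Hom C X Y"
    using f' module_homsD(1,2) that by (auto simp: assms algebra_simps module_homsD(1,2) intro!: eq_matI)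
  show "Add C X Y (Add C X Y f g) h = Add C X Y f (Add C X Y g h)"
    if "g \<in> Hom C X Y" "h \<in> Hom C X Y"
    using f' module_homsD(1,2) that by (auto simp: assms algebra_simps module_homsD(1,2) intro!: eq_matI)
  assume Z: "Z \<in> Obj C"
  show "Comp C X Y Z g f \<in> Hom C X Z" if "g \<in> Hom C Y Z"
    using module_homs_comp[OF XY mem[OF Z]] f that by (simp add: assms)
  show "Comp C X Y Z g (Scale C X Y a f) = Scale C X Z a (Comp C X Y Z g f)"
    "Comp C X Y Z (Scale C Y Z a g) f = Scale C X Z a (Comp C X Y Z g f)"
    if "g \<in> Hom C Y Z"
    using f' that by (simp_all add: assms mat_distribs module_homsD(1,2))
  show "Comp C X Y Z g (Add C X Y f f') = Add C X Z (Comp C X Y Z g f) (Comp C X Y Z g f')"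
    if "f' \<in> Hom C X Y" "g \<in> Hom C Y Z"
    using f' that by (simp add: assms mat_distribs module_homsD(1,2))
  show "Comp C X Y Z (Add C Y Z g g') f = Add C X Z (Comp C X Y Z g f) (Comp C X Y Z g' f)"
    if "g \<in> Hom C Y Z" "g' \<in> Hom C Y Z"
    using f' that by (simp add: assms mat_distribs module_homsD(1,2))
next
  fix W X Y Z f g h
  assume "f \<in> Hom C W X" "g \<in> Hom C X Y" "h \<in> Hom C Y Z"
  then show "Comp C W X Z (Comp C X Y Z h g) f = Comp C W Y Z h (Comp C W X Y g f)"
    by (simp add: assms module_homsD mat_assoc)
qed

context matrix_lie_algebra begin

lemma trivial_module_closed: "trivial_module L \<in> lie_modules L"
  by (rule lie_modulesI)
    (auto simp: trivial_module_def add_mem smult_mem bracket_mem bracket_def[of "0\<^sub>m (Suc 0) (Suc 0)"] intro!: eq_matI)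

lemma snd_tensor [simp]:
  "x \<in> L \<Longrightarrow> snd (module_tensor L V W) x = kron (snd V x) (1\<^sub>m (fst W)) + kron (1\<^sub>m (fst V)) (snd W x)"
  by (simp add: module_tensor_def)

lemma fst_tensor [simp]: "fst (module_tensor L V W) = fst V * fst W"
  by (simp add: module_tensor_def)

lemma module_tensor_closed:
  assumes "V \<in> lie_modules L" "W \<in> lie_modules L"
  shows "module_tensor L V W \<in> lie_modules L"
proof (rule lie_modulesI)
  note d = lie_module_dims[OF assms(1)] lie_module_dims[OF assms(2)]
  note h = lie_module_hom[OF assms(1)] lie_module_hom[OF assms(2)]
  fix x y c assume x: "x \<in> L"
  show "snd (module_tensor L V W) (c \<cdot>\<^sub>m x) = c \<cdot>\<^sub>m snd (module_tensor L V W) x"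
    using x d by (auto simp: smult_mem h kron_linear algebra_simps intro!: eq_matI)
  assume y: "y \<in> L"
  show "snd (module_tensor L V W) (x + y) = snd (module_tensor L V W) x + snd (module_tensor L V W) y"
    using x y d by (auto simp: add_mem h kron_linear intro!: eq_matI)
  \<comment> \<open>The mixed terms \<open>kron (snd V x) (snd W y)\<close> and
    \<open>kron (snd V y) (snd W x)\<close> occur in both products of the commutator and
    cancel.\<close>
  show "snd (module_tensor L V W) (bracket x y) =
      bracket (snd (module_tensor L V W) x) (snd (module_tensor L V W) y)"
    using x y d
    by (simp add: bracket_mem h) (simp add: bracket_def kron_linear kron_mult mat_distribs,
      auto simp del: index_mult_mat(1) intro!: eq_matI)
qed (use lie_module_dims[OF assms(2)] in \<open>auto simp: module_tensor_def\<close>)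

lemma kron_hom:
  assumes "V \<in> lie_modules L" "V' \<in> lie_modules L" "W \<in> lie_modules L" "W' \<in> lie_modules L"
    "f \<in> module_homs L V V'" "g \<in> module_homs L W W'"
  shows "kron f g \<in> module_homs L (module_tensor L V W) (module_tensor L V' W')"
proof (rule module_homsI)
  fix x assume x: "x \<in> L"
  note d = lie_module_dims[OF assms(1) x] lie_module_dims[OF assms(2) x]
    lie_module_dims[OF assms(3) x] lie_module_dims[OF assms(4) x]
    module_homsD[OF assms(5)] module_homsD[OF assms(6)]
  show "kron f g * snd (module_tensor L V W) x = snd (module_tensor L V' W') x * kron f g"
    using x d by (simp add: mat_distribs kron_mult)
qed (use assms in \<open>simp_all add: module_homsD\<close>)

text \<open>An equality of objects, not only an isomorphism: the associativity constraint is an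
  identity matrix, so both bracketings must carry the same action.\<close>

lemma module_tensor_assoc:
  assumes "U \<in> lie_modules L" "V \<in> lie_modules L" "W \<in> lie_modules L"
  shows "module_tensor L (module_tensor L U V) W = module_tensor L U (module_tensor L V W)"
proof (rule prod_eqI)
  have "snd (module_tensor L (module_tensor L U V) W) x =
      snd (module_tensor L U (module_tensor L V W)) x" for x
  proof (cases "x \<in> L")
    case True
    note d = lie_module_dims[OF assms(1) True] lie_module_dims[OF assms(2) True]
      lie_module_dims[OF assms(3) True]
    have "kron (1\<^sub>m (fst U * fst V)) (snd W x) = kron (1\<^sub>m (fst U)) (kron (1\<^sub>m (fst V)) (snd W x))"
      by (simp flip: kron_assoc)
    moreover have "kron (kron (snd U x) (1\<^sub>m (fst V))) (1\<^sub>m (fst W)) = kron (snd U x) (1\<^sub>m (fst V * fst W))"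
      by (simp add: kron_assoc)
    ultimately show ?thesis
      using True d by (simp add: kron_linear kron_assoc)
        (subst assoc_add_mat, auto simp: mult.assoc intro!: carrier_matI)
  qed (simp add: module_tensor_def)
  then show "snd (module_tensor L (module_tensor L U V) W) = snd (module_tensor L U (module_tensor L V W))"
    by blast
qed (simp add: module_tensor_def mult.assoc)

text \<open>Equality of the two action maps off \<open>L\<close> is where extensionality of the
  representations enters.\<close>

lemma module_tensor_trivial:
  assumes "V \<in> lie_modules L"
  shows "module_tensor L (trivial_module L) V = V" "module_tensor L V (trivial_module L) = V"
proof -
  have "snd (module_tensor L (trivial_module L) V) x = snd V x" (is ?l)
    and "snd (module_tensor L V (trivial_module L)) x = snd V x" (is ?r) for x
  proof (atomize(full), cases "x \<in> L")
    case True
    with lie_module_dims[OF assms True] show "?l \<and> ?r"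
      by (auto simp: trivial_module_def intro!: eq_matI)
  next
    case False
    with lie_modules_extensional[OF assms] show "?l \<and> ?r"
      by (auto simp: module_tensor_def extensional_def)
  qed
  then show "module_tensor L (trivial_module L) V = V" "module_tensor L V (trivial_module L) = V"
    by (auto intro!: prod_eqI simp: trivial_module_def)
qed

end

section \<open>The monoidal category and its module categories\<close>

lemma sl2_lie_algebra: "matrix_lie_algebra sl2"
proof
  fix x y :: "complex mat" assume "x \<in> sl2" "y \<in> sl2"
  then show "bracket x y \<in> sl2"
    by (auto simp: sl2_def bracket_def scalar_prod_def algebra_simps numeral_2_eq_2)
qed (auto simp: sl2_def algebra_simps simp flip: distrib_left)

interpretation sl2: matrix_lie_algebra sl2
  by (rule sl2_lie_algebra)

lemma fst_trivial [simp]: "fst (trivial_module L) = Suc 0"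
  by (simp add: trivial_module_def)

text \<open>For the constraints, which are identity matrices on one and the same object. The size
  \<open>n\<close> is kept apart from \<open>fst V\<close> because the constraints may give it as a
  product of dimensions.\<close>

lemma inverse_mor_ident:
  assumes "Hom C = module_homs L" "Ident C = (\<lambda>V. 1\<^sub>m (fst V))" "Comp C = (\<lambda>U V W T S. T * S)"
    "V \<in> lie_modules L" "n = fst V"
  shows "iso_mor C V V (1\<^sub>m n)"
  unfolding iso_mor_def inverse_mor_def using assms by (intro exI[of _ "1\<^sub>m n"]) auto

lemma sl2_mod_simps [simp]:
  "Obj sl2_mod = lie_modules sl2" "Hom sl2_mod = module_homs sl2"
  "Ident sl2_mod = (\<lambda>V. 1\<^sub>m (fst V))" "Comp sl2_mod = (\<lambda>U V W T S. T * S)"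
  "Zero sl2_mod = (\<lambda>V W. 0\<^sub>m (fst W) (fst V))" "Add sl2_mod = (\<lambda>V W S T. S + T)"
  "Scale sl2_mod = (\<lambda>V W c T. c \<cdot>\<^sub>m T)" "TensUnit sl2_mod = trivial_module sl2"
  "Tens sl2_mod = module_tensor sl2" "TensMor sl2_mod = (\<lambda>V V' W W' S T. kron S T)"
  "TensAssoc sl2_mod = (\<lambda>U V W. 1\<^sub>m (fst U * fst V * fst W))"
  "LeftUnitor sl2_mod = (\<lambda>V. 1\<^sub>m (fst V))" "RightUnitor sl2_mod = (\<lambda>V. 1\<^sub>m (fst V))"
  by (simp_all add: sl2_mod_def)

lemma sl2_mod_monoidal: "monoidal_category sl2_mod"
proof -
  interpret linear_category sl2_mod
    by (rule linear_category_modules[of _ sl2]) simp_all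
  note iso = inverse_mor_ident[of sl2_mod sl2]
  show ?thesis
    by unfold_locales
      (auto simp: sl2.trivial_module_closed sl2.module_tensor_closed sl2.kron_hom kron_mult module_homsD
        kron_linear sl2.module_tensor_assoc sl2.module_tensor_trivial kron_assoc
        mult.assoc simp del: split_paired_All intro!: iso)
qed

lemma restrict_closed:
  assumes "matrix_lie_algebra L" "L \<subseteq> sl2" "V \<in> lie_modules sl2"
  shows "module_restrict L V \<in> lie_modules L"
proof -
  interpret matrix_lie_algebra L by fact
  show ?thesis
    by (rule lie_modulesI)
      (use assms(2) lie_module_dims[OF assms(3)] lie_module_hom[OF assms(3)]
        in \<open>auto simp: module_restrict_def add_mem smult_mem bracket_mem subset_iff\<close>)
qed

lemma restrict_homs: "L \<subseteq> sl2 \<Longrightarrow> f \<in> module_homs sl2 V W \<Longrightarrow>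
    f \<in> module_homs L (module_restrict L V) (module_restrict L W)"
  by (auto simp: module_homs_def module_restrict_def)

lemma restrict_tensor:
  assumes "matrix_lie_algebra L" "L \<subseteq> sl2"
  shows "module_restrict L (module_tensor sl2 V W) =
    module_tensor L (module_restrict L V) (module_restrict L W)"
  using assms(2) by (auto simp: module_restrict_def module_tensor_def restrict_def fun_eq_iff)

lemma restrict_trivial: "L \<subseteq> sl2 \<Longrightarrow> module_restrict L (trivial_module sl2) = trivial_module L"
  by (auto simp: module_restrict_def trivial_module_def restrict_def fun_eq_iff)

lemma fst_restrict [simp]: "fst (module_restrict L V) = fst V"
  by (simp add: module_restrict_def)

abbreviation sub_cat ::
    "complex mat set \<Rightarrow> lie_module set \<Rightarrow> (lie_module, complex mat, lie_module, complex mat) modcat"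
  where "sub_cat L S \<equiv> full_submodcat (sub_mod L) S"

lemma sub_cat_simps [simp]:
  "Obj (sub_cat L S) = S" "Hom (sub_cat L S) = module_homs L"
  "Ident (sub_cat L S) = (\<lambda>V. 1\<^sub>m (fst V))" "Comp (sub_cat L S) = (\<lambda>U V W T S. T * S)"
  "Zero (sub_cat L S) = (\<lambda>V W. 0\<^sub>m (fst W) (fst V))" "Add (sub_cat L S) = (\<lambda>V W S T. S + T)"
  "Scale (sub_cat L S) = (\<lambda>V W c T. c \<cdot>\<^sub>m T)"
  "Act (sub_cat L S) = (\<lambda>V N. module_tensor L (module_restrict L V) N)"
  "ActMor (sub_cat L S) = (\<lambda>V W N P S T. kron S T)"
  "ActAssoc (sub_cat L S) = (\<lambda>V W N. 1\<^sub>m (fst V * fst W * fst N))"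
  "ActUnitor (sub_cat L S) = (\<lambda>N. 1\<^sub>m (fst N))"
  by (simp_all add: full_submodcat_def sub_mod_def)

lemma sub_mod_eq: "sub_mod L = sub_cat L (lie_modules L)"
  by (simp add: full_submodcat_def sub_mod_def)

lemma sub_cat_linear: "S \<subseteq> lie_modules L \<Longrightarrow> linear_category (sub_cat L S)"
  by (rule linear_category_modules[of _ L]) simp_all

text \<open>Restriction to \<open>L\<close> commutes with tensor products and units on the nose, so
  the coherence laws reduce to identities of Kronecker products. Stability of \<open>S\<close> under
  the action is the input that depends on the case.\<close>

lemma sub_cat_module_category:
  assumes "matrix_lie_algebra L" "L \<subseteq> sl2" "S \<subseteq> lie_modules L"
    and act: "\<And>V N. V \<in> lie_modules sl2 \<Longrightarrow> N \<in> S \<Longrightarrow> module_tensor L (module_restrict L V) N \<in> S"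
  shows "module_category sl2_mod (sub_cat L S)"
proof -
  interpret matrix_lie_algebra L by fact
  interpret M: linear_category "sub_cat L S" by (rule sub_cat_linear) fact
  interpret monoidal_category sl2_mod by (rule sl2_mod_monoidal)
  note iso = inverse_mor_ident[of "sub_cat L S" L]
  have mem: "N \<in> lie_modules L" if "N \<in> S" for N
    using that assms(3) by blast
  note r = restrict_closed[OF assms(1,2)]
  show ?thesis
    by unfold_locales
      (auto simp: act kron_mult module_homsD kron_linear module_tensor_assoc module_tensor_trivial
        mem r kron_assoc restrict_tensor[OF assms(1,2)] restrict_trivial[OF assms(2)]
        mult.assoc
        simp del: split_paired_All intro!: iso kron_hom intro: restrict_homs[OF assms(2)])
qed

subsection \<open>Splitting idempotents\<close>

text \<open>Products are normalised to right-nested form by \<open>mat_assoc\<close>; this form lets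
  a relation \<open>A * B = C\<close> rewrite the head of a longer product.\<close>

lemma mat_mult_eq:
  "A * B = C \<Longrightarrow> dim_col A = dim_row B \<Longrightarrow> dim_col B = dim_row X \<Longrightarrow> A * (B * X) = C * X"
  for A B C X :: "'a::comm_semiring_0 mat"
  by (simp flip: mat_assoc)

lemma block_matrices:
  fixes n m :: nat
  obtains i j p q :: "complex mat"
  where "dim_row i = n + m" "dim_col i = n" "dim_row p = n" "dim_col p = n + m"
    "dim_row j = n + m" "dim_col j = m" "dim_row q = m" "dim_col q = n + m"
    "p * i = 1\<^sub>m n" "q * j = 1\<^sub>m m" "p * j = 0\<^sub>m n m" "q * i = 0\<^sub>m m n"
    "i * p + j * q = 1\<^sub>m (n + m)"
    "\<forall>A \<in> carrier_mat n n. \<forall>D \<in> carrier_mat m m.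
      four_block_mat A (0\<^sub>m n m) (0\<^sub>m m n) D * i = i * A \<and>
      four_block_mat A (0\<^sub>m n m) (0\<^sub>m m n) D * j = j * D \<and>
      p * four_block_mat A (0\<^sub>m n m) (0\<^sub>m m n) D = A * p \<and>
      q * four_block_mat A (0\<^sub>m n m) (0\<^sub>m m n) D = D * q"
proof -
  \<comment> \<open>Inclusions and projections of a direct sum of two coordinate spaces, padded with
    blocks of width or height 0, so that \<open>mult_four_block_mat\<close> computes all
    products.\<close>
  define i j p q :: "complex mat" where
    defs: "i = four_block_mat (1\<^sub>m n) (0\<^sub>m n 0) (0\<^sub>m m n) (0\<^sub>m m 0)"
      "j = four_block_mat (0\<^sub>m n m) (0\<^sub>m n 0) (1\<^sub>m m) (0\<^sub>m m 0)"
      "p = four_block_mat (1\<^sub>m n) (0\<^sub>m n m) (0\<^sub>m 0 n) (0\<^sub>m 0 m)"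
      "q = four_block_mat (0\<^sub>m m n) (1\<^sub>m m) (0\<^sub>m 0 n) (0\<^sub>m 0 m)"
  show thesis
  proof (rule that[of i p j q])
    show "p * i = 1\<^sub>m n"
      unfolding defs by (subst mult_four_block_mat[of _ "n" "n" _ "m" _ "0" _ _ "n" _ "0"]) (auto intro!: eq_matI)
    show "q * j = 1\<^sub>m m"
      unfolding defs by (subst mult_four_block_mat[of _ "m" "n" _ "m" _ "0" _ _ "m" _ "0"]) (auto intro!: eq_matI)
    show "p * j = 0\<^sub>m n m"
      unfolding defs by (subst mult_four_block_mat[of _ "n" "n" _ "m" _ "0" _ _ "m" _ "0"]) (auto intro!: eq_matI)
    show "q * i = 0\<^sub>m m n"
      unfolding defs by (subst mult_four_block_mat[of _ "m" "n" _ "m" _ "0" _ _ "n" _ "0"]) (auto intro!: eq_matI)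
    show "i * p + j * q = 1\<^sub>m (n + m)"
      unfolding defs
      by (subst mult_four_block_mat[of _ "n" "n" _ "0" _ "m" _ _ "n" _ "m"], simp_all, subst mult_four_block_mat[of _ "n" "m" _ "0" _ "m" _ _ "n" _ "m"], simp_all) (auto intro!: eq_matI)
  next
    have "four_block_mat A (0\<^sub>m n m) (0\<^sub>m m n) D * i = i * A \<and>
      four_block_mat A (0\<^sub>m n m) (0\<^sub>m m n) D * j = j * D \<and>
      p * four_block_mat A (0\<^sub>m n m) (0\<^sub>m m n) D = A * p \<and>
      q * four_block_mat A (0\<^sub>m n m) (0\<^sub>m m n) D = D * q"
      if AD: "A \<in> carrier_mat n n" "D \<in> carrier_mat m m" for A D
    proof -
      have AD0: "four_block_mat A (0\<^sub>m n 0) (0\<^sub>m 0 n) (0\<^sub>m 0 0) = A" "four_block_mat D (0\<^sub>m m 0) (0\<^sub>m 0 m) (0\<^sub>m 0 0) = D"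
        using AD by (auto intro!: eq_matI)
      have "four_block_mat A (0\<^sub>m n m) (0\<^sub>m m n) D * i = four_block_mat A (0\<^sub>m n 0) (0\<^sub>m m n) (0\<^sub>m m 0)"
        unfolding defs by (subst mult_four_block_mat[of _ "n" "n" _ "m" _ "m" _ _ "n" _ "0"]) (use AD in auto)
      moreover have "i * four_block_mat A (0\<^sub>m n 0) (0\<^sub>m 0 n) (0\<^sub>m 0 0) = four_block_mat A (0\<^sub>m n 0) (0\<^sub>m m n) (0\<^sub>m m 0)"
        unfolding defs by (subst mult_four_block_mat[of _ "n" "n" _ "0" _ "m" _ _ "n" _ "0"]) (use AD in auto)
      moreover have "four_block_mat A (0\<^sub>m n m) (0\<^sub>m m n) D * j = four_block_mat (0\<^sub>m n m) (0\<^sub>m n 0) D (0\<^sub>m m 0)"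
        unfolding defs by (subst mult_four_block_mat[of _ "n" "n" _ "m" _ "m" _ _ "m" _ "0"]) (use AD in auto)
      moreover have "j * four_block_mat D (0\<^sub>m m 0) (0\<^sub>m 0 m) (0\<^sub>m 0 0) = four_block_mat (0\<^sub>m n m) (0\<^sub>m n 0) D (0\<^sub>m m 0)"
        unfolding defs by (subst mult_four_block_mat[of _ "n" "m" _ "0" _ "m" _ _ "m" _ "0"]) (use AD in auto)
      moreover have "p * four_block_mat A (0\<^sub>m n m) (0\<^sub>m m n) D = four_block_mat A (0\<^sub>m n m) (0\<^sub>m 0 n) (0\<^sub>m 0 m)"
        unfolding defs by (subst mult_four_block_mat[of _ "n" "n" _ "m" _ "0" _ _ "n" _ "m"]) (use AD in auto)
      moreover have "four_block_mat A (0\<^sub>m n 0) (0\<^sub>m 0 n) (0\<^sub>m 0 0) * p = four_block_mat A (0\<^sub>m n m) (0\<^sub>m 0 n) (0\<^sub>m 0 m)"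
        unfolding defs by (subst mult_four_block_mat[of _ "n" "n" _ "0" _ "0" _ _ "n" _ "m"]) (use AD in auto)
      moreover have "q * four_block_mat A (0\<^sub>m n m) (0\<^sub>m m n) D = four_block_mat (0\<^sub>m m n) D (0\<^sub>m 0 n) (0\<^sub>m 0 m)"
        unfolding defs by (subst mult_four_block_mat[of _ "m" "n" _ "m" _ "0" _ _ "n" _ "m"]) (use AD in auto)
      moreover have "four_block_mat D (0\<^sub>m m 0) (0\<^sub>m 0 m) (0\<^sub>m 0 0) * q = four_block_mat (0\<^sub>m m n) D (0\<^sub>m 0 n) (0\<^sub>m 0 m)"
        unfolding defs by (subst mult_four_block_mat[of _ "m" "m" _ "0" _ "0" _ _ "n" _ "m"]) (use AD in auto)
      ultimately show ?thesis
        by (simp only: AD0 simp_thms)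
    qed
    then show "\<forall>A \<in> carrier_mat n n. \<forall>D \<in> carrier_mat m m.
      four_block_mat A (0\<^sub>m n m) (0\<^sub>m m n) D * i = i * A \<and>
      four_block_mat A (0\<^sub>m n m) (0\<^sub>m m n) D * j = j * D \<and>
      p * four_block_mat A (0\<^sub>m n m) (0\<^sub>m m n) D = A * p \<and>
      q * four_block_mat A (0\<^sub>m n m) (0\<^sub>m m n) D = D * q"
      by blast
  qed (simp_all add: defs)
qed

text \<open>If \<open>r\<close> exceeded \<open>n\<close>, padding with zeros would give square
  matrices with a one-sided, hence two-sided, inverse, although the last rows of
  \<open>i1 * i\<close> are zero.\<close>

lemma mat_left_inverse_le:
  fixes i p :: "complex mat"
  assumes "i \<in> carrier_mat n r" "p \<in> carrier_mat r n" "p * i = 1\<^sub>m r"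
  shows "r \<le> n"
proof (rule ccontr)
  assume "\<not> r \<le> n"
  then obtain k where k: "r = n + k" "0 < k"
    by (metis less_imp_add_positive not_le)
  obtain i1 j1 p1 q1 :: "complex mat" where bl:
    "dim_row i1 = n + k" "dim_col i1 = n" "dim_row p1 = n" "dim_col p1 = n + k"
    "dim_row j1 = n + k" "dim_col j1 = k" "dim_row q1 = k" "dim_col q1 = n + k"
    "p1 * i1 = 1\<^sub>m n" "q1 * j1 = 1\<^sub>m k" "p1 * j1 = 0\<^sub>m n k" "q1 * i1 = 0\<^sub>m k n"
    by (rule block_matrices)
  have d: "dim_row i = n" "dim_col i = r" "dim_row p = r" "dim_col p = n"
    using assms by auto
  have "(p * p1) * (i1 * i) = 1\<^sub>m r"
    using d bl k assms(3) by (simp add: mat_assoc mat_mult_eq[OF bl(9)])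
  moreover have "p * p1 \<in> carrier_mat r r" "i1 * i \<in> carrier_mat r r"
    by (rule carrier_matI; simp add: d bl k)+
  ultimately have "(i1 * i) * (p * p1) = 1\<^sub>m r"
    using mat_mult_left_right_inverse by blast
  then have "q1 * ((i1 * i) * (p * p1)) * j1 = q1 * j1"
    using bl k by simp
  then have "1\<^sub>m k = (0\<^sub>m k k :: complex mat)"
    using d bl k by (simp add: mat_assoc mat_mult_eq[OF bl(12)])
  then have "(1\<^sub>m k :: complex mat) $$ (0, 0) = (0\<^sub>m k k :: complex mat) $$ (0, 0)"
    by simp
  with k show False by simp
qed

text \<open>A rank factorisation: \<open>r\<close> is the largest size of a pair
  \<open>(i, p)\<close> with \<open>p * i = 1\<close> that is absorbed by \<open>e\<close>, and
  \<open>mat_left_inverse_le\<close> bounds it by \<open>n\<close>. The rest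
  \<open>f = e - i * p\<close> is again idempotent, and a nonzero entry of it would supply one more
  dimension.\<close>

lemma idempotent_split_mat:
  fixes e :: "complex mat"
  assumes e: "e \<in> carrier_mat n n" "e * e = e"
  obtains r i p where "i \<in> carrier_mat n r" "p \<in> carrier_mat r n" "p * i = 1\<^sub>m r" "i * p = e"
proof -
  define P where "P r \<longleftrightarrow> (\<exists>i p. i \<in> carrier_mat n r \<and> p \<in> carrier_mat r n \<and> p * i = 1\<^sub>m r \<and>
    e * i = i \<and> p * e = p)" for r
  have "P 0"
    unfolding P_def using e by (intro exI[of _ "0\<^sub>m n 0"] exI[of _ "0\<^sub>m 0 n"]) (auto intro: eq_matI)
  moreover have bound: "r \<le> n" if "P r" for r
    using that mat_left_inverse_le unfolding P_def by blast
  ultimately have "P (Greatest P)"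
    by (rule GreatestI_nat)
  then obtain i p where ip: "i \<in> carrier_mat n (Greatest P)" "p \<in> carrier_mat (Greatest P) n"
    "p * i = 1\<^sub>m (Greatest P)" "e * i = i" "p * e = p"
    unfolding P_def by blast
  define r where "r = Greatest P"
  note ip = ip[folded r_def]
  have d: "dim_row i = n" "dim_col i = r" "dim_row p = r" "dim_col p = n" "dim_row e = n" "dim_col e = n"
    using ip e by auto
  define f where "f = e - i * p"
  have fd: "dim_row f = n" "dim_col f = n"
    using d by (simp_all add: f_def)
  have ff: "e * f = f" "f * e = f" "p * f = 0\<^sub>m r n" "f * i = 0\<^sub>m n r"
    using d ip e unfolding f_def
    by (auto simp: mat_distribs mat_assoc mat_mult_eq[OF ip(4)] mat_mult_eq[OF ip(3)] intro!: eq_matI)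
  have ff2: "f * f = f"
  proof -
    have "f * f = f * e - f * i * p"
      using d fd by (subst (2) f_def) (simp add: mat_distribs mat_assoc)
    then show ?thesis using ff d fd by (auto intro!: eq_matI)
  qed
  have "f = 0\<^sub>m n n"
  proof (rule ccontr)
    assume "f \<noteq> 0\<^sub>m n n"
    then obtain a b where ab: "a < n" "b < n" "f $$ (a, b) \<noteq> 0"
      using fd by (metis eq_matI index_zero_mat)
    \<comment> \<open>\<open>f * Eb\<close> is column \<open>b\<close> of \<open>f\<close>, and
      \<open>Ea\<close> is scaled so that \<open>Ea * f * Eb\<close> is the identity of size 1; the
      pair \<open>(f * Eb, Ea * f)\<close> splits off a piece of rank one.\<close>
    define Eb where "Eb = mat n 1 (\<lambda>(k, _). if k = b then 1 else 0 :: complex)"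
    define Ea where "Ea = mat 1 n (\<lambda>(_, k). if k = a then 1 / f $$ (a, b) else 0 :: complex)"
    have Ed: "dim_row Eb = n" "dim_col Eb = 1" "dim_row Ea = 1" "dim_col Ea = n"
      by (simp_all add: Ea_def Eb_def)
    have one: "Ea * (f * Eb) = 1\<^sub>m 1"
    proof (rule eq_matI)
      fix k l assume "k < dim_row (1\<^sub>m 1 :: complex mat)" "l < dim_col (1\<^sub>m 1 :: complex mat)"
      then have kl: "k = 0" "l = 0" by auto
      have "(Ea * (f * Eb)) $$ (0, 0) = (\<Sum>c<n. Ea $$ (0, c) * (\<Sum>d<n. f $$ (c, d) * Eb $$ (d, 0)))"
        using Ed fd by (simp add: mat_mult_index del: index_mult_mat(1))
      also have "\<dots> = (\<Sum>c<n. Ea $$ (0, c) * f $$ (c, b))"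
        using ab by (subst sum.remove[of _ b]) (auto simp: Eb_def)
      also have "\<dots> = 1"
        using ab by (subst sum.remove[of _ a]) (auto simp: Ea_def)
      finally show "(Ea * (f * Eb)) $$ (k, l) = 1\<^sub>m 1 $$ (k, l)"
        using kl by simp
    qed (simp_all add: Ed)
    obtain i1 j1 p1 q1 :: "complex mat" where bl:
      "dim_row i1 = r + 1" "dim_col i1 = r" "dim_row p1 = r" "dim_col p1 = r + 1"
      "dim_row j1 = r + 1" "dim_col j1 = 1" "dim_row q1 = 1" "dim_col q1 = r + 1"
      "p1 * i1 = 1\<^sub>m r" "q1 * j1 = 1\<^sub>m 1" "p1 * j1 = 0\<^sub>m r 1" "q1 * i1 = 0\<^sub>m 1 r"
      "i1 * p1 + j1 * q1 = 1\<^sub>m (r + 1)"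
      by (rule block_matrices)
    define i' where "i' = i * p1 + f * Eb * q1"
    define p' where "p' = i1 * p + j1 * Ea * f"
    note eqs = mat_mult_eq[OF ff(1)] mat_mult_eq[OF ff(2)] mat_mult_eq[OF ff(3)] mat_mult_eq[OF ff(4)]
      mat_mult_eq[OF ff2] mat_mult_eq[OF ip(3)] mat_mult_eq[OF ip(4)] mat_mult_eq[OF ip(5)]
    have "p' * i' = i1 * p1 + j1 * ((Ea * (f * Eb)) * q1)"
      using d fd Ed bl(1-8) by (simp add: p'_def i'_def mat_distribs mat_assoc eqs)
        (auto intro!: eq_matI simp del: index_mult_mat(1))
    then have "p' * i' = 1\<^sub>m (r + 1)"
      using bl unfolding one by simp
    moreover have "e * i' = i'" "p' * e = p'"
      using d fd Ed bl(1-8) by (simp_all add: p'_def i'_def mat_distribs mat_assoc eqs ip ff)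
    ultimately have "P (r + 1)"
      unfolding P_def using d fd Ed bl(1-8)
      by (intro exI[of _ i'] exI[of _ p']) (auto simp: p'_def i'_def)
    then have "r + 1 \<le> Greatest P"
      by (rule Greatest_le_nat[of P _ n]) (rule bound)
    then show False
      by (simp add: r_def)
  qed
  then have "(e - i * p) $$ (a, b) = 0" if "a < n" "b < n" for a b
    using that unfolding f_def by simp
  then have "i * p = e"
    using d by (intro eq_matI) (auto simp del: index_mult_mat(1))
  then show thesis
    using that ip by blast
qed

subsection \<open>Jordan normal form, traces and nilpotency\<close>

lemma jordan_nf_complex:
  fixes A :: "complex mat"
  assumes "A \<in> carrier_mat n n"
  obtains ns P Q where "0 \<notin> fst ` set ns" "similar_mat_wit A (jordan_matrix ns) P Q"
    "sum_list (map fst ns) = n"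
proof -
  obtain ns where ns: "jordan_nf A ns"
    using jordan_nf_exists[OF assms] char_poly_factorized[OF assms] by blast
  then obtain P Q where w: "similar_mat_wit A (jordan_matrix ns) P Q"
    unfolding jordan_nf_def similar_mat_def by blast
  then have "jordan_matrix ns \<in> carrier_mat n n"
    using similar_mat_witD2[OF assms w] by blast
  then have "sum_list (map fst ns) = n" by auto
  with ns w show thesis
    by (intro that) (auto simp: jordan_nf_def)
qed

lemma jordan_matrix_upper [simp]: "upper_triangular (jordan_matrix ns)"
  using jordan_matrix_upper_triangular[of _ ns] by (auto simp: upper_triangular_def)

lemma upper_triangular_mult:
  fixes A B :: "complex mat"
  assumes A: "A \<in> carrier_mat n n" "upper_triangular A" and B: "B \<in> carrier_mat n n" "upper_triangular B"
  shows "upper_triangular (A * B)" "i < n \<Longrightarrow> (A * B) $$ (i, i) = A $$ (i, i) * B $$ (i, i)"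
proof -
  have d: "dim_row A = n" "dim_col A = n" "dim_row B = n" "dim_col B = n"
    using A B by auto
  have zero: "A $$ (i, l) * B $$ (l, j) = 0" if "i < n" "l < n" "l < i \<or> j < l" for i j l
    using that A B d by (auto dest: upper_triangularD)
  have "(A * B) $$ (i, j) = 0" if "j < i" "i < n" for i j
  proof -
    have "(\<Sum>l<n. A $$ (i, l) * B $$ (l, j)) = 0"
      using that by (intro sum.neutral ballI zero) auto
    then show ?thesis using that d by (simp add: mat_mult_index del: index_mult_mat(1))
  qed
  then show "upper_triangular (A * B)"
    using d by (auto simp: upper_triangular_def simp del: index_mult_mat(1))
  assume i: "i < n"
  have "(\<Sum>l\<in>{..<n} - {i}. A $$ (i, l) * B $$ (l, i)) = 0"
    using i by (intro sum.neutral ballI zero) auto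
  then show "(A * B) $$ (i, i) = A $$ (i, i) * B $$ (i, i)"
    using i d by (simp add: mat_mult_index sum.remove[of _ i] del: index_mult_mat(1))
qed

lemma upper_triangular_pow:
  fixes U :: "complex mat"
  assumes U: "U \<in> carrier_mat n n" "upper_triangular U"
  shows "upper_triangular (U ^\<^sub>m k) \<and> (\<forall>i<n. (U ^\<^sub>m k) $$ (i, i) = U $$ (i, i) ^ k)"
proof (induction k)
  case (Suc k)
  then show ?case
    using U upper_triangular_mult[OF _ _ U, of "U ^\<^sub>m k"] by simp
qed (use U in \<open>auto simp: upper_triangular_def\<close>)

text \<open>\<open>d\<close> lists the diagonal of the Jordan form, that is, the eigenvalues with
  multiplicity; the diagonal of a power of a triangular matrix consists of the powers of its
  diagonal entries.\<close>

lemma trace_pow_eigenvalues: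
  assumes A: "A \<in> carrier_mat n n"
  obtains d where "\<And>z. eigenvalue A z \<longleftrightarrow> (\<exists>i<n. d i = z)"
    "\<And>k. mtrace (A ^\<^sub>m k) = (\<Sum>i<n. d i ^ k)"
proof -
  obtain ns P Q where w: "similar_mat_wit A (jordan_matrix ns) P Q"
    and sz: "sum_list (map fst ns) = n"
    by (rule jordan_nf_complex[OF A])
  let ?J = "jordan_matrix ns"
  have J: "?J \<in> carrier_mat n n" using sz by auto
  note wd = similar_mat_witD2[OF A w]
  define d where "d = (\<lambda>i. ?J $$ (i, i))"
  have "eigenvalue A z \<longleftrightarrow> (\<exists>i<n. d i = z)" for z
  proof -
    have "char_poly A = char_poly ?J"
      using w by (intro char_poly_similar) (auto simp: similar_mat_def)
    also have "\<dots> = (\<Prod>a\<leftarrow>diag_mat ?J. [:- a, 1:])"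
      by (rule char_poly_upper_triangular[OF J]) simp
    finally have "poly (char_poly A) z = (\<Prod>a\<leftarrow>diag_mat ?J. z - a)"
      by (simp add: poly_prod_list o_def)
    also have "\<dots> = 0 \<longleftrightarrow> (\<exists>i<n. d i = z)"
      using sz by (auto simp: prod_list_zero_iff diag_mat_def d_def)
    finally show ?thesis
      using eigenvalue_root_char_poly[OF A] by simp
  qed
  moreover have "mtrace (A ^\<^sub>m k) = (\<Sum>i<n. d i ^ k)" for k
  proof -
    have Jk: "?J ^\<^sub>m k \<in> carrier_mat n n" using J by simp
    then have "mtrace (A ^\<^sub>m k) = mtrace (?J ^\<^sub>m k)"
      unfolding similar_mat_wit_pow_id[OF w, of k]
      using wd Jk mtrace_comm[of "P * ?J ^\<^sub>m k" Q] mat_mult_eq[OF wd(2), of "?J ^\<^sub>m k"]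
      by (metis carrier_matD index_mult_mat(2,3) left_mult_one_mat)
    also have "\<dots> = (\<Sum>i<n. d i ^ k)"
      using upper_triangular_pow[OF J, of k] carrier_matD(1)[OF Jk] by (simp add: mtrace_def d_def del: pow_mat_dim)
    finally show ?thesis .
  qed
  ultimately show thesis by (rule that)
qed

text \<open>In characteristic \<open>0\<close> the power sums of the eigenvalues detect nonzero eigenvalues: a polynomial
  with zero constant term that vanishes at all eigenvalues but one has a nonzero trace on \<open>A\<close>.\<close>

lemma trace_pow_zero_imp_eigenvalue_zero:
  assumes A: "A \<in> carrier_mat n n" and tr: "\<And>k. k > 0 \<Longrightarrow> mtrace (A ^\<^sub>m k) = 0"
    and ev: "eigenvalue A z"
  shows "z = 0"
proof (rule ccontr)
  assume z: "z \<noteq> 0"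
  obtain d where d: "\<And>z. eigenvalue A z \<longleftrightarrow> (\<exists>i<n. d i = z)"
    "\<And>k. mtrace (A ^\<^sub>m k) = (\<Sum>i<n. d i ^ k)"
    using trace_pow_eigenvalues[OF A] by blast
  define D where "D = d ` {..<n} - {z}"
  define p where "p = [:0, 1:] * (\<Prod>y\<in>D. [:- y, 1:])"
  have finD: "finite D" by (simp add: D_def)
  have pz: "poly p z \<noteq> 0" and p0: "coeff p 0 = 0"
    using z finD by (auto simp: p_def poly_prod D_def coeff_mult)
  have pd: "poly p (d i) = (if d i = z then poly p z else 0)" if "i < n" for i
    using that finD by (auto simp: p_def poly_prod D_def)
  have "(\<Sum>i<n. poly p (d i)) = (\<Sum>k\<le>degree p. coeff p k * (\<Sum>i<n. d i ^ k))"
    unfolding poly_altdef sum_distrib_left by (rule sum.swap)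
  also have "\<dots> = 0"
  proof (rule sum.neutral, intro ballI)
    fix k show "coeff p k * (\<Sum>i<n. d i ^ k) = 0"
      using tr[of k] d(2)[of k] p0 by (cases "k = 0") auto
  qed
  finally have "(\<Sum>i<n. if d i = z then poly p z else 0) = 0"
    using pd by simp
  moreover have "(\<Sum>i<n. if d i = z then poly p z else 0) = of_nat (card {i\<in>{..<n}. d i = z}) * poly p z"
    by (simp flip: sum.inter_filter)
  ultimately have "card {i\<in>{..<n}. d i = z} = 0"
    using pz by simp
  with ev d(1)[of z] show False
    by (auto simp: card_eq_0_iff)
qed

lemma eigenvalue_zero_imp_trace_zero:
  assumes A: "A \<in> carrier_mat n n" and ev: "\<And>z. eigenvalue A z \<Longrightarrow> z = 0"
  shows "mtrace A = 0"
proof -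
  obtain d where d: "\<And>z. eigenvalue A z \<longleftrightarrow> (\<exists>i<n. d i = z)"
    "\<And>k. mtrace (A ^\<^sub>m k) = (\<Sum>i<n. d i ^ k)"
    using trace_pow_eigenvalues[OF A] by blast
  have "d i = 0" if "i < n" for i
    using d(1) ev that by blast
  then show ?thesis
    using d(2)[of 1] A by simp
qed

text \<open>All diagonal entries of the Jordan form vanish, so its \<open>k\<close>-th power is zero
  at every position with \<open>j < i + k\<close>; for \<open>k = n\<close> these are all
  positions.\<close>

lemma eigenvalue_zero_imp_nilpotent:
  fixes A :: "complex mat"
  assumes A: "A \<in> carrier_mat n n" and ev: "\<And>z. eigenvalue A z \<Longrightarrow> z = 0"
  shows "A ^\<^sub>m n = 0\<^sub>m n n"
proof -
  obtain ns P Q where w: "similar_mat_wit A (jordan_matrix ns) P Q"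
    and sz: "sum_list (map fst ns) = n"
    by (rule jordan_nf_complex[OF A])
  let ?J = "jordan_matrix ns"
  have J: "?J \<in> carrier_mat n n" using sz by auto
  note wd = similar_mat_witD2[OF A w]
  have "char_poly A = (\<Prod>a\<leftarrow>diag_mat ?J. [:- a, 1:])"
    using w char_poly_upper_triangular[OF J] char_poly_similar[of A ?J] by (auto simp: similar_mat_def)
  then have "poly (char_poly A) (?J $$ (i, i)) = 0" if "i < n" for i
    using that sz by (auto simp: poly_prod_list prod_list_zero_iff diag_mat_def)
  then have diag: "?J $$ (i, i) = 0" if "i < n" for i
    using that ev eigenvalue_root_char_poly[OF A] by blast
  have Jk: "(?J ^\<^sub>m k) $$ (i, j) = 0" if "i < n" "j < n" "j < i + k" for i j k
    using that
  proof (induction k arbitrary: j)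
    case (Suc k)
    have "(?J ^\<^sub>m k) $$ (i, l) * ?J $$ (l, j) = 0" if "l < n" for l
      using that Suc diag[of l] J jordan_matrix_upper_triangular[of l ns j] sz
      by (cases "l < j"; cases "l = j") auto
    then show ?case
      using Suc.prems carrier_matD[OF J] carrier_matD[OF pow_carrier_mat[OF J, of k]]
      by (simp only: pow_mat.simps mat_mult_index) (auto intro!: sum.neutral)
  qed (use J in auto)
  have "?J ^\<^sub>m n = 0\<^sub>m n n"
    using sz by (intro eq_matI) (auto simp: Jk)
  then show ?thesis
    unfolding similar_mat_wit_pow_id[OF w, of n] using wd by auto
qed

text \<open>\<open>spec_in \<Lambda> ss A\<close>: all eigenvalues of \<open>A\<close> lie in \<open>\<Lambda>\<close> and, if \<open>ss\<close> holds, \<open>A\<close> is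
  diagonalisable, in the form \<open>ker (A - z)\<^sup>2 = ker (A - z)\<close>. Part (a) uses \<open>\<Lambda> = {\<alpha>}\<close> without
  \<open>ss\<close>, part (b) uses \<open>\<Lambda> = \<alpha> + \<int>\<mu>\<close> with \<open>ss\<close>.\<close>

definition spec_in :: "complex set \<Rightarrow> bool \<Rightarrow> complex mat \<Rightarrow> bool" where
  "spec_in \<Lambda> ss A \<longleftrightarrow> (\<forall>z. eigenvalue A z \<longrightarrow> z \<in> \<Lambda>) \<and>
     (ss \<longrightarrow> (\<forall>v w z. dim_vec v = dim_row A \<and> dim_vec w = dim_row A \<and>
        A *\<^sub>v v = z \<cdot>\<^sub>v v + w \<and> A *\<^sub>v w = z \<cdot>\<^sub>v w \<longrightarrow> w = 0\<^sub>v (dim_row A)))"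

lemma vec_add_zero: "dim_vec v = n \<Longrightarrow> v + 0\<^sub>v n = v" for v :: "complex vec"
  by (rule eq_vecI) auto

lemma eigenvalueI:
  "dim_vec v = dim_row A \<Longrightarrow> v \<noteq> 0\<^sub>v (dim_row A) \<Longrightarrow> A *\<^sub>v v = z \<cdot>\<^sub>v v \<Longrightarrow> eigenvalue A z"
  unfolding eigenvalue_def eigenvector_def by (auto intro: carrier_vecI)

lemma eigenvalueE:
  assumes "eigenvalue A z"
  obtains v where "dim_vec v = dim_row A" "v \<noteq> 0\<^sub>v (dim_row A)" "A *\<^sub>v v = z \<cdot>\<^sub>v v"
  using assms unfolding eigenvalue_def eigenvector_def by (auto dest: carrier_vecD)

lemma spec_inI:
  assumes "\<And>v z. dim_vec v = dim_row A \<Longrightarrow> v \<noteq> 0\<^sub>v (dim_row A) \<Longrightarrow> A *\<^sub>v v = z \<cdot>\<^sub>v v \<Longrightarrow> z \<in> \<Lambda>"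
    "\<And>v w z. ss \<Longrightarrow> dim_vec v = dim_row A \<Longrightarrow> dim_vec w = dim_row A \<Longrightarrow>
      A *\<^sub>v v = z \<cdot>\<^sub>v v + w \<Longrightarrow> A *\<^sub>v w = z \<cdot>\<^sub>v w \<Longrightarrow> w = 0\<^sub>v (dim_row A)"
  shows "spec_in \<Lambda> ss A"
  using assms unfolding spec_in_def by (auto elim!: eigenvalueE)

lemma spec_inD:
  assumes "spec_in \<Lambda> ss A"
  shows "dim_vec v = dim_row A \<Longrightarrow> v \<noteq> 0\<^sub>v (dim_row A) \<Longrightarrow> A *\<^sub>v v = z \<cdot>\<^sub>v v \<Longrightarrow> z \<in> \<Lambda>"
    and "ss \<Longrightarrow> dim_vec v = dim_row A \<Longrightarrow> dim_vec w = dim_row A \<Longrightarrow>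
      A *\<^sub>v v = z \<cdot>\<^sub>v v + w \<Longrightarrow> A *\<^sub>v w = z \<cdot>\<^sub>v w \<Longrightarrow> w = 0\<^sub>v (dim_row A)"
  using assms unfolding spec_in_def by (blast intro: eigenvalueI)+

lemma spec_in_UNIV: "spec_in UNIV False A"
  by (simp add: spec_in_def)

text \<open>The split injection \<open>i\<close> maps eigenvectors and Jordan chains of length two
  of \<open>B\<close> to such of \<open>A\<close>.\<close>

lemma spec_in_summand:
  assumes A: "spec_in \<Lambda> ss A" "A \<in> carrier_mat n n" and B: "B \<in> carrier_mat m m"
    and i: "i \<in> carrier_mat n m" "p \<in> carrier_mat m n" "p * i = 1\<^sub>m m" "A * i = i * B"
  shows "spec_in \<Lambda> ss B"
proof (rule spec_inI)
  have d: "dim_row A = n" "dim_col A = n" "dim_row B = m" "dim_col B = m" "dim_row i = n" "dim_col i = m"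
    "dim_row p = m" "dim_col p = n"
    using A B i by auto
  have inj: "v = 0\<^sub>v m" if "i *\<^sub>v v = 0\<^sub>v n" "dim_vec v = m" for v
  proof -
    have "v = p *\<^sub>v (i *\<^sub>v v)"
      using that(2) d mat_vec_simps(1)[of p i v] by (simp add: i(3) mat_vec_simps(8))
    then show ?thesis using that d by (simp add: mat_vec_simps)
  qed
  have comm: "A *\<^sub>v (i *\<^sub>v v) = i *\<^sub>v (B *\<^sub>v v)" if "dim_vec v = m" for v
    using that d i(4) by (simp flip: mat_vec_simps(1))
  fix v w :: "complex vec" and z assume v: "dim_vec v = dim_row B"
  show "z \<in> \<Lambda>" if "v \<noteq> 0\<^sub>v (dim_row B)" "B *\<^sub>v v = z \<cdot>\<^sub>v v"
    using spec_inD(1)[OF A(1), of "i *\<^sub>v v" z] that v d inj[of v] comm[of v] by (auto simp: mat_vec_simps)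
  assume "ss" "dim_vec w = dim_row B" "B *\<^sub>v v = z \<cdot>\<^sub>v v + w" "B *\<^sub>v w = z \<cdot>\<^sub>v w"
  then show "w = 0\<^sub>v (dim_row B)"
    using spec_inD(2)[OF A(1), of "i *\<^sub>v v" "i *\<^sub>v w" z] v d inj[of w] comm[of v] comm[of w]
    by (auto simp: mat_vec_simps)
qed

text \<open>\<open>E k\<close> maps an eigenvector of \<open>A\<close> for \<open>z\<close> to zero
  or to an eigenvector of \<open>B k\<close> for \<open>z - c k\<close>, and it respects chains of
  length two in the same way; joint injectivity leaves some image nonzero. With \<open>c = 0\<close>
  this covers biproducts, with weights for \<open>c\<close> it covers tensor products with a
  diagonalisable factor.\<close>

lemma spec_in_jointly_injective:
  assumes A: "A \<in> carrier_mat n n"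
    and E: "\<And>k. k \<in> K \<Longrightarrow> E k \<in> carrier_mat (m k) n" "\<And>k. k \<in> K \<Longrightarrow> B k \<in> carrier_mat (m k) (m k)"
    and comm: "\<And>k. k \<in> K \<Longrightarrow> E k * A = B k * E k + c k \<cdot>\<^sub>m E k"
    and inj: "\<And>v. dim_vec v = n \<Longrightarrow> (\<And>k. k \<in> K \<Longrightarrow> E k *\<^sub>v v = 0\<^sub>v (m k)) \<Longrightarrow> v = 0\<^sub>v n"
    and B: "\<And>k. k \<in> K \<Longrightarrow> spec_in \<Lambda> ss (B k)"
    and shift: "\<And>k z. k \<in> K \<Longrightarrow> z \<in> \<Lambda> \<Longrightarrow> z + c k \<in> \<Lambda>"
  shows "spec_in \<Lambda> ss A"
proof (rule spec_inI)
  have d: "dim_row A = n" "dim_col A = n" using A by auto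
  have dk: "dim_row (E k) = m k" "dim_col (E k) = n" "dim_row (B k) = m k" "dim_col (B k) = m k"
    if "k \<in> K" for k using E[OF that] by auto
  have comm': "B k *\<^sub>v (E k *\<^sub>v v) = (z - c k) \<cdot>\<^sub>v (E k *\<^sub>v v) + E k *\<^sub>v w"
    if k: "k \<in> K" and v: "dim_vec v = n" "dim_vec w = n" "A *\<^sub>v v = z \<cdot>\<^sub>v v + w" for k v w z
  proof -
    note dk = dk[OF k]
    have "E k *\<^sub>v (z \<cdot>\<^sub>v v + w) = B k *\<^sub>v (E k *\<^sub>v v) + c k \<cdot>\<^sub>v (E k *\<^sub>v v)"
      using comm[OF k] v dk d mat_vec_simps(1)[of "E k" A v]
      by (simp add: mat_vec_simps)
    then have eq: "z \<cdot>\<^sub>v (E k *\<^sub>v v) + E k *\<^sub>v w = B k *\<^sub>v (E k *\<^sub>v v) + c k \<cdot>\<^sub>v (E k *\<^sub>v v)"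
      using v dk by (simp add: mat_vec_simps)
    show ?thesis
    proof (rule eq_vecI)
      fix a assume "a < dim_vec ((z - c k) \<cdot>\<^sub>v (E k *\<^sub>v v) + E k *\<^sub>v w)"
      then have a: "a < m k" using dk by simp
      from arg_cong[OF eq, of "\<lambda>x. x $ a"] show "(B k *\<^sub>v (E k *\<^sub>v v)) $ a =
          ((z - c k) \<cdot>\<^sub>v (E k *\<^sub>v v) + E k *\<^sub>v w) $ a"
        using a dk by (simp add: algebra_simps del: index_mult_mat_vec)
    qed (use dk in simp)
  qed
  fix v w :: "complex vec" and z assume v: "dim_vec v = dim_row A"
  {
    assume nz: "v \<noteq> 0\<^sub>v (dim_row A)" and eq: "A *\<^sub>v v = z \<cdot>\<^sub>v v"
    then obtain k where k: "k \<in> K" "E k *\<^sub>v v \<noteq> 0\<^sub>v (m k)"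
      using inj[of v] v d by auto
    have "A *\<^sub>v v = z \<cdot>\<^sub>v v + 0\<^sub>v n"
      using eq v d by auto
    from comm'[OF k(1) _ _ this] have "B k *\<^sub>v (E k *\<^sub>v v) = (z - c k) \<cdot>\<^sub>v (E k *\<^sub>v v)"
      using v d dk[OF k(1)] by (simp add: mat_vec_simps vec_add_zero)
    then have "z - c k \<in> \<Lambda>"
      using spec_inD(1)[OF B[OF k(1)], of "E k *\<^sub>v v"] k dk[OF k(1)] by simp
    with shift[OF k(1)] show "z \<in> \<Lambda>" by fastforce
  }
  assume ss: "ss" "dim_vec w = dim_row A" "A *\<^sub>v v = z \<cdot>\<^sub>v v + w" "A *\<^sub>v w = z \<cdot>\<^sub>v w"
  then have w: "A *\<^sub>v w = z \<cdot>\<^sub>v w + 0\<^sub>v n"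
    using d by auto
  have "E k *\<^sub>v w = 0\<^sub>v (m k)" if k: "k \<in> K" for k
    using spec_inD(2)[OF B[OF k] ss(1), of "E k *\<^sub>v v" "E k *\<^sub>v w" "z - c k"]
      comm'[OF k _ _ ss(3)] comm'[OF k _ _ w] v ss d dk[OF k] by (simp add: mat_vec_simps vec_add_zero)
  then show "w = 0\<^sub>v (dim_row A)"
    using inj ss d by auto
qed

lemma spec_in_biproduct:
  assumes A: "A \<in> carrier_mat n n" and BD: "B \<in> carrier_mat m m" "D \<in> carrier_mat k k"
    and "i \<in> carrier_mat n m" "p \<in> carrier_mat m n" "j \<in> carrier_mat n k" "q \<in> carrier_mat k n"
    and one: "i * p + j * q = 1\<^sub>m n" and comm: "p * A = B * p" "q * A = D * q"
    and spec: "spec_in \<Lambda> ss B" "spec_in \<Lambda> ss D"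
  shows "spec_in \<Lambda> ss A"
proof (rule spec_in_jointly_injective[where K = UNIV and E = "\<lambda>b. if b then p else q" and
      B = "\<lambda>b. if b then B else D" and m = "\<lambda>b. if b then m else k" and c = "\<lambda>_. 0"])
  fix v :: "complex vec"
  assume v: "dim_vec v = n" "\<And>b. b \<in> UNIV \<Longrightarrow> (if b then p else q) *\<^sub>v v = 0\<^sub>v (if b then m else k)"
  have "(i * p + j * q) *\<^sub>v v = i *\<^sub>v (p *\<^sub>v v) + j *\<^sub>v (q *\<^sub>v v)"
    using v assms(4-7) by (simp add: mat_vec_simps)
  also have "\<dots> = 0\<^sub>v n"
    using v(2)[of True] v(2)[of False] assms(4-7) by (simp add: mat_vec_simps)
  finally show "v = 0\<^sub>v n"
    using v by (simp add: one mat_vec_simps)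
qed (use assms in auto)

lemma spec_in_jordan_block:
  "spec_in \<Lambda> ss (jordan_block n z) \<longleftrightarrow> n = 0 \<or> z \<in> \<Lambda> \<and> (ss \<longrightarrow> n = 1)"
proof -
  have ev: "eigenvalue (jordan_block n z) y \<longleftrightarrow> n \<noteq> 0 \<and> y = z" for y
    by (auto simp: eigenvalue_root_char_poly[OF jordan_block_carrier] jordan_block_char_poly)
  have "w = 0\<^sub>v n"
    if "n \<le> 1" "dim_vec v = n" "dim_vec w = n" "jordan_block n z *\<^sub>v v = y \<cdot>\<^sub>v v + w"
      "jordan_block n z *\<^sub>v w = y \<cdot>\<^sub>v w" for v w y
  proof (rule eq_vecI)
    fix i assume "i < dim_vec (0\<^sub>v n :: complex vec)"
    then have "i = 0" "n = 1" using that by auto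
    with arg_cong[OF that(4), of "\<lambda>x. x $ 0"] arg_cong[OF that(5), of "\<lambda>x. x $ 0"] that
    have "z * v $ 0 = y * v $ 0 + w $ 0" "z * w $ 0 = y * w $ 0"
      by (auto simp: scalar_prod_def)
    then have "w $ 0 = 0" by (cases "z = y") auto
    with \<open>i = 0\<close> \<open>n = 1\<close> show "w $ i = 0\<^sub>v n $ i" by simp
  qed (use that in simp)
  moreover have "\<exists>v w y. dim_vec v = n \<and> dim_vec w = n \<and> jordan_block n z *\<^sub>v v = y \<cdot>\<^sub>v v + w \<and>
      jordan_block n z *\<^sub>v w = y \<cdot>\<^sub>v w \<and> w \<noteq> 0\<^sub>v n" if "1 < n"
  proof (intro exI conjI)
    have 1: "(\<Sum>k<n. (if i = k then z else if Suc i = k then 1 else 0) * (if k = j then 1 else 0)) =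
        (if i = j then z else if Suc i = j then 1 else 0)" if "j < n" for i j
      using that by (subst sum.remove[of _ j]) auto
    \<comment> \<open>The first two basis vectors form a Jordan chain of length two, which is what
      \<open>ss\<close> forbids.\<close>
    show "jordan_block n z *\<^sub>v unit_vec n 1 = z \<cdot>\<^sub>v unit_vec n 1 + unit_vec n 0"
      using that by (intro eq_vecI) (auto simp: scalar_prod_def unit_vec_def lessThan_atLeast0[symmetric] 1)
    show "jordan_block n z *\<^sub>v unit_vec n 0 = z \<cdot>\<^sub>v unit_vec n 0"
      using that by (intro eq_vecI) (auto simp: scalar_prod_def unit_vec_def lessThan_atLeast0[symmetric] 1)
    have "unit_vec n 0 $ 0 \<noteq> (0\<^sub>v n :: complex vec) $ 0"
      using that by simp
    then show "unit_vec n 0 \<noteq> (0\<^sub>v n :: complex vec)" by metis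
  qed simp_all
  ultimately show ?thesis
    unfolding spec_in_def ev by (cases "1 < n") (auto simp: not_less le_Suc_eq)
qed

lemma spec_in_similar:
  assumes "spec_in \<Lambda> ss A" "A \<in> carrier_mat n n" "similar_mat_wit A B P Q"
  shows "spec_in \<Lambda> ss B"
proof -
  note d = similar_mat_witD2[OF assms(2,3)]
  have "A * P = P * (B * (Q * P))"
    unfolding d(3) using d(5-7) by (auto simp: mat_assoc)
  then have "A * P = P * B"
    unfolding d(2) using d(5) by simp
  with d assms(1) show ?thesis
    by (intro spec_in_summand[of _ _ A n B n P Q])
qed

text \<open>Splitting off the first block exhibits it and the remaining matrix as direct summands,
  so the spectral condition descends to every block by \<open>spec_in_summand\<close>.\<close>

lemma jordan_matrix_blocks:
  assumes "spec_in \<Lambda> ss (jordan_matrix ns)" "(n, z) \<in> set ns" "n > 0"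
  shows "z \<in> \<Lambda>" "ss \<longrightarrow> n = 1"
proof -
  have "spec_in \<Lambda> ss (jordan_block n z)" using assms(1,2)
  proof (induction ns)
    case (Cons b ns)
    obtain k y where b: "b = (k, y)" by force
    let ?m = "sum_list (map fst ns)"
    obtain i j p q :: "complex mat" where bl:
      "dim_row i = k + ?m" "dim_col i = k" "dim_row p = k" "dim_col p = k + ?m"
      "dim_row j = k + ?m" "dim_col j = ?m" "dim_row q = ?m" "dim_col q = k + ?m"
      "p * i = 1\<^sub>m k" "q * j = 1\<^sub>m ?m" "p * j = 0\<^sub>m k ?m" "q * i = 0\<^sub>m ?m k"
      "i * p + j * q = 1\<^sub>m (k + ?m)"
      "\<forall>A \<in> carrier_mat k k. \<forall>D \<in> carrier_mat ?m ?m.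
        four_block_mat A (0\<^sub>m k ?m) (0\<^sub>m ?m k) D * i = i * A \<and>
        four_block_mat A (0\<^sub>m k ?m) (0\<^sub>m ?m k) D * j = j * D \<and>
        p * four_block_mat A (0\<^sub>m k ?m) (0\<^sub>m ?m k) D = A * p \<and>
        q * four_block_mat A (0\<^sub>m k ?m) (0\<^sub>m ?m k) D = D * q"
      by (rule block_matrices)
    have fb: "jordan_matrix (b # ns) * i = i * jordan_block k y"
      "jordan_matrix (b # ns) * j = j * jordan_matrix ns"
      using bl(14)[rule_format, of "jordan_block k y" "jordan_matrix ns"]
      by (simp_all add: b jordan_matrix_Cons)
    have "spec_in \<Lambda> ss (jordan_block k y)"
      by (rule spec_in_summand[OF Cons.prems(1), of "k + ?m" _ k i p]) (use bl fb b in \<open>auto intro!: carrier_matI\<close>)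
    moreover have "spec_in \<Lambda> ss (jordan_matrix ns)"
      by (rule spec_in_summand[OF Cons.prems(1), of "k + ?m" _ ?m j q]) (use bl fb b in \<open>auto intro!: carrier_matI\<close>)
    ultimately show ?case
      using Cons b by auto
  qed simp
  then show "z \<in> \<Lambda>" "ss \<longrightarrow> n = 1"
    using \<open>n > 0\<close> by (auto simp: spec_in_jordan_block)
qed

subsection \<open>Spectra of tensor products\<close>

text \<open>The slice maps given by the rows of \<open>Q\<close> are together the map
  \<open>kron Q (1\<^sub>m n)\<close>, which has the left inverse
  \<open>kron P (1\<^sub>m n)\<close>.\<close>

lemma kron_slices_injective:
  fixes Q :: "complex mat"
  assumes Q: "Q \<in> carrier_mat m m" "P \<in> carrier_mat m m" "P * Q = 1\<^sub>m m"
    and w: "dim_vec w = m * n"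
    and zero: "\<And>k. k < m \<Longrightarrow> kron (mat 1 m (\<lambda>(_, c). Q $$ (k, c))) (1\<^sub>m n) *\<^sub>v w = 0\<^sub>v n"
  shows "w = 0\<^sub>v (m * n)"
proof -
  have d: "dim_row Q = m" "dim_col Q = m" "dim_row P = m" "dim_col P = m" using Q by auto
  have "kron Q (1\<^sub>m n) *\<^sub>v w = 0\<^sub>v (m * n)"
  proof (rule eq_vecI)
    fix r assume "r < dim_vec (0\<^sub>v (m * n) :: complex vec)"
    then have r: "r < m * n" by simp
    then have b: "r div n < m" "r mod n < n" using div_mod_bounds by blast+
    let ?E = "kron (mat 1 m (\<lambda>(_, c). Q $$ (r div n, c))) (1\<^sub>m n)"
    have "row (kron Q (1\<^sub>m n)) r = row ?E (r mod n)"
    proof (rule eq_vecI)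
      fix c assume "c < dim_vec (row ?E (r mod n))"
      then have c: "c < m * n" by simp
      then have "c div n < m" "c mod n < n" using div_mod_bounds by blast+
      then show "row (kron Q (1\<^sub>m n)) r $ c = row ?E (r mod n) $ c"
        using r b c d by (simp add: kron_index)
    qed (simp add: d)
    then have "(kron Q (1\<^sub>m n) *\<^sub>v w) $ r = (?E *\<^sub>v w) $ (r mod n)"
      using r b d by simp
    also have "\<dots> = 0"
      using zero[OF b(1)] b by simp
    finally show "(kron Q (1\<^sub>m n) *\<^sub>v w) $ r = 0\<^sub>v (m * n) $ r"
      using r by simp
  qed (simp add: d)
  then have "kron P (1\<^sub>m n) *\<^sub>v (kron Q (1\<^sub>m n) *\<^sub>v w) = 0\<^sub>v (m * n)"
    using d by (simp add: mat_vec_simps)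
  moreover have "kron P (1\<^sub>m n) *\<^sub>v (kron Q (1\<^sub>m n) *\<^sub>v w) = w"
    using d w Q(3) by (simp add: mat_vec_simps kron_mult flip: mat_vec_simps(1))
  ultimately show ?thesis by simp
qed

text \<open>The rows of \<open>Q\<close> are left eigenvectors of \<open>A\<close>, so the slice
  along row \<open>k\<close> intertwines the matrix of the tensor product with \<open>B\<close>
  shifted by \<open>D $$ (k, k)\<close>.\<close>

lemma spec_in_kron_diagonal:
  fixes A B D :: "complex mat"
  assumes A: "A \<in> carrier_mat m m" and B: "B \<in> carrier_mat n n" "spec_in \<Lambda> ss B"
    and Q: "Q \<in> carrier_mat m m" "P \<in> carrier_mat m m" "P * Q = 1\<^sub>m m" "Q * A = D * Q"
    and D: "D \<in> carrier_mat m m" "diagonal_mat D"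
    and shift: "\<And>k z. k < m \<Longrightarrow> z \<in> \<Lambda> \<Longrightarrow> z + D $$ (k, k) \<in> \<Lambda>"
  shows "spec_in \<Lambda> ss (kron A (1\<^sub>m n) + kron (1\<^sub>m m) B)"
proof (rule spec_in_jointly_injective[where K = "{..<m}" and m = "\<lambda>_. n" and B = "\<lambda>_. B" and
      E = "\<lambda>k. kron (mat 1 m (\<lambda>(_, c). Q $$ (k, c))) (1\<^sub>m n)" and c = "\<lambda>k. D $$ (k, k)"])
  fix k assume "k \<in> {..<m}"
  then have k: "k < m" by simp
  define R where "R = mat 1 m (\<lambda>(_, c). Q $$ (k, c))"
  have d: "dim_row A = m" "dim_col A = m" "dim_row B = n" "dim_col B = n" "dim_row Q = m" "dim_col Q = m"
    "dim_row R = 1" "dim_col R = m" "dim_row D = m" "dim_col D = m"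
    using A B Q D by (auto simp: R_def)
  have "R * A = D $$ (k, k) \<cdot>\<^sub>m R"
  proof (rule eq_matI)
    fix i j assume "i < dim_row (D $$ (k, k) \<cdot>\<^sub>m R)" "j < dim_col (D $$ (k, k) \<cdot>\<^sub>m R)"
    then have ij: "i = 0" "j < m" using d by auto
    have "(R * A) $$ (i, j) = (Q * A) $$ (k, j)"
      using ij k d by (simp add: mat_mult_index R_def del: index_mult_mat(1))
    also have "\<dots> = (\<Sum>l<m. D $$ (k, l) * Q $$ (l, j))"
      unfolding Q(4) using ij k d by (simp add: mat_mult_index del: index_mult_mat(1))
    also have "\<dots> = D $$ (k, k) * Q $$ (k, j)"
      using k d D(2) by (subst sum.remove[of _ k]) (auto simp: diagonal_mat_def intro!: sum.neutral)
    finally show "(R * A) $$ (i, j) = (D $$ (k, k) \<cdot>\<^sub>m R) $$ (i, j)"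
      using ij k d by (simp add: R_def)
  qed (use d in auto)
  then have "kron R (1\<^sub>m n) * kron A (1\<^sub>m n) = D $$ (k, k) \<cdot>\<^sub>m kron R (1\<^sub>m n)"
    using d by (simp add: kron_mult kron_linear)
  moreover have "kron R (1\<^sub>m n) * kron (1\<^sub>m m) B = B * kron R (1\<^sub>m n)"
    using d kron_mult[of "1\<^sub>m (Suc 0)" R B "1\<^sub>m n"] by (simp add: kron_mult)
  moreover have "X + Y = Y + X" if "dim_row X = dim_row Y" "dim_col X = dim_col Y" for X Y :: "complex mat"
    using that by (intro eq_matI) auto
  ultimately show "kron R (1\<^sub>m n) * (kron A (1\<^sub>m n) + kron (1\<^sub>m m) B) =
      B * kron R (1\<^sub>m n) + D $$ (k, k) \<cdot>\<^sub>m kron R (1\<^sub>m n)"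
    using d by (simp add: mat_distribs)
next
  show "v = 0\<^sub>v (m * n)" if "dim_vec v = m * n"
    "\<And>k. k \<in> {..<m} \<Longrightarrow> kron (mat 1 m (\<lambda>(_, c). Q $$ (k, c))) (1\<^sub>m n) *\<^sub>v v = 0\<^sub>v n" for v
    by (rule kron_slices_injective[OF Q(1-3)]) (use that in auto)
qed (use assms in \<open>auto intro!: carrier_matI\<close>)

text \<open>The nilpotent summand \<open>kron A (1\<^sub>m n)\<close> commutes with the whole
  matrix. Applied repeatedly to an eigenvector, it yields a last nonzero vector, which is an
  eigenvector of \<open>kron (1\<^sub>m m) B\<close> for the same eigenvalue; a nonzero slice of it
  is one of \<open>B\<close>.\<close>

lemma spec_in_kron_nilpotent:
  fixes A B :: "complex mat"
  assumes A: "A \<in> carrier_mat m m" "A ^\<^sub>m k = 0\<^sub>m m m"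
    and B: "B \<in> carrier_mat n n" "spec_in \<Lambda> False B"
  shows "spec_in \<Lambda> False (kron A (1\<^sub>m n) + kron (1\<^sub>m m) B)"
proof (rule spec_inI)
  let ?X = "kron A (1\<^sub>m n)" and ?Y = "kron (1\<^sub>m m) B"
  have d: "dim_row A = m" "dim_col A = m" "dim_row B = n" "dim_col B = n"
    using A B by auto
  fix v z assume v: "dim_vec v = dim_row (?X + ?Y)" "v \<noteq> 0\<^sub>v (dim_row (?X + ?Y))"
    and eq: "(?X + ?Y) *\<^sub>v v = z \<cdot>\<^sub>v v"
  define u where "u = (\<lambda>j. ((*\<^sub>v) ?X ^^ j) v)"
  have ud: "dim_vec (u j) = m * n" for j
    using v d by (induction j) (auto simp: u_def)
  have uS: "u (Suc j) = ?X *\<^sub>v u j" for j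
    by (simp add: u_def)
  have comm: "(?X + ?Y) * ?X = ?X * (?X + ?Y)"
    using d by (simp add: mat_distribs kron_mult)
  have ueq: "(?X + ?Y) *\<^sub>v u j = z \<cdot>\<^sub>v u j" for j
  proof (induction j)
    case (Suc j)
    have "(?X + ?Y) *\<^sub>v u (Suc j) = ?X *\<^sub>v ((?X + ?Y) *\<^sub>v u j)"
      using d ud[of j] comm unfolding uS by (simp flip: mat_vec_simps(1))
    then show ?case
      using d ud[of j] unfolding Suc uS by (simp add: mat_vec_simps)
  qed (use eq in \<open>simp add: u_def\<close>)
  have "((*\<^sub>v) ?X ^^ j) x = kron (A ^\<^sub>m j) (1\<^sub>m n) *\<^sub>v x" if "dim_vec x = m * n" for j x
    using that
  proof (induction j arbitrary: x)
    case (Suc j)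
    have dj: "dim_row (A ^\<^sub>m j) = m" "dim_col (A ^\<^sub>m j) = m"
      using A(1) by (metis carrier_matD pow_carrier_mat)+
    have "((*\<^sub>v) ?X ^^ Suc j) x = kron (A ^\<^sub>m j) (1\<^sub>m n) *\<^sub>v (?X *\<^sub>v x)"
      using Suc.IH[of "?X *\<^sub>v x"] d by (simp add: funpow_swap1)
    also have "\<dots> = kron (A ^\<^sub>m Suc j) (1\<^sub>m n) *\<^sub>v x"
      using d dj Suc.prems mat_vec_simps(1)[of "kron (A ^\<^sub>m j) (1\<^sub>m n)" ?X x]
      by (simp add: kron_mult del: pow_mat_dim)
    finally show ?case .
  qed (use A in \<open>simp add: mat_vec_simps\<close>)
  then have "u k = 0\<^sub>v (m * n)"
    using v d A(2) by (simp add: u_def mat_vec_simps)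
  moreover have "u 0 \<noteq> 0\<^sub>v (m * n)"
    using v d by (simp add: u_def)
  ultimately obtain j where j: "u j \<noteq> 0\<^sub>v (m * n)" "u (Suc j) = 0\<^sub>v (m * n)"
    using nat_induct[of "\<lambda>j. u j \<noteq> 0\<^sub>v (m * n)" k] by blast
  have "?X *\<^sub>v u j + ?Y *\<^sub>v u j = z \<cdot>\<^sub>v u j"
    using ueq[of j] d ud[of j] by (simp add: mat_vec_simps)
  then have Yu: "?Y *\<^sub>v u j = z \<cdot>\<^sub>v u j"
    using j(2) ud[of j] d left_zero_vec[of "?Y *\<^sub>v u j" "m * n"] carrier_vecI[of "?Y *\<^sub>v u j" "m * n"]
    by (simp add: uS[symmetric])
  obtain l where l: "l < m" "kron (mat 1 m (\<lambda>(_, c). 1\<^sub>m m $$ (l, c))) (1\<^sub>m n) *\<^sub>v u j \<noteq> 0\<^sub>v n"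
    using kron_slices_injective[of "1\<^sub>m m" m "1\<^sub>m m" "u j" n] ud[of j] j(1) by auto
  define R :: "complex mat" where "R = mat 1 m (\<lambda>(_, c). 1\<^sub>m m $$ (l, c))"
  have dR: "dim_row R = 1" "dim_col R = m" by (simp_all add: R_def)
  have "B * kron R (1\<^sub>m n) = kron R (1\<^sub>m n) * ?Y"
    using d dR kron_mult[of "1\<^sub>m (Suc 0)" R B "1\<^sub>m n"] by (simp add: kron_mult)
  then have "B *\<^sub>v (kron R (1\<^sub>m n) *\<^sub>v u j) = kron R (1\<^sub>m n) *\<^sub>v (?Y *\<^sub>v u j)"
    using d dR ud[of j] by (simp flip: mat_vec_simps(1))
  then have "B *\<^sub>v (kron R (1\<^sub>m n) *\<^sub>v u j) = z \<cdot>\<^sub>v (kron R (1\<^sub>m n) *\<^sub>v u j)"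
    unfolding Yu using dR ud[of j] by (simp add: mat_vec_simps)
  then show "z \<in> \<Lambda>"
    using spec_inD(1)[OF B(2), of "kron R (1\<^sub>m n) *\<^sub>v u j" z] d dR l(2) by (simp add: R_def)
qed simp

subsection \<open>The action of a semisimple element of \<open>sl2\<close>\<close>

lemma pow_mat_commute:
  fixes A B :: "complex mat"
  assumes "A \<in> carrier_mat n n" "B \<in> carrier_mat n n" "A * B = B * A"
  shows "A * B ^\<^sub>m k = B ^\<^sub>m k * A"
proof (induction k)
  case (Suc k)
  have d: "dim_row A = n" "dim_col A = n" "dim_row B = n" "dim_col B = n"
    "dim_row (B ^\<^sub>m k) = n" "dim_col (B ^\<^sub>m k) = n"
    using assms carrier_matD[OF pow_carrier_mat[OF assms(2)]] by auto
  have "A * (B ^\<^sub>m k * B) = B ^\<^sub>m k * (A * B)"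
    using d Suc by (simp del: pow_mat_dim flip: mat_assoc)
  then show ?case
    using d assms(3) by (simp del: pow_mat_dim add: mat_assoc)
qed (use assms in simp)

lemma bracket_pow:
  fixes H E :: "complex mat"
  assumes "H \<in> carrier_mat n n" "E \<in> carrier_mat n n" "H * E - E * H = c \<cdot>\<^sub>m E"
  shows "H * E ^\<^sub>m k = E ^\<^sub>m k * H + (of_nat k * c) \<cdot>\<^sub>m E ^\<^sub>m k"
proof (induction k)
  case (Suc k)
  have d: "dim_row H = n" "dim_col H = n" "dim_row E = n" "dim_col E = n"
    "dim_row (E ^\<^sub>m k) = n" "dim_col (E ^\<^sub>m k) = n"
    using assms carrier_matD[OF pow_carrier_mat[OF assms(2)]] by auto
  have HE: "H * E = E * H + c \<cdot>\<^sub>m E"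
  proof (rule eq_matI)
    fix i j assume "i < dim_row (E * H + c \<cdot>\<^sub>m E)" "j < dim_col (E * H + c \<cdot>\<^sub>m E)"
    then show "(H * E) $$ (i, j) = (E * H + c \<cdot>\<^sub>m E) $$ (i, j)"
      using arg_cong[OF assms(3), of "\<lambda>M. M $$ (i, j)"] d
      by (simp add: algebra_simps del: index_mult_mat(1))
  qed (use d in auto)
  have "H * (E ^\<^sub>m k * E) = E ^\<^sub>m k * (H * E) + (of_nat k * c) \<cdot>\<^sub>m (E ^\<^sub>m k * E)"
    using d Suc by (simp add: mat_distribs mat_assoc del: pow_mat_dim flip: mat_assoc[of H])
  also have "\<dots> = E ^\<^sub>m Suc k * H + (of_nat (Suc k) * c) \<cdot>\<^sub>m E ^\<^sub>m Suc k"
    unfolding HE using d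
    by (simp add: mat_distribs mat_assoc del: pow_mat_dim)
      (rule eq_matI, auto simp: algebra_simps simp del: index_mult_mat(1) pow_mat_dim)
  finally show ?case by simp
qed (use assms in \<open>auto intro!: eq_matI\<close>)

text \<open>The commutator of \<open>H\<close> and \<open>E^k\<close> has trace zero, and by
  \<open>bracket_pow\<close> it is \<open>k * c\<close> times \<open>E^k\<close>. So the positive
  powers of \<open>E\<close> have trace zero, and all eigenvalues of \<open>E\<close>
  vanish.\<close>

lemma bracket_eigen_nilpotent:
  fixes H E :: "complex mat"
  assumes HE: "H \<in> carrier_mat n n" "E \<in> carrier_mat n n" "H * E - E * H = c \<cdot>\<^sub>m E" and "c \<noteq> 0"
  shows "E ^\<^sub>m n = 0\<^sub>m n n"
proof (rule eigenvalue_zero_imp_nilpotent[OF HE(2)], rule trace_pow_zero_imp_eigenvalue_zero[OF HE(2)])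
  fix k :: nat assume "k > 0"
  have d: "dim_row H = n" "dim_col H = n" "dim_row (E ^\<^sub>m k) = n" "dim_col (E ^\<^sub>m k) = n"
    using HE carrier_matD[OF pow_carrier_mat[OF HE(2)]] by auto
  have "mtrace (H * E ^\<^sub>m k) = mtrace (E ^\<^sub>m k * H) + (of_nat k * c) * mtrace (E ^\<^sub>m k)"
    using d unfolding bracket_pow[OF HE, of k] by (simp del: pow_mat_dim)
  then show "mtrace (E ^\<^sub>m k) = 0"
    using mtrace_comm[of H "E ^\<^sub>m k"] d \<open>k > 0\<close> \<open>c \<noteq> 0\<close> by (simp del: pow_mat_dim)
qed

text \<open>The factor of largest index acts first on a vector; \<open>mat_prod_chain\<close> strips
  factors from that side.\<close>

primrec mat_prod :: "nat \<Rightarrow> (nat \<Rightarrow> complex mat) \<Rightarrow> nat \<Rightarrow> complex mat" where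
  "mat_prod d x 0 = 1\<^sub>m d"
| "mat_prod d x (Suc n) = mat_prod d x n * x n"

lemma mat_prod_carrier:
  "(\<And>i. x i \<in> carrier_mat d d) \<Longrightarrow> mat_prod d x n \<in> carrier_mat d d"
  by (induction n) auto

lemma mat_prod_commute:
  assumes "A \<in> carrier_mat d d" "\<And>i. x i \<in> carrier_mat d d" "\<And>i. A * x i = x i * A"
  shows "A * mat_prod d x n = mat_prod d x n * A"
proof (induction n)
  case (Suc n)
  have c: "dim_row A = d" "dim_col A = d" "dim_row (x n) = d" "dim_col (x n) = d"
    "dim_row (mat_prod d x n) = d" "dim_col (mat_prod d x n) = d"
    using assms carrier_matD[OF mat_prod_carrier[OF assms(2)]] carrier_matD[OF assms(2)] by auto
  have "A * (mat_prod d x n * x n) = mat_prod d x n * (A * x n)"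
    using c Suc by (simp flip: mat_assoc)
  then show ?case
    using c assms(3) by (simp add: mat_assoc)
qed (use assms in simp)

lemma mat_prod_eigen:
  assumes "\<And>i. x i \<in> carrier_mat d d" "dim_vec w = d" "\<And>i. x i *\<^sub>v w = c i \<cdot>\<^sub>v w"
  shows "mat_prod d x n *\<^sub>v w = (\<Prod>i<n. c i) \<cdot>\<^sub>v w"
proof (induction n)
  case (Suc n)
  have "dim_row (x n) = d" "dim_col (x n) = d" "dim_col (mat_prod d x n) = d"
    using carrier_matD[OF mat_prod_carrier[OF assms(1)]] carrier_matD[OF assms(1)] by auto
  then show ?case
    using assms(2,3) Suc by (simp add: mat_vec_simps smult_smult_assoc mult.commute)
qed (use assms in \<open>simp add: mat_vec_simps\<close>)

text \<open>Apply the factors of a vanishing product to \<open>v\<close> one after the other, and stop just before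
  \<open>T\<close> kills the result.\<close>

lemma mat_prod_chain:
  assumes x: "\<And>i. x i \<in> carrier_mat d d" and T: "T \<in> carrier_mat d d"
    and v: "dim_vec v = d" "v \<in> S" "T *\<^sub>v v \<noteq> 0\<^sub>v d" "mat_prod d x n *\<^sub>v v = 0\<^sub>v d"
    and S: "\<And>i u. u \<in> S \<Longrightarrow> dim_vec u = d \<Longrightarrow> x i *\<^sub>v u \<in> S"
  obtains i u where "dim_vec u = d" "u \<in> S" "T *\<^sub>v u \<noteq> 0\<^sub>v d" "T *\<^sub>v (x i *\<^sub>v u) = 0\<^sub>v d"
    "mat_prod d x (Suc i) *\<^sub>v u = 0\<^sub>v d"
  using v
proof (induction n arbitrary: v thesis)
  case 0
  then show ?case using T by (simp add: mat_vec_simps)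
next
  case (Suc n)
  have c: "dim_row (x n) = d" "dim_col (x n) = d" "dim_col (mat_prod d x n) = d"
    using carrier_matD[OF mat_prod_carrier[OF x]] carrier_matD[OF x] by auto
  show ?case
  proof (cases "T *\<^sub>v (x n *\<^sub>v v) = 0\<^sub>v d")
    case False
    show ?thesis
      by (rule Suc.IH[where v = "x n *\<^sub>v v"]) (use Suc.prems c S False in \<open>auto simp: mat_vec_simps\<close>)
  qed (use Suc.prems in blast)
qed

text \<open>Up to the order of the factors, \<open>F\<^sup>n E\<^sup>n\<close> is the product of the matrices
  \<open>weight_lin K H d (- i) (- i (i + 1))\<close>, and
  \<open>E\<^sup>n F\<^sup>n\<close> that of \<open>weight_lin K H d (i + 1) (- i (i + 1))\<close>, over \<open>i < n\<close>, where \<open>K = F E\<close>.\<close>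

definition weight_lin :: "complex mat \<Rightarrow> complex mat \<Rightarrow> nat \<Rightarrow> int \<Rightarrow> int \<Rightarrow> complex mat" where
  "weight_lin K H d a b = K + of_int a \<cdot>\<^sub>m H + of_int b \<cdot>\<^sub>m 1\<^sub>m d"

context
  fixes K H :: "complex mat" and d :: nat
  assumes K: "K \<in> carrier_mat d d" and H: "H \<in> carrier_mat d d" and KH: "K * H = H * K"
begin

private abbreviation "lin \<equiv> weight_lin K H d"
private abbreviation "x \<equiv> \<lambda>i::nat. lin (- int i) (- (int i * (int i + 1)))"
private abbreviation "y \<equiv> \<lambda>j::nat. lin (int j + 1) (- (int j * (int j + 1)))"

private lemma dims: "dim_row K = d" "dim_col K = d" "dim_row H = d" "dim_col H = d"
  using K H by auto

lemma lin_dims: "dim_row (lin a b) = d" "dim_col (lin a b) = d" "lin a b \<in> carrier_mat d d"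
  using dims by (auto simp: weight_lin_def intro!: carrier_matI)

lemma lin_commute:
  assumes "T \<in> carrier_mat d d" "T * K = K * T" "T * H = H * T"
  shows "T * lin a b = lin a b * T"
  using assms dims by (auto simp: weight_lin_def mat_distribs)

lemma lin_lin: "lin a b * lin a' b' = lin a' b' * lin a b"
proof (rule lin_commute[OF lin_dims(3)])
  show "lin a b * K = K * lin a b"
    by (rule lin_commute[symmetric]) (use K KH in auto)
  show "lin a b * H = H * lin a b"
    by (rule lin_commute[symmetric]) (use H KH in auto)
qed

lemma lin_eigen:
  assumes "dim_vec w = d" "K *\<^sub>v w = k \<cdot>\<^sub>v w" "H *\<^sub>v w = z \<cdot>\<^sub>v w"
  shows "lin a b *\<^sub>v w = (k + of_int a * z + of_int b) \<cdot>\<^sub>v w"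
  using assms dims by (auto simp: weight_lin_def mat_vec_simps algebra_simps intro!: eq_vecI simp del: index_mult_mat_vec)

text \<open>The chosen vector \<open>T u\<close> is an eigenvector of \<open>H\<close> killed by some \<open>x i\<close> and some \<open>y j\<close>; the two
  values of \<open>K\<close> on it agree only if \<open>z = j - i\<close>.\<close>

lemma weight_integral:
  assumes px: "mat_prod d x n = 0\<^sub>m d d" and py: "mat_prod d y m = 0\<^sub>m d d"
    and T: "T \<in> carrier_mat d d" "T * K = K * T" "T * H = H * T"
    and v: "dim_vec v = d" "T *\<^sub>v v \<noteq> 0\<^sub>v d" "H *\<^sub>v (T *\<^sub>v v) = z \<cdot>\<^sub>v (T *\<^sub>v v)"
  obtains i j :: nat and u where "z = of_int (int j - int i)" "dim_vec u = d" "T *\<^sub>v u \<noteq> 0\<^sub>v d"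
    "H *\<^sub>v (T *\<^sub>v u) = z \<cdot>\<^sub>v (T *\<^sub>v u)"
    "K *\<^sub>v (T *\<^sub>v u) = (of_nat i * z + of_nat (i * (i + 1))) \<cdot>\<^sub>v (T *\<^sub>v u)"
    "mat_prod d x (Suc i) *\<^sub>v u = 0\<^sub>v d" "mat_prod d y (Suc j) *\<^sub>v u = 0\<^sub>v d"
proof -
  have Td: "dim_row T = d" "dim_col T = d" using T by auto
  have TL: "T *\<^sub>v (lin a b *\<^sub>v u) = lin a b *\<^sub>v (T *\<^sub>v u)" if "dim_vec u = d" for a b u
    using lin_commute[OF T, of a b] Td that by (simp add: lin_dims flip: mat_vec_simps(1))
  have HL: "H *\<^sub>v (lin a b *\<^sub>v u) = lin a b *\<^sub>v (H *\<^sub>v u)" if "dim_vec u = d" for a b u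
    using lin_commute[of H a b] dims that KH H by (simp add: lin_dims flip: mat_vec_simps(1))
  have LL: "lin a b *\<^sub>v (lin a' b' *\<^sub>v u) = lin a' b' *\<^sub>v (lin a b *\<^sub>v u)" if "dim_vec u = d" for a b a' b' u
    using lin_lin[of a b a' b'] that by (simp add: lin_dims flip: mat_vec_simps(1))
  define S where "S = {u. H *\<^sub>v (T *\<^sub>v u) = z \<cdot>\<^sub>v (T *\<^sub>v u)}"
  have S: "lin a b *\<^sub>v u \<in> S" if "u \<in> S" "dim_vec u = d" for a b u
    using that Td dims by (simp add: S_def TL HL lin_dims mat_vec_simps)
  obtain i u1 where u1: "dim_vec u1 = d" "u1 \<in> S" "T *\<^sub>v u1 \<noteq> 0\<^sub>v d" "T *\<^sub>v (x i *\<^sub>v u1) = 0\<^sub>v d"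
    "mat_prod d x (Suc i) *\<^sub>v u1 = 0\<^sub>v d"
    by (rule mat_prod_chain[of x d T v S n])
      (use T v S px in \<open>auto simp: lin_dims S_def mat_vec_simps\<close>)
  \<comment> \<open>\<open>S2\<close> records what the chain for \<open>x\<close> has achieved. As
    all matrices \<open>lin a b\<close> commute with each other and with \<open>T\<close>, it is
    stable under the factors \<open>y\<close>, so the chain for \<open>y\<close> preserves these
    properties.\<close>
  define S2 where "S2 = {u \<in> S. T *\<^sub>v (x i *\<^sub>v u) = 0\<^sub>v d \<and> mat_prod d x (Suc i) *\<^sub>v u = 0\<^sub>v d}"
  have px_comm: "mat_prod d x l *\<^sub>v (lin a b *\<^sub>v u) = lin a b *\<^sub>v (mat_prod d x l *\<^sub>v u)"
    if "dim_vec u = d" for l a b u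
    using mat_prod_commute[of "lin a b" d x l] that carrier_matD[OF mat_prod_carrier[of x d l]]
    by (simp add: lin_dims lin_lin flip: mat_vec_simps(1))
  have S2: "lin a b *\<^sub>v u \<in> S2" if u: "u \<in> S2" "dim_vec u = d" for a b u
  proof -
    have "T *\<^sub>v (x i *\<^sub>v (lin a b *\<^sub>v u)) = lin a b *\<^sub>v (T *\<^sub>v (x i *\<^sub>v u))"
      using u Td by (simp add: LL[of u "- int i"] TL lin_dims)
    also have "\<dots> = 0\<^sub>v d"
      using u by (simp add: S2_def mat_vec_simps lin_dims)
    finally show ?thesis
      using u S[of u a b] px_comm[of u "Suc i" a b]
      by (simp add: S2_def mat_vec_simps lin_dims del: mat_prod.simps)
  qed
  obtain j u where u: "dim_vec u = d" "u \<in> S2" "T *\<^sub>v u \<noteq> 0\<^sub>v d" "T *\<^sub>v (y j *\<^sub>v u) = 0\<^sub>v d"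
    "mat_prod d y (Suc j) *\<^sub>v u = 0\<^sub>v d"
    by (rule mat_prod_chain[of y d T u1 S2 m])
      (use T u1 S2 py in \<open>auto simp: lin_dims S2_def mat_vec_simps simp del: mat_prod.simps(2)\<close>)
  define w where "w = T *\<^sub>v u"
  have w: "dim_vec w = d" "w \<noteq> 0\<^sub>v d" "H *\<^sub>v w = z \<cdot>\<^sub>v w" "x i *\<^sub>v w = 0\<^sub>v d" "y j *\<^sub>v w = 0\<^sub>v d"
    using u Td TL[OF u(1)] by (auto simp: w_def S2_def S_def)
  have Kw: "K *\<^sub>v w = - (of_int a * z + of_int b) \<cdot>\<^sub>v w" if "lin a b *\<^sub>v w = 0\<^sub>v d" for a b
  proof (rule eq_vecI)
    fix r assume "r < dim_vec (- (of_int a * z + of_int b) \<cdot>\<^sub>v w)"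
    then have r: "r < d" using w by simp
    have "lin a b *\<^sub>v w = K *\<^sub>v w + of_int a \<cdot>\<^sub>v (z \<cdot>\<^sub>v w) + of_int b \<cdot>\<^sub>v w"
      using w dims by (simp add: weight_lin_def mat_vec_simps)
    from arg_cong[OF this[unfolded that], of "\<lambda>v. v $ r"]
    show "(K *\<^sub>v w) $ r = (- (of_int a * z + of_int b) \<cdot>\<^sub>v w) $ r"
      using r w dims by (simp add: algebra_simps eq_neg_iff_add_eq_0 del: index_mult_mat_vec)
  qed (use w dims in simp)
  have Kx: "K *\<^sub>v w = (of_nat i * z + of_nat (i * (i + 1))) \<cdot>\<^sub>v w"
    using Kw[OF w(4)] by (simp add: algebra_simps)
  obtain r where r: "r < d" "w $ r \<noteq> 0"
    using w(1,2) by (metis eq_vecI index_zero_vec)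
  from Kw[OF w(4)] Kw[OF w(5)]
  have "(- (of_int (- int i) * z + of_int (- (int i * (int i + 1)))) \<cdot>\<^sub>v w) $ r =
      (- (of_int (int j + 1) * z + of_int (- (int j * (int j + 1)))) \<cdot>\<^sub>v w) $ r"
    by simp
  \<comment> \<open>The two values of \<open>K\<close> on \<open>w\<close> are
    \<open>i z + i (i + 1)\<close> and \<open>j (j + 1) - (j + 1) z\<close>; their difference
    factors.\<close>
  then have "(of_nat i + of_nat j + 1) * (z - of_int (int j - int i)) * w $ r = 0"
    using r(1) w(1) by (simp add: algebra_simps)
  then have "(of_nat i + of_nat j + 1) * (z - of_int (int j - int i)) = 0"
    using r(2) by simp
  moreover have "of_nat i + of_nat j + 1 \<noteq> (0 :: complex)"
    by (metis of_nat_1 of_nat_add of_nat_eq_0_iff add_is_0 one_neq_zero)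
  ultimately have "z = of_int (int j - int i)"
    by simp
  then show thesis
    using that[of j i u] u w(3) Kx by (simp add: w_def S2_def del: mat_prod.simps)
qed

text \<open>For \<open>z = j - i\<close> one has \<open>y j - x i = (i + j + 1) (H - z)\<close>. On a Jordan chain of length two this
  operator kills the image \<open>u'\<close> of \<open>u\<close> under the remaining factors, although these factors act on the
  eigenvector \<open>(H - z) u\<close> by a nonzero scalar.\<close>

lemma weight_semisimple:
  assumes px: "mat_prod d x n = 0\<^sub>m d d" and py: "mat_prod d y m = 0\<^sub>m d d"
  shows "spec_in (range of_int) True H"
proof (rule spec_inI)
  fix v w :: "complex vec" and z assume v: "dim_vec v = dim_row H"
  show "z \<in> range of_int" if "v \<noteq> 0\<^sub>v (dim_row H)" "H *\<^sub>v v = z \<cdot>\<^sub>v v"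
  proof -
    have "1\<^sub>m d *\<^sub>v v = v" using v dims by (simp add: mat_vec_simps)
    show ?thesis
    proof (rule weight_integral[OF px py, of "1\<^sub>m d" v z])
      fix i j :: nat assume "z = of_int (int j - int i)"
      then show ?thesis by (rule range_eqI)
    qed (use that v dims K H \<open>1\<^sub>m d *\<^sub>v v = v\<close> in simp_all)
  qed
  assume w: "dim_vec w = dim_row H" "H *\<^sub>v v = z \<cdot>\<^sub>v v + w" "H *\<^sub>v w = z \<cdot>\<^sub>v w"
  \<comment> \<open>Whereas \<open>T = 1\<close> above selects plain eigenvectors,
    \<open>T = H - z\<close> sends \<open>v\<close> to \<open>w\<close>, and a nonzero
    \<open>T u\<close> makes \<open>u\<close> the top of a chain of length two.\<close>
  define T where "T = H + - z \<cdot>\<^sub>m 1\<^sub>m d"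
  have T: "T \<in> carrier_mat d d" "T * K = K * T" "T * H = H * T"
    using H K KH dims by (auto simp: T_def mat_distribs intro!: carrier_matI)
  have Tapp: "T *\<^sub>v u = H *\<^sub>v u + - z \<cdot>\<^sub>v u" if "dim_vec u = d" for u
    using that dims by (simp add: T_def mat_vec_simps)
  have Tv: "T *\<^sub>v v = w"
    using v w dims by (auto simp: Tapp intro!: eq_vecI)
  show "w = 0\<^sub>v (dim_row H)"
  proof (rule ccontr)
    assume nz: "w \<noteq> 0\<^sub>v (dim_row H)"
    obtain i j u where u: "z = of_int (int j - int i)" "dim_vec u = d" "T *\<^sub>v u \<noteq> 0\<^sub>v d"
      "H *\<^sub>v (T *\<^sub>v u) = z \<cdot>\<^sub>v (T *\<^sub>v u)"
      "K *\<^sub>v (T *\<^sub>v u) = (of_nat i * z + of_nat (i * (i + 1))) \<cdot>\<^sub>v (T *\<^sub>v u)"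
      "mat_prod d x (Suc i) *\<^sub>v u = 0\<^sub>v d" "mat_prod d y (Suc j) *\<^sub>v u = 0\<^sub>v d"
      by (rule weight_integral[OF px py T, of v z]) (use nz v w dims Tv in simp_all)
    have z: "z = of_nat j - of_nat i" using u(1) by simp
    have xc: "x l \<in> carrier_mat d d" and yc: "y l \<in> carrier_mat d d" for l
      by (rule lin_dims)+
    have Pd: "dim_row (mat_prod d x l) = d" "dim_col (mat_prod d x l) = d"
      "dim_row (mat_prod d y l) = d" "dim_col (mat_prod d y l) = d" for l
      using mat_prod_carrier[of x d l, OF xc] mat_prod_carrier[of y d l, OF yc] by auto
    have Td: "dim_row T = d" "dim_col T = d" using T by auto
    have comm: "A * mat_prod d x l = mat_prod d x l * A" "A * mat_prod d y l = mat_prod d y l * A"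
      if "A \<in> carrier_mat d d" "\<And>a b. A * lin a b = lin a b * A" for A l
      using mat_prod_commute[of A d x l] mat_prod_commute[of A d y l] that lin_dims(3) by blast+
    have Ploc: "mat_prod d y b * mat_prod d x a = mat_prod d x a * mat_prod d y b" for a b
    proof (rule comm(1))
      show "mat_prod d y b * lin k l = lin k l * mat_prod d y b" for k l
        by (rule comm(2)[symmetric]) (auto simp: lin_dims lin_lin)
    qed (rule mat_prod_carrier[OF yc])
    define u' where "u' = mat_prod d x i *\<^sub>v (mat_prod d y j *\<^sub>v u)"
    have u'd: "dim_vec u' = d" by (simp add: u'_def Pd)
    have xu': "x i *\<^sub>v u' = 0\<^sub>v d"
    proof -
      have "x i *\<^sub>v u' = (x i * mat_prod d x i * mat_prod d y j) *\<^sub>v u"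
        using u(2) by (simp add: u'_def mat_vec_simps Pd lin_dims)
      also have "x i * mat_prod d x i * mat_prod d y j = mat_prod d y j * mat_prod d x (Suc i)"
        using comm(1)[of "x i" i] by (simp add: lin_dims lin_lin Ploc[of j "Suc i", simplified])
      finally show ?thesis
        using u(2,6) by (simp add: mat_vec_simps(1,10) Pd lin_dims del: mat_prod.simps)
    qed
    have yu': "y j *\<^sub>v u' = 0\<^sub>v d"
    proof -
      have "y j *\<^sub>v u' = (y j * mat_prod d x i * mat_prod d y j) *\<^sub>v u"
        using u(2) by (simp add: u'_def mat_vec_simps Pd lin_dims)
      also have "y j * mat_prod d x i * mat_prod d y j = mat_prod d x i * (y j * mat_prod d y j)"
        using comm(1)[of "y j" i] by (simp add: lin_dims lin_lin Pd mat_assoc)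
      also have "y j * mat_prod d y j = mat_prod d y (Suc j)"
        using comm(2)[of "y j" j] by (simp add: lin_dims lin_lin)
      finally show ?thesis
        using u(2,7) by (simp add: mat_vec_simps(1,10) Pd lin_dims del: mat_prod.simps)
    qed
    have "of_nat (i + j + 1) \<cdot>\<^sub>v (T *\<^sub>v u') = y j *\<^sub>v u' - x i *\<^sub>v u'"
      unfolding Tapp[OF u'd] weight_lin_def using u'd dims
      by (auto simp: z mat_vec_simps algebra_simps intro!: eq_vecI simp del: index_mult_mat_vec)
    then have zero: "of_nat (i + j + 1) \<cdot>\<^sub>v (T *\<^sub>v u') = 0\<^sub>v d"
      unfolding xu' yu' by simp
    have "T *\<^sub>v u' = mat_prod d x i *\<^sub>v (mat_prod d y j *\<^sub>v (T *\<^sub>v u))"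
    proof -
      have "T *\<^sub>v u' = (T * mat_prod d x i * mat_prod d y j) *\<^sub>v u"
        using u(2) Td by (simp add: u'_def mat_vec_simps Pd)
      also have "T * mat_prod d x i * mat_prod d y j = mat_prod d x i * (mat_prod d y j * T)"
        using comm[OF T(1) lin_commute[OF T]] Td by (simp add: Pd mat_assoc)
      finally show ?thesis
        using u(2) Td by (simp add: mat_vec_simps Pd)
    qed
    \<comment> \<open>With \<open>z = j - i\<close> and the known value of \<open>K\<close>, the
      factor \<open>x l\<close> acts on \<open>T u\<close> by \<open>(i - l) (j + l + 1)\<close> and
      \<open>y l\<close> by \<open>(j - l) (i + l + 1)\<close>; these are nonzero for
      \<open>l < i\<close> and \<open>l < j\<close> respectively.\<close>
    also have "\<dots> = ((\<Prod>l<i. (of_nat i - of_nat l) * of_nat (j + l + 1)) *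
        (\<Prod>l<j. (of_nat j - of_nat l) * of_nat (i + l + 1))) \<cdot>\<^sub>v (T *\<^sub>v u)"
    proof -
      have "x l *\<^sub>v (T *\<^sub>v u) = ((of_nat i - of_nat l) * of_nat (j + l + 1)) \<cdot>\<^sub>v (T *\<^sub>v u)" for l
        using lin_eigen[OF _ u(5,4)] Td by (simp add: z algebra_simps)
      then have 1: "mat_prod d x i *\<^sub>v (T *\<^sub>v u) =
          (\<Prod>l<i. (of_nat i - of_nat l) * of_nat (j + l + 1)) \<cdot>\<^sub>v (T *\<^sub>v u)"
        by (intro mat_prod_eigen) (auto simp: lin_dims Td)
      have "y l *\<^sub>v (T *\<^sub>v u) = ((of_nat j - of_nat l) * of_nat (i + l + 1)) \<cdot>\<^sub>v (T *\<^sub>v u)" for l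
        using lin_eigen[OF _ u(5,4)] Td by (simp add: z algebra_simps)
      then have 2: "mat_prod d y j *\<^sub>v (T *\<^sub>v u) =
          (\<Prod>l<j. (of_nat j - of_nat l) * of_nat (i + l + 1)) \<cdot>\<^sub>v (T *\<^sub>v u)"
        by (intro mat_prod_eigen) (auto simp: lin_dims Td)
      show ?thesis
        unfolding 2 using 1 Td
        by (simp add: mat_vec_simps Pd smult_smult_assoc mult.commute)
    qed
    finally have "of_nat (i + j + 1) \<cdot>\<^sub>v (((\<Prod>l<i. (of_nat i - of_nat l) * of_nat (j + l + 1)) *
        (\<Prod>l<j. (of_nat j - of_nat l) * of_nat (i + l + 1))) \<cdot>\<^sub>v (T *\<^sub>v u)) = 0\<^sub>v d"
      using zero by simp
    moreover obtain r where r: "r < d" "(T *\<^sub>v u) $ r \<noteq> 0"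
      using u(3) Td by (metis dim_mult_mat_vec eq_vecI index_zero_vec)
    ultimately have "of_nat (i + j + 1) * (((\<Prod>l<i. (of_nat i - of_nat l) * of_nat (j + l + 1)) *
        (\<Prod>l<j. (of_nat j - of_nat l) * of_nat (i + l + 1))) * (T *\<^sub>v u) $ r) = 0"
      using Td by (metis (no_types, lifting) dim_mult_mat_vec index_smult_vec index_zero_vec(1))
    then show False
      using r(2) by (auto simp: prod_zero_iff simp flip: of_nat_Suc of_nat_add)
  qed
qed

end

text \<open>Writing \<open>K = F E\<close>, one has \<open>F^(n+1) E^(n+1) = F^n K E^n\<close>, and
  moving \<open>K\<close> to the right of \<open>E^n\<close> turns it into
  \<open>K - n H - n (n + 1)\<close>. Nilpotency of \<open>E\<close> thus becomes a polynomial
  relation between \<open>K\<close> and \<open>H\<close>.\<close>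

lemma raising_lowering_product:
  fixes E F H :: "complex mat"
  assumes E: "E \<in> carrier_mat d d" and F: "F \<in> carrier_mat d d" and H: "H \<in> carrier_mat d d"
    and HE: "H * E - E * H = 2 \<cdot>\<^sub>m E" and EF: "E * F - F * E = H"
  shows "F ^\<^sub>m n * E ^\<^sub>m n =
    mat_prod d (\<lambda>i. F * E - of_nat i \<cdot>\<^sub>m H - of_nat (i * (i + 1)) \<cdot>\<^sub>m 1\<^sub>m d) n"
proof (induction n)
  case (Suc n)
  let ?K = "F * E" and ?x = "\<lambda>i::nat. F * E - of_nat i \<cdot>\<^sub>m H - of_nat (i * (i + 1)) \<cdot>\<^sub>m 1\<^sub>m d"
  have dm: "dim_row E = d" "dim_col E = d" "dim_row F = d" "dim_col F = d" "dim_row H = d" "dim_col H = d"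
    using E F H by auto
  have dp: "dim_row (E ^\<^sub>m n) = d" "dim_col (E ^\<^sub>m n) = d" "dim_row (F ^\<^sub>m n) = d" "dim_col (F ^\<^sub>m n) = d" for n
    using carrier_matD[OF pow_carrier_mat[OF E]] carrier_matD[OF pow_carrier_mat[OF F]] by auto
  note [simp del] = pow_mat_dim index_mult_mat(1)
  have move: "X = Y + Z" if "X - Y = Z" "dim_row X = d" "dim_col X = d" "dim_row Y = d" "dim_col Y = d"
    for X Y Z :: "complex mat"
    using that by (auto intro!: eq_matI)
  have HEn: "H * E ^\<^sub>m n = E ^\<^sub>m n * H + (of_nat n * 2) \<cdot>\<^sub>m E ^\<^sub>m n" for n
    by (rule bracket_pow[OF H E HE])
  have EFE: "E * F = F * E + H"
    by (rule move[OF EF]) (simp_all add: dm)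
  have HEc: "H * E = E * H + 2 \<cdot>\<^sub>m E"
    by (rule move[OF HE]) (simp_all add: dm)
  have KE: "?K * E = E * (?K - H - 2 \<cdot>\<^sub>m 1\<^sub>m d)"
  proof -
    have "E * ?K = ?K * E + H * E"
      using dm EFE by (simp add: mat_distribs flip: mat_assoc)
    then have "E * ?K = ?K * E + (E * H + 2 \<cdot>\<^sub>m E)"
      unfolding HEc .
    then have "?K * E = E * ?K - (E * H + 2 \<cdot>\<^sub>m E)"
      using dm by (intro eq_matI) auto
    then show ?thesis
      using dm by (simp add: mat_distribs) (rule eq_matI, auto)
  qed
  have comm: "E * E ^\<^sub>m n = E ^\<^sub>m n * E" for n
    by (rule pow_mat_commute[OF E E]) simp
  have commF: "F * F ^\<^sub>m n = F ^\<^sub>m n * F" for n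
    by (rule pow_mat_commute[OF F F]) simp
  have KEn: "?K * E ^\<^sub>m n = E ^\<^sub>m n * ?x n" for n
  proof (induction n)
    case (Suc n)
    have "?K * E ^\<^sub>m Suc n = ?K * E * E ^\<^sub>m n"
      using dm dp by (simp add: mat_assoc comm)
    also have "\<dots> = E * (?K * E ^\<^sub>m n - H * E ^\<^sub>m n - 2 \<cdot>\<^sub>m E ^\<^sub>m n)"
      unfolding KE using dm dp by (simp add: mat_assoc mat_distribs)
    also have "\<dots> = E * (E ^\<^sub>m n * ?x n - (E ^\<^sub>m n * H + (of_nat n * 2) \<cdot>\<^sub>m E ^\<^sub>m n) - 2 \<cdot>\<^sub>m E ^\<^sub>m n)"
      unfolding Suc HEn ..
    also have "E ^\<^sub>m n * ?x n - (E ^\<^sub>m n * H + (of_nat n * 2) \<cdot>\<^sub>m E ^\<^sub>m n) - 2 \<cdot>\<^sub>m E ^\<^sub>m n = E ^\<^sub>m n * ?x (Suc n)"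
      using dm dp by (simp add: mat_distribs) (rule eq_matI, auto simp: algebra_simps)
    finally show ?case
      using dm dp by (simp add: comm flip: mat_assoc)
  qed (use dm in \<open>auto intro!: eq_matI\<close>)
  have "F ^\<^sub>m Suc n * E ^\<^sub>m Suc n = F ^\<^sub>m n * (?K * E ^\<^sub>m n)"
    using dm dp by (simp add: mat_assoc flip: comm)
  also have "\<dots> = F ^\<^sub>m n * E ^\<^sub>m n * ?x n"
    unfolding KEn using dm dp by (simp add: mat_assoc)
  finally show ?case
    unfolding Suc by simp
qed (use E F in auto)

text \<open>Bracketing with \<open>H\<close> scales \<open>E\<close> and \<open>F\<close> by 2 and
  -2, hence both are nilpotent, and the two products required by \<open>weight_semisimple\<close>
  vanish.\<close>

lemma sl2_triple_spectrum:
  fixes E F H :: "complex mat"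
  assumes E: "E \<in> carrier_mat d d" and F: "F \<in> carrier_mat d d" and H: "H \<in> carrier_mat d d"
    and HE: "H * E - E * H = 2 \<cdot>\<^sub>m E" and HF: "H * F - F * H = - 2 \<cdot>\<^sub>m F" and EF: "E * F - F * E = H"
  shows "spec_in (range of_int) True H"
proof (rule weight_semisimple)
  have dm: "dim_row E = d" "dim_col E = d" "dim_row F = d" "dim_col F = d" "dim_row H = d" "dim_col H = d"
    using E F H by auto
  note [simp del] = pow_mat_dim index_mult_mat(1)
  have move: "X = Y + Z" if "X - Y = Z" "dim_row X = d" "dim_col X = d" "dim_row Y = d" "dim_col Y = d"
    for X Y Z :: "complex mat"
    using that by (auto intro!: eq_matI)
  have HEc: "H * E = E * H + 2 \<cdot>\<^sub>m E" and HFc: "H * F = F * H + - 2 \<cdot>\<^sub>m F"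
    by (rule move[OF HE], simp_all add: dm) (rule move[OF HF], simp_all add: dm)
  show "F * E * H = H * (F * E)"
  proof -
    have "H * (F * E) = H * F * E" using dm by (simp add: mat_assoc)
    also have "\<dots> = F * (H * E) + - 2 \<cdot>\<^sub>m (F * E)"
      unfolding HFc using dm by (simp add: mat_distribs mat_assoc)
    also have "\<dots> = F * (E * H)"
      unfolding HEc using dm by (simp add: mat_distribs) (rule eq_matI, auto)
    finally show ?thesis using dm by (simp add: mat_assoc)
  qed
  have nilp: "E ^\<^sub>m d = 0\<^sub>m d d" "F ^\<^sub>m d = 0\<^sub>m d d"
    using bracket_eigen_nilpotent[OF H E HE] bracket_eigen_nilpotent[OF H F HF] by auto
  have cong: "mat_prod d x n = mat_prod d y n" if "\<And>i. x i = y i" for x y n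
    using that by (induction n) auto
  have "mat_prod d (\<lambda>i. weight_lin (F * E) H d (- int i) (- (int i * (int i + 1)))) d =
      mat_prod d (\<lambda>i. F * E - of_nat i \<cdot>\<^sub>m H - of_nat (i * (i + 1)) \<cdot>\<^sub>m 1\<^sub>m d) d"
    using dm by (intro cong) (auto simp: weight_lin_def ring_distribs intro!: eq_matI)
  also have "\<dots> = F ^\<^sub>m d * E ^\<^sub>m d"
    by (rule raising_lowering_product[OF E F H HE EF, symmetric])
  finally show "mat_prod d (\<lambda>i. weight_lin (F * E) H d (- int i) (- (int i * (int i + 1)))) d = 0\<^sub>m d d"
    by (simp add: nilp)
  \<comment> \<open>\<open>(F, E, - H)\<close> satisfies the relations of \<open>(E, F, H)\<close>.
    Since \<open>E F = K + H\<close>, its factors \<open>E F + i H - i (i + 1)\<close> are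
    \<open>K + (i + 1) H - i (i + 1)\<close>.\<close>
  have "- H * F - F * - H = - (H * F - F * H)"
    using dm by (auto intro!: eq_matI)
  then have FE: "- H * F - F * - H = 2 \<cdot>\<^sub>m F"
    unfolding HF by (auto intro!: eq_matI)
  have "F * E - E * F = - (E * F - F * E)"
    using dm by (auto intro!: eq_matI)
  then have FE2: "F * E - E * F = - H"
    unfolding EF .
  have "mat_prod d (\<lambda>j. weight_lin (F * E) H d (int j + 1) (- (int j * (int j + 1)))) d =
      mat_prod d (\<lambda>i. E * F - of_nat i \<cdot>\<^sub>m - H - of_nat (i * (i + 1)) \<cdot>\<^sub>m 1\<^sub>m d) d"
    using dm move[OF EF] by (intro cong) (auto simp: weight_lin_def ring_distribs intro!: eq_matI)
  also have "\<dots> = E ^\<^sub>m d * F ^\<^sub>m d"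
    by (rule raising_lowering_product[OF F E _ FE FE2, symmetric]) (use H in auto)
  finally show "mat_prod d (\<lambda>j. weight_lin (F * E) H d (int j + 1) (- (int j * (int j + 1)))) d = 0\<^sub>m d d"
    by (simp add: nilp)
qed (use E F H in auto)

subsection \<open>Modules over the line spanned by an element of \<open>sl2\<close>\<close>

definition jordan_blocks :: "complex set \<Rightarrow> bool \<Rightarrow> (nat \<times> complex) set" where
  "jordan_blocks \<Lambda> ss = {(n, z). 0 < n \<and> z \<in> \<Lambda> \<and> (ss \<longrightarrow> n = 1)}"

locale line_element =
  fixes g :: "complex mat"
  assumes g_sl2: "g \<in> sl2" and g_nonzero: "g \<noteq> 0\<^sub>m 2 2"
begin

lemma g_dims: "dim_row g = 2" "dim_col g = 2"
  using g_sl2 by (auto simp: sl2_def)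

lemma smult_g_inj: "c \<cdot>\<^sub>m g = c' \<cdot>\<^sub>m g \<longleftrightarrow> c = c'"
proof
  obtain i j where ij: "i < 2" "j < 2" "g $$ (i, j) \<noteq> 0"
    using g_nonzero g_dims by (metis eq_matI index_zero_mat)
  assume "c \<cdot>\<^sub>m g = c' \<cdot>\<^sub>m g"
  then have "(c \<cdot>\<^sub>m g) $$ (i, j) = (c' \<cdot>\<^sub>m g) $$ (i, j)" by simp
  then show "c = c'" using ij g_dims by simp
qed simp

lemma g_line: "g \<in> line g"
  unfolding line_def by (rule CollectI, rule exI[of _ 1]) (auto intro!: eq_matI)

lemma line_lie_algebra: "matrix_lie_algebra (line g)"
proof
  fix x y assume "x \<in> line g" "y \<in> line g"
  then obtain a b where ab: "x = a \<cdot>\<^sub>m g" "y = b \<cdot>\<^sub>m g" by (auto simp: line_def)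
  have "x + y = (a + b) \<cdot>\<^sub>m g" "bracket x y = 0 \<cdot>\<^sub>m g"
    using g_dims by (auto simp: ab bracket_def mat_distribs algebra_simps intro!: eq_matI)
  then show "x + y \<in> line g" "bracket x y \<in> line g"
    by (auto simp: line_def)
next
  fix x c assume "x \<in> line g"
  then obtain a where "x = a \<cdot>\<^sub>m g" by (auto simp: line_def)
  then have "c \<cdot>\<^sub>m x = (c * a) \<cdot>\<^sub>m g" by (auto intro!: eq_matI)
  then show "c \<cdot>\<^sub>m x \<in> line g" by (auto simp: line_def)
qed

sublocale line: matrix_lie_algebra "line g"
  by (rule line_lie_algebra)

lemma line_subset: "line g \<subseteq> sl2"
  using sl2.smult_mem[OF g_sl2] by (auto simp: line_def)

abbreviation mods :: "lie_module set" where "mods \<equiv> lie_modules (line g)"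
abbreviation act :: "lie_module \<Rightarrow> complex mat" where "act N \<equiv> snd N g"
abbreviation hom :: "lie_module \<Rightarrow> lie_module \<Rightarrow> complex mat set" where "hom \<equiv> module_homs (line g)"

lemma line_module_simps [simp]:
  "fst (line_module g A) = dim_row A" "act (line_module g A) = A"
proof -
  have "(THE c. g = c \<cdot>\<^sub>m g) = 1"
  proof (rule the_equality)
    show one: "g = 1 \<cdot>\<^sub>m g" by (rule eq_matI) auto
    show "c = 1" if "g = c \<cdot>\<^sub>m g" for c
    proof -
      have "c \<cdot>\<^sub>m g = 1 \<cdot>\<^sub>m g"
        unfolding that[symmetric] one[symmetric] ..
      then show ?thesis by (simp only: smult_g_inj)
    qed
  qed
  then show "act (line_module g A) = A"
    using g_line by (auto simp: line_module_def intro!: eq_matI)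
qed (simp add: line_module_def)

lemma snd_line_module: "snd (line_module g A) (c \<cdot>\<^sub>m g) = c \<cdot>\<^sub>m A"
proof -
  have "c \<cdot>\<^sub>m g \<in> line g" by (auto simp: line_def)
  then show ?thesis by (simp add: line_module_def smult_g_inj)
qed

lemma line_module_mem: "A \<in> carrier_mat n n \<Longrightarrow> line_module g A \<in> mods"
proof (rule lie_modulesI)
  assume A: "A \<in> carrier_mat n n"
  fix x assume x: "x \<in> line g"
  then obtain a where a: "x = a \<cdot>\<^sub>m g" by (auto simp: line_def)
  then show "dim_row (snd (line_module g A) x) = fst (line_module g A)"
    "dim_col (snd (line_module g A) x) = fst (line_module g A)"
    using A by (auto simp: snd_line_module)
  show "snd (line_module g A) (c \<cdot>\<^sub>m x) = c \<cdot>\<^sub>m snd (line_module g A) x" for c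
  proof -
    have "c \<cdot>\<^sub>m x = (c * a) \<cdot>\<^sub>m g" unfolding a by (auto intro!: eq_matI)
    then show ?thesis by (auto simp: a snd_line_module intro!: eq_matI)
  qed
  fix y assume y: "y \<in> line g"
  then obtain b where b: "y = b \<cdot>\<^sub>m g" by (auto simp: line_def)
  have 1: "x + y = (a + b) \<cdot>\<^sub>m g" "bracket x y = 0 \<cdot>\<^sub>m g"
    using g_dims by (auto simp: a b bracket_def mat_distribs algebra_simps intro!: eq_matI)
  show "snd (line_module g A) (x + y) = snd (line_module g A) x + snd (line_module g A) y"
    unfolding 1 snd_line_module by (auto simp: a b snd_line_module algebra_simps intro!: eq_matI)
  show "snd (line_module g A) (bracket x y) = bracket (snd (line_module g A) x) (snd (line_module g A) y)"
    unfolding 1 snd_line_module using A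
    by (auto simp: a b snd_line_module bracket_def mat_distribs algebra_simps intro!: eq_matI)
qed (auto simp: line_module_def)

lemma act_dims [simp]: "N \<in> mods \<Longrightarrow> dim_row (act N) = fst N" "N \<in> mods \<Longrightarrow> dim_col (act N) = fst N"
  using lie_module_dims[OF _ g_line] by auto

lemma act_carrier: "N \<in> mods \<Longrightarrow> act N \<in> carrier_mat (fst N) (fst N)"
  by (auto intro: carrier_matI)

text \<open>By linearity it is enough to commute with \<open>g\<close>, which reduces modules over
  the line to single matrices.\<close>

lemma hom_iff:
  assumes "V \<in> mods" "W \<in> mods"
  shows "T \<in> hom V W \<longleftrightarrow> T \<in> carrier_mat (fst W) (fst V) \<and> T * act V = act W * T"
proof
  assume T: "T \<in> carrier_mat (fst W) (fst V) \<and> T * act V = act W * T"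
  show "T \<in> hom V W"
  proof (rule module_homsI)
    fix x assume "x \<in> line g"
    then obtain a where x: "x = a \<cdot>\<^sub>m g" by (auto simp: line_def)
    have "snd V x = a \<cdot>\<^sub>m act V" "snd W x = a \<cdot>\<^sub>m act W"
      unfolding x using lie_module_hom(2)[OF assms(1) g_line g_line] lie_module_hom(2)[OF assms(2) g_line g_line] by auto
    moreover have "dim_row T = fst W" "dim_col T = fst V"
      using T by auto
    ultimately show "T * snd V x = snd W x * T"
      using T assms by (simp add: mat_distribs)
  qed (use T in auto)
qed (auto simp: module_homs_def g_line)

lemma homD:
  assumes "T \<in> hom V W"
  shows "dim_row T = fst W" "dim_col T = fst V" "T * act V = act W * T"
  using assms g_line by (auto simp: module_homs_def)

lemma hom_carrier: "T \<in> hom V W \<Longrightarrow> T \<in> carrier_mat (fst W) (fst V)"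
  by (auto simp: module_homs_def)

lemma homI:
  assumes "V \<in> mods" "W \<in> mods" "dim_row T = fst W" "dim_col T = fst V" "T * act V = act W * T"
  shows "T \<in> hom V W"
  using assms hom_iff by (auto intro: carrier_matI)

lemma act_tensor:
  "act (module_tensor (line g) (module_restrict (line g) V) N) =
    kron (snd V g) (1\<^sub>m (fst N)) + kron (1\<^sub>m (fst V)) (act N)"
  using g_line by (simp add: module_restrict_def)

text \<open>Intrinsic description of the additive closures, justified by
  \<open>additive_closure_eq\<close>.\<close>

definition fam :: "complex set \<Rightarrow> bool \<Rightarrow> lie_module set" where
  "fam \<Lambda> ss = {N \<in> mods. spec_in \<Lambda> ss (act N)}"

abbreviation cat :: "complex set \<Rightarrow> bool \<Rightarrow> (lie_module, complex mat, lie_module, complex mat) modcat"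
  where "cat \<Lambda> ss \<equiv> sub_cat (line g) (fam \<Lambda> ss)"

abbreviation J :: "nat \<Rightarrow> complex \<Rightarrow> lie_module" where "J \<equiv> jordan_module g"

lemma fam_mods: "N \<in> fam \<Lambda> ss \<Longrightarrow> N \<in> mods"
  by (simp add: fam_def)

text \<open>Makes the results on \<open>cat\<close> available in the ambient category of all
  modules, where the additive closures are formed.\<close>

lemma fam_UNIV: "fam UNIV False = mods"
  by (simp add: fam_def spec_in_UNIV)

lemma J_simps [simp]: "fst (J n z) = n" "act (J n z) = jordan_block n z" "J n z \<in> mods"
  by (simp_all add: jordan_module_def line_module_mem[OF jordan_block_carrier])

lemma J_fam: "(n, z) \<in> jordan_blocks \<Lambda> ss \<Longrightarrow> J n z \<in> fam \<Lambda> ss"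
  by (auto simp: fam_def jordan_blocks_def spec_in_jordan_block)

section \<open>Biproducts, direct sums and split idempotents\<close>

lemma fam_summand:
  assumes "X \<in> fam \<Lambda> ss" "Y \<in> mods" "i \<in> hom Y X" "p \<in> hom X Y" "p * i = 1\<^sub>m (fst Y)"
  shows "Y \<in> fam \<Lambda> ss"
  using spec_in_summand[of \<Lambda> ss "act X" "fst X" "act Y" "fst Y" i p] assms
  by (auto simp: fam_def homD act_carrier hom_carrier)

text \<open>Membership in the family is demanded of \<open>X\<close> only; the summands inherit it
  by \<open>fam_summand\<close>.\<close>

lemma biproductI:
  assumes "X \<in> fam \<Lambda> ss" "Y \<in> mods" "Z \<in> mods" "i \<in> hom Y X" "p \<in> hom X Y" "j \<in> hom Z X" "q \<in> hom X Z"
    "p * i = 1\<^sub>m (fst Y)" "q * j = 1\<^sub>m (fst Z)" "p * j = 0\<^sub>m (fst Y) (fst Z)" "q * i = 0\<^sub>m (fst Z) (fst Y)"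
    "i * p + j * q = 1\<^sub>m (fst X)"
  shows "biproduct (cat \<Lambda> ss) X Y Z"
  using assms fam_summand[of X \<Lambda> ss Y i p] fam_summand[of X \<Lambda> ss Z j q]
  unfolding biproduct_def by auto

lemma biproductE:
  assumes "biproduct (cat \<Lambda> ss) X Y Z"
  obtains i p j q where "X \<in> fam \<Lambda> ss" "Y \<in> fam \<Lambda> ss" "Z \<in> fam \<Lambda> ss"
    "i \<in> hom Y X" "p \<in> hom X Y" "j \<in> hom Z X" "q \<in> hom X Z"
    "p * i = 1\<^sub>m (fst Y)" "q * j = 1\<^sub>m (fst Z)" "p * j = 0\<^sub>m (fst Y) (fst Z)" "q * i = 0\<^sub>m (fst Z) (fst Y)"
    "i * p + j * q = 1\<^sub>m (fst X)"
  using assms unfolding biproduct_def by auto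

lemma zero_obj_iff: "zero_obj (cat \<Lambda> ss) X \<longleftrightarrow> X \<in> fam \<Lambda> ss \<and> fst X = 0"
proof -
  have "(1\<^sub>m n :: complex mat) = 0\<^sub>m n n \<longleftrightarrow> n = 0" for n
  proof
    assume "(1\<^sub>m n :: complex mat) = 0\<^sub>m n n"
    then have "(1\<^sub>m n :: complex mat) $$ (0, 0) = 0\<^sub>m n n $$ (0, 0)" by simp
    then show "n = 0" by (cases n) auto
  qed auto
  then show ?thesis by (simp add: zero_obj_def)
qed

lemma zero_obj_mem: "line_module g (0\<^sub>m 0 0) \<in> fam \<Lambda> ss"
  unfolding fam_def using line_module_mem[of "0\<^sub>m 0 0" 0]
  by (auto intro!: spec_inI eq_vecI)

lemma biproduct_exists:
  assumes "Y \<in> fam \<Lambda> ss" "Z \<in> fam \<Lambda> ss"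
  shows "biproduct (cat \<Lambda> ss)
    (line_module g (four_block_mat (act Y) (0\<^sub>m (fst Y) (fst Z)) (0\<^sub>m (fst Z) (fst Y)) (act Z))) Y Z"
    (is "biproduct _ ?X _ _")
proof -
  have YZ: "act Y \<in> carrier_mat (fst Y) (fst Y)" "act Z \<in> carrier_mat (fst Z) (fst Z)" "Y \<in> mods" "Z \<in> mods"
    using assms by (auto dest: fam_mods intro: act_carrier)
  let ?A = "four_block_mat (act Y) (0\<^sub>m (fst Y) (fst Z)) (0\<^sub>m (fst Z) (fst Y)) (act Z)"
  have A: "?A \<in> carrier_mat (fst Y + fst Z) (fst Y + fst Z)"
    using YZ by simp
  obtain i j p q :: "complex mat" where bl:
    "dim_row i = fst Y + fst Z" "dim_col i = fst Y" "dim_row p = fst Y" "dim_col p = fst Y + fst Z"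
    "dim_row j = fst Y + fst Z" "dim_col j = fst Z" "dim_row q = fst Z" "dim_col q = fst Y + fst Z"
    "p * i = 1\<^sub>m (fst Y)" "q * j = 1\<^sub>m (fst Z)" "p * j = 0\<^sub>m (fst Y) (fst Z)" "q * i = 0\<^sub>m (fst Z) (fst Y)"
    "i * p + j * q = 1\<^sub>m (fst Y + fst Z)"
    "\<forall>A \<in> carrier_mat (fst Y) (fst Y). \<forall>D \<in> carrier_mat (fst Z) (fst Z).
      four_block_mat A (0\<^sub>m (fst Y) (fst Z)) (0\<^sub>m (fst Z) (fst Y)) D * i = i * A \<and>
      four_block_mat A (0\<^sub>m (fst Y) (fst Z)) (0\<^sub>m (fst Z) (fst Y)) D * j = j * D \<and>
      p * four_block_mat A (0\<^sub>m (fst Y) (fst Z)) (0\<^sub>m (fst Z) (fst Y)) D = A * p \<and>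
      q * four_block_mat A (0\<^sub>m (fst Y) (fst Z)) (0\<^sub>m (fst Z) (fst Y)) D = D * q"
    by (rule block_matrices)
  note comm = bl(14)[rule_format, OF YZ(1,2)]
  have X: "?X \<in> mods" "fst ?X = fst Y + fst Z" "act ?X = ?A"
    using line_module_mem[OF A] A by auto
  have "spec_in \<Lambda> ss ?A"
    by (rule spec_in_biproduct[OF A YZ(1,2), of i p j q])
      (use bl comm assms in \<open>auto simp: fam_def intro!: carrier_matI\<close>)
  then have "?X \<in> fam \<Lambda> ss"
    unfolding fam_def using X by simp
  then show ?thesis
    by (rule biproductI[of _ _ _ _ _ i p j q])
      (use bl comm X YZ in \<open>auto intro!: homI simp del: line_module_simps\<close>)
qed

lemma biproduct_similar:
  assumes X: "X \<in> fam \<Lambda> ss" and YZ: "Y \<in> mods" "Z \<in> mods"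
    and w: "similar_mat_wit (act X) (four_block_mat (act Y) (0\<^sub>m (fst Y) (fst Z)) (0\<^sub>m (fst Z) (fst Y)) (act Z)) P Q"
  shows "biproduct (cat \<Lambda> ss) X Y Z"
proof -
  let ?A = "four_block_mat (act Y) (0\<^sub>m (fst Y) (fst Z)) (0\<^sub>m (fst Z) (fst Y)) (act Z)"
  have YZc: "act Y \<in> carrier_mat (fst Y) (fst Y)" "act Z \<in> carrier_mat (fst Z) (fst Z)"
    using YZ by (auto intro: act_carrier)
  have Xm: "X \<in> mods" using X by (rule fam_mods)
  note wd = similar_mat_witD2[OF act_carrier[OF Xm] w]
  have n: "fst X = fst Y + fst Z"
    using wd(5) YZ by auto
  obtain i j p q :: "complex mat" where bl:
    "dim_row i = fst Y + fst Z" "dim_col i = fst Y" "dim_row p = fst Y" "dim_col p = fst Y + fst Z"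
    "dim_row j = fst Y + fst Z" "dim_col j = fst Z" "dim_row q = fst Z" "dim_col q = fst Y + fst Z"
    "p * i = 1\<^sub>m (fst Y)" "q * j = 1\<^sub>m (fst Z)" "p * j = 0\<^sub>m (fst Y) (fst Z)" "q * i = 0\<^sub>m (fst Z) (fst Y)"
    "i * p + j * q = 1\<^sub>m (fst Y + fst Z)"
    "\<forall>A \<in> carrier_mat (fst Y) (fst Y). \<forall>D \<in> carrier_mat (fst Z) (fst Z).
      four_block_mat A (0\<^sub>m (fst Y) (fst Z)) (0\<^sub>m (fst Z) (fst Y)) D * i = i * A \<and>
      four_block_mat A (0\<^sub>m (fst Y) (fst Z)) (0\<^sub>m (fst Z) (fst Y)) D * j = j * D \<and>
      p * four_block_mat A (0\<^sub>m (fst Y) (fst Z)) (0\<^sub>m (fst Z) (fst Y)) D = A * p \<and>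
      q * four_block_mat A (0\<^sub>m (fst Y) (fst Z)) (0\<^sub>m (fst Z) (fst Y)) D = D * q"
    by (rule block_matrices)
  note comm = bl(14)[rule_format, OF YZc]
  have d: "dim_row P = fst X" "dim_col P = fst X" "dim_row Q = fst X" "dim_col Q = fst X"
    "dim_row ?A = fst X" "dim_col ?A = fst X"
    using wd by auto
  have AP: "act X * P = P * ?A"
    using d wd(1,2) by (subst wd(3)) (simp add: mat_assoc)
  have QA: "Q * act X = ?A * Q"
    using d wd(1,2) by (subst wd(3)) (simp add: mat_mult_eq[OF wd(2)] mat_assoc)
  show ?thesis
  proof (rule biproductI[OF X YZ, of "P * i" "p * Q" "P * j" "q * Q"])
    let ?n = "fst Y + fst Z"
    have hom: "P * i * act Y = act X * (P * i) \<and> P * j * act Z = act X * (P * j) \<and>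
      p * Q * act X = act Y * (p * Q) \<and> q * Q * act X = act Z * (q * Q)"
    proof (intro conjI)
      have "P * i * act Y = P * (?A * i)" "P * j * act Z = P * (?A * j)"
        unfolding comm[THEN conjunct1] comm[THEN conjunct2, THEN conjunct1]
        by (rule mat_assoc; simp add: d bl n YZ)+
      moreover have "P * (?A * i) = act X * (P * i)" "P * (?A * j) = act X * (P * j)"
        by (subst mat_assoc[symmetric], simp_all only: d bl n, simp only: AP[symmetric],
          rule mat_assoc, simp_all only: act_dims[OF Xm] d bl n)+
      ultimately show "P * i * act Y = act X * (P * i)" "P * j * act Z = act X * (P * j)"
        by simp_all
      have "p * Q * act X = p * ?A * Q" "q * Q * act X = q * ?A * Q"
        by (subst mat_assoc, simp_all only: act_dims[OF Xm] d bl n, simp only: QA,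
          rule mat_assoc[symmetric], simp_all only: act_dims[OF Xm] d bl n)+
      then show "p * Q * act X = act Y * (p * Q)" "q * Q * act X = act Z * (q * Q)"
        unfolding comm[THEN conjunct2, THEN conjunct2, THEN conjunct1]
          comm[THEN conjunct2, THEN conjunct2, THEN conjunct2]
        by (simp_all add: mat_assoc d bl n YZ)
    qed
    show "P * i \<in> hom Y X" "P * j \<in> hom Z X" "p * Q \<in> hom X Y" "q * Q \<in> hom X Z"
      by (rule homI; simp add: d bl hom YZ Xm)+
    show "p * Q * (P * i) = 1\<^sub>m (fst Y)" "q * Q * (P * j) = 1\<^sub>m (fst Z)"
      "p * Q * (P * j) = 0\<^sub>m (fst Y) (fst Z)" "q * Q * (P * i) = 0\<^sub>m (fst Z) (fst Y)"
      using bl d n by (simp_all add: mat_assoc mat_mult_eq[OF wd(2)] del: index_mat_four_block)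
    have "P * i * (p * Q) + P * j * (q * Q) = P * (i * p + j * q) * Q"
      using bl(1-8) d n by (simp add: mat_assoc mat_distribs del: index_mat_four_block)
    also have "\<dots> = 1\<^sub>m (fst X)"
      unfolding bl(13) using d n wd(1) by (simp del: index_mat_four_block)
    finally show "P * i * (p * Q) + P * j * (q * Q) = 1\<^sub>m (fst X)" .
  qed
qed

lemma direct_sum_jordan:
  assumes "X \<in> fam \<Lambda> ss" "similar_mat_wit (act X) (jordan_matrix ns) P Q"
  shows "direct_sum (cat \<Lambda> ss) X (map (\<lambda>(n, z). J n z) ns)"
  using assms
proof (induction ns arbitrary: X P Q)
  case Nil
  have "(jordan_matrix [] :: complex mat) \<in> carrier_mat (fst X) (fst X)"
    by (rule similar_mat_witD2(5)[OF act_carrier[OF fam_mods[OF Nil.prems(1)]] Nil.prems(2)])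
  then show ?case using Nil by (auto simp: zero_obj_iff)
next
  case (Cons b ns)
  obtain n z where b: "b = (n, z)" by force
  define Z where "Z = line_module g (jordan_matrix ns)"
  have Z: "Z \<in> mods" "fst Z = sum_list (map fst ns)" "act Z = jordan_matrix ns"
    using line_module_mem[OF jordan_matrix_carrier, of ns] by (auto simp: Z_def)
  have bp: "biproduct (cat \<Lambda> ss) X (J n z) Z"
  proof (rule biproduct_similar[OF Cons.prems(1)])
    show "similar_mat_wit (act X) (four_block_mat (act (J n z)) (0\<^sub>m (fst (J n z)) (fst Z))
        (0\<^sub>m (fst Z) (fst (J n z))) (act Z)) P Q"
      using Cons.prems(2) by (simp add: b jordan_matrix_Cons Z)
  qed (simp_all add: Z)
  have "Z \<in> fam \<Lambda> ss" using bp by (auto elim: biproductE)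
  moreover have "similar_mat_wit (act Z) (jordan_matrix ns) (1\<^sub>m (fst Z)) (1\<^sub>m (fst Z))"
    using similar_mat_wit_refl[OF jordan_matrix_carrier, of ns] by (simp add: Z)
  ultimately have "direct_sum (cat \<Lambda> ss) Z (map (\<lambda>(n, z). J n z) ns)"
    by (rule Cons.IH)
  with bp show ?case by (simp add: b del: split_paired_Ex) blast
qed

lemma split_idempotent:
  assumes X: "X \<in> fam \<Lambda> ss" and e: "e \<in> hom X X" "e * e = e"
  obtains Z j q where "Z \<in> fam \<Lambda> ss" "j \<in> hom Z X" "q \<in> hom X Z" "j * q = e" "q * j = 1\<^sub>m (fst Z)"
proof -
  have Xm: "X \<in> mods" using X by (rule fam_mods)
  obtain r i p where ip: "i \<in> carrier_mat (fst X) r" "p \<in> carrier_mat r (fst X)" "p * i = 1\<^sub>m r" "i * p = e"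
    by (rule idempotent_split_mat[OF hom_carrier[OF e(1)] e(2)])
  \<comment> \<open>The action on the image of \<open>e\<close> is the compression of the action on
    \<open>X\<close>; it makes \<open>i\<close> and \<open>p\<close> intertwiners because
    \<open>e\<close> commutes with \<open>act X\<close>.\<close>
  define Z where "Z = line_module g (p * act X * i)"
  have d: "dim_row i = fst X" "dim_col i = r" "dim_row p = r" "dim_col p = fst X"
    "dim_row e = fst X" "dim_col e = fst X"
    using ip homD[OF e(1)] by auto
  have "p * act X * i \<in> carrier_mat r r"
    by (rule carrier_matI) (simp_all add: d)
  then have Z: "Z \<in> mods" "fst Z = r" "act Z = p * act X * i"
    using line_module_mem d by (simp_all add: Z_def)
  have comm: "e * act X = act X * e"
    using homD(3)[OF e(1)] .
  have ei: "e * i = i" "p * e = p"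
    using d ip(3) by (simp_all add: ip(4)[symmetric] mat_assoc mat_mult_eq[OF ip(3)])
  have i: "i \<in> hom Z X"
  proof (rule homI[OF Z(1) Xm])
    have "i * act Z = e * act X * i"
      using d Xm by (simp add: Z mat_assoc ip(4)[symmetric])
    also have "\<dots> = act X * i"
      unfolding comm using d Xm by (simp add: mat_assoc ei)
    finally show "i * act Z = act X * i" .
  qed (simp_all add: d Z)
  have p: "p \<in> hom X Z"
  proof (rule homI[OF Xm Z(1)])
    have "act Z * p = p * (act X * e)"
      using d Xm by (simp add: Z mat_assoc ip(4)[symmetric])
    also have "\<dots> = p * act X"
      unfolding comm[symmetric] using d Xm by (simp add: ei flip: mat_assoc)
    finally show "p * act X = act Z * p" by simp
  qed (simp_all add: d Z)
  have "Z \<in> fam \<Lambda> ss"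
    using fam_summand[OF X Z(1) i p] ip Z by simp
  then show thesis
    using that i p ip Z by blast
qed

lemma hom_comp: "U \<in> mods \<Longrightarrow> V \<in> mods \<Longrightarrow> W \<in> mods \<Longrightarrow> S \<in> hom U V \<Longrightarrow> T \<in> hom V W \<Longrightarrow> T * S \<in> hom U W"
  by (rule module_homs_comp)

text \<open>A retraction has a complement: the idempotent \<open>1 - i * p\<close> splits, and its
  image is the other summand.\<close>

lemma direct_summandI:
  assumes X: "X \<in> fam \<Lambda> ss" and Y: "Y \<in> mods" and ip: "i \<in> hom Y X" "p \<in> hom X Y" "p * i = 1\<^sub>m (fst Y)"
  shows "direct_summand (cat \<Lambda> ss) Y X"
proof -
  have Xm: "X \<in> mods" using X by (rule fam_mods)
  note d = homD(1,2)[OF ip(1)] homD(1,2)[OF ip(2)]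
  have iph: "i * p \<in> hom X X" by (rule hom_comp[OF Xm Y Xm ip(2,1)])
  define e where "e = 1\<^sub>m (fst X) - i * p"
  have ed: "dim_row e = fst X" "dim_col e = fst X" using d by (simp_all add: e_def)
  have pe: "p * e = 0\<^sub>m (fst Y) (fst X)" and ei: "e * i = 0\<^sub>m (fst X) (fst Y)"
    using d ip(3) by (auto simp: e_def mat_distribs mat_assoc mat_mult_eq[OF ip(3)])
  have "e \<in> hom X X"
    using homD[OF iph] Xm d by (intro homI[OF Xm Xm]) (simp_all add: e_def mat_distribs)
  moreover have "e * e = e"
  proof -
    have "e * e = e - i * (p * e)"
      using ed d by (subst (1) e_def) (simp add: mat_distribs mat_assoc)
    then show ?thesis using pe ed d by (auto intro!: eq_matI)
  qed
  ultimately obtain Z j q where Z: "Z \<in> fam \<Lambda> ss" "j \<in> hom Z X" "q \<in> hom X Z" "j * q = e" "q * j = 1\<^sub>m (fst Z)"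
    by (rule split_idempotent[OF X])
  note dZ = homD(1,2)[OF Z(2)] homD(1,2)[OF Z(3)]
  have "p * j = p * (j * q) * j"
    using d dZ Z(5) by (simp add: mat_assoc)
  then have pj: "p * j = 0\<^sub>m (fst Y) (fst Z)"
    using d dZ by (simp add: Z(4) pe)
  have "q * i = q * ((j * q) * i)"
    using d dZ by (simp add: mat_assoc mat_mult_eq[OF Z(5)])
  then have qi: "q * i = 0\<^sub>m (fst Z) (fst Y)"
    using d dZ by (simp add: Z(4) ei)
  have "i * p + j * q = 1\<^sub>m (fst X)"
    unfolding Z(4) e_def using d by (auto intro!: eq_matI simp del: index_mult_mat(1))
  then have "biproduct (cat \<Lambda> ss) X Y Z"
    using biproductI[OF X Y fam_mods[OF Z(1)] ip(1,2) Z(2,3) ip(3) Z(5) pj qi] by blast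
  then show ?thesis unfolding direct_summand_def by blast
qed

lemma direct_summandE:
  assumes "direct_summand (cat \<Lambda> ss) Y X"
  obtains i p where "X \<in> fam \<Lambda> ss" "Y \<in> fam \<Lambda> ss" "i \<in> hom Y X" "p \<in> hom X Y" "p * i = 1\<^sub>m (fst Y)"
  using assms unfolding direct_summand_def by (auto elim!: biproductE)

lemma idempotent_split_cat: "idempotent_split (cat \<Lambda> ss)"
  unfolding idempotent_split_def sub_cat_simps
proof (intro ballI impI)
  fix X e assume "X \<in> fam \<Lambda> ss" "e \<in> hom X X" "e * e = e"
  then show "\<exists>Y\<in>fam \<Lambda> ss. \<exists>p\<in>hom X Y. \<exists>i\<in>hom Y X. i * p = e \<and> p * i = 1\<^sub>m (fst Y)"
    by (meson split_idempotent)
qed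

lemma additive_cat: "additive_category (cat \<Lambda> ss)"
  unfolding additive_category_def
proof (intro conjI)
  show "linear_category (cat \<Lambda> ss)"
    by (rule sub_cat_linear) (auto dest: fam_mods)
  show "\<exists>X. zero_obj (cat \<Lambda> ss) X"
    using zero_obj_mem by (intro exI[of _ "line_module g (0\<^sub>m 0 0)"]) (simp add: zero_obj_iff)
  show "\<forall>Y\<in>Obj (cat \<Lambda> ss). \<forall>Z\<in>Obj (cat \<Lambda> ss). \<exists>X. biproduct (cat \<Lambda> ss) X Y Z"
    using biproduct_exists by (metis sub_cat_simps(1))
qed

section \<open>Local endomorphism rings and the classification of indecomposables\<close>

lemma det_nonzero_inverse:
  fixes A :: "complex mat"
  assumes "A \<in> carrier_mat n n" "det A \<noteq> 0"
  obtains B where "B \<in> carrier_mat n n" "A * B = 1\<^sub>m n" "B * A = 1\<^sub>m n"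
  using det_non_zero_imp_unit[OF assms, of "()"] unfolding Units_def ring_mat_simps by auto

text \<open>The inverse matrix of an intertwiner is again an intertwiner.\<close>

lemma iso_endo_iff:
  assumes "X \<in> mods"
  shows "iso_mor (sub_cat (line g) S) X X T \<longleftrightarrow> T \<in> hom X X \<and> det T \<noteq> 0"
proof
  assume "iso_mor (sub_cat (line g) S) X X T"
  then obtain R where R: "T \<in> hom X X" "R \<in> hom X X" "R * T = 1\<^sub>m (fst X)"
    by (auto simp: iso_mor_def inverse_mor_def)
  then have "det R * det T = 1"
    using det_mult[OF hom_carrier[OF R(2)] hom_carrier[OF R(1)]] by simp
  with R show "T \<in> hom X X \<and> det T \<noteq> 0" by auto
next
  assume T: "T \<in> hom X X \<and> det T \<noteq> 0"
  obtain R where R: "R \<in> carrier_mat (fst X) (fst X)" "T * R = 1\<^sub>m (fst X)" "R * T = 1\<^sub>m (fst X)"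
    using det_nonzero_inverse[of T "fst X"] T hom_carrier by blast
  note d = homD[OF T[THEN conjunct1]] carrier_matD[OF R(1)]
  have "R * act X = R * (act X * (T * R))"
    using assms d(1,2,4,5) by (simp add: R(2))
  also have "\<dots> = R * ((act X * T) * R)"
    using assms d(1,2,4,5) by (simp add: mat_assoc)
  also have "\<dots> = R * (T * (act X * R))"
    unfolding d(3)[symmetric] using assms d(1,2,4,5) by (simp add: mat_assoc)
  also have "\<dots> = act X * R"
    using assms d(1,2,4,5) by (simp add: mat_mult_eq[OF R(3)])
  finally have "R \<in> hom X X"
    using assms d by (intro homI) auto
  with T R show "iso_mor (sub_cat (line g) S) X X T"
    by (auto simp: iso_mor_def inverse_mor_def)
qed

text \<open>Comparing entries of the two products shows that \<open>T\<close> is constant along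
  diagonals and zero below the main one: an upper triangular Toeplitz matrix, i.e. a polynomial in
  the nilpotent part of the block.\<close>

lemma endo_J:
  assumes T: "T \<in> hom (J n z) (J n z)"
  shows "upper_triangular T" "\<And>i. i < n \<Longrightarrow> T $$ (i, i) = T $$ (0, 0)"
proof -
  have d: "dim_row T = n" "dim_col T = n" "T * jordan_block n z = jordan_block n z * T"
    using homD[OF T] by auto
  have eq: "(if j = 0 then 0 else T $$ (i, j - 1)) = (if Suc i < n then T $$ (Suc i, j) else 0)"
    if ij: "i < n" "j < n" for i j
  proof -
    have "(T * jordan_block n z) $$ (i, j) = (\<Sum>k<n. T $$ (i, k) * jordan_block n z $$ (k, j))"
      using ij d(1,2) by (subst mat_mult_index) auto
    also have "\<dots> = (\<Sum>k<n. (if k = j then T $$ (i, j) * z else 0) + (if Suc k = j then T $$ (i, k) else 0))"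
      using ij by (intro sum.cong) auto
    also have "\<dots> = T $$ (i, j) * z + (if j = 0 then 0 else T $$ (i, j - 1))"
      using ij by (cases j) (simp_all add: sum.distrib)
    finally have 1: "(T * jordan_block n z) $$ (i, j) = T $$ (i, j) * z + (if j = 0 then 0 else T $$ (i, j - 1))" .
    have "(jordan_block n z * T) $$ (i, j) = (\<Sum>k<n. jordan_block n z $$ (i, k) * T $$ (k, j))"
      using ij d(1,2) by (subst mat_mult_index) auto
    also have "\<dots> = (\<Sum>k<n. (if k = i then z * T $$ (i, j) else 0) + (if k = Suc i then T $$ (k, j) else 0))"
      using ij by (intro sum.cong) auto
    also have "\<dots> = z * T $$ (i, j) + (if Suc i < n then T $$ (Suc i, j) else 0)"
      using ij by (simp add: sum.distrib)
    finally show ?thesis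
      using 1 d(3) by simp
  qed
  have low: "T $$ (i, j) = 0" if "j < i" "i < n" for i j
    using that
  proof (induction j arbitrary: i)
    case 0
    then show ?case using eq[of "i - 1" 0] by simp
  next
    case (Suc j)
    then show ?case using eq[of "i - 1" "Suc j"] Suc.IH[of "i - 1"] by simp
  qed
  then show "upper_triangular T" using d by (auto simp: upper_triangular_def)
  show "T $$ (i, i) = T $$ (0, 0)" if "i < n" for i
    using that
  proof (induction i)
    case (Suc i)
    then show ?case using eq[of i "Suc i"] by simp
  qed simp
qed

lemma det_endo_J:
  assumes T: "T \<in> hom (J n z) (J n z)"
  shows "det T = T $$ (0, 0) ^ n" "mtrace T = of_nat n * T $$ (0, 0)"
proof -
  have d: "dim_row T = n" "dim_col T = n" using homD[OF T] by auto
  have "det T = prod_list (diag_mat T)"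
    by (rule det_upper_triangular[OF endo_J(1)[OF T], of n]) (use d in auto)
  also have "diag_mat T = replicate n (T $$ (0, 0))"
    unfolding diag_mat_def d
  proof (rule replicate_eqI)
    fix y assume "y \<in> set (map (\<lambda>i. T $$ (i, i)) [0..<n])"
    then obtain i where "i < n" "y = T $$ (i, i)" by auto
    with endo_J(2)[OF T] show "y = T $$ (0, 0)" by blast
  qed simp
  finally show "det T = T $$ (0, 0) ^ n" by simp
  have "mtrace T = (\<Sum>i<n. T $$ (0, 0))"
    unfolding mtrace_def d by (rule sum.cong[OF refl], rule endo_J(2)[OF T], simp)
  then show "mtrace T = of_nat n * T $$ (0, 0)" by simp
qed

lemma iso_endo_J:
  "0 < n \<Longrightarrow> iso_mor (sub_cat (line g) S) (J n z) (J n z) T \<longleftrightarrow> T \<in> hom (J n z) (J n z) \<and> T $$ (0, 0) \<noteq> 0"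
  by (auto simp: iso_endo_iff det_endo_J)

text \<open>Invertibility is decided by the entry at \<open>(0, 0)\<close>, which is additive; if
  the sum of two such entries is nonzero, so is one of them.\<close>

lemma local_end_J:
  assumes "0 < n" "J n z \<in> S"
  shows "local_end (sub_cat (line g) S) (J n z)"
proof -
  have "(1\<^sub>m n :: complex mat) $$ (0, 0) \<noteq> 0\<^sub>m n n $$ (0, 0)"
    using assms by simp
  then have "(1\<^sub>m n :: complex mat) \<noteq> 0\<^sub>m n n" by (rule contrapos_nn) (simp only:)
  moreover have "iso_mor (sub_cat (line g) S) (J n z) (J n z) f \<or> iso_mor (sub_cat (line g) S) (J n z) (J n z) f'"
    if "f \<in> hom (J n z) (J n z)" "f' \<in> hom (J n z) (J n z)" "iso_mor (sub_cat (line g) S) (J n z) (J n z) (f + f')" for f f'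
    using that assms(1) homD(1,2)[OF that(2)] by (auto simp: iso_endo_J)
  ultimately show ?thesis
    using assms by (simp add: local_end_def)
qed

text \<open>The identity is \<open>i * p + j * q\<close>, so one of the two idempotents is
  invertible, say \<open>i * p\<close>. It annihilates \<open>j\<close>, so the complementary
  summand is zero.\<close>

lemma local_end_indecomposable:
  assumes "local_end (cat \<Lambda> ss) X"
  shows "indecomposable (cat \<Lambda> ss) X"
proof -
  have X: "X \<in> fam \<Lambda> ss" and nz: "fst X \<noteq> 0"
    using assms zero_obj_iff[of \<Lambda> ss X] by (auto simp: local_end_def zero_obj_def)
  have Xm: "X \<in> mods" using X by (rule fam_mods)
  have "fst Y = 0 \<or> fst Z = 0" if bp: "biproduct (cat \<Lambda> ss) X Y Z" for Y Z
  proof -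
    obtain i p j q where b: "Y \<in> fam \<Lambda> ss" "Z \<in> fam \<Lambda> ss"
      "i \<in> hom Y X" "p \<in> hom X Y" "j \<in> hom Z X" "q \<in> hom X Z"
      "p * i = 1\<^sub>m (fst Y)" "q * j = 1\<^sub>m (fst Z)" "p * j = 0\<^sub>m (fst Y) (fst Z)" "q * i = 0\<^sub>m (fst Z) (fst Y)"
      "i * p + j * q = 1\<^sub>m (fst X)"
      using bp by (rule biproductE)
    note d = homD(1,2)[OF b(3)] homD(1,2)[OF b(4)] homD(1,2)[OF b(5)] homD(1,2)[OF b(6)]
    have key: "fst W = 0" if iso: "iso_mor (cat \<Lambda> ss) X X (k * l)" and that: "l * m = 0\<^sub>m (fst V) (fst W)" "r * m = 1\<^sub>m (fst W)"
      "dim_row k = fst X" "dim_col k = fst V" "dim_row l = fst V" "dim_col l = fst X"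
      "dim_row m = fst X" "dim_col m = fst W" "dim_row r = fst W" "dim_col r = fst X" for V W k l m r
    proof -
      obtain R where "R \<in> hom X X" and R1: "R * (k * l) = 1\<^sub>m (fst X)"
        using iso unfolding iso_mor_def inverse_mor_def sub_cat_simps by blast
      then have R: "R * (k * l) = 1\<^sub>m (fst X)" "dim_row R = fst X" "dim_col R = fst X"
        by (simp_all add: homD(1,2))
      have "1\<^sub>m (fst W) = r * (R * (k * l) * m)"
        using that by (simp add: R)
      also have "\<dots> = 0\<^sub>m (fst W) (fst W)"
        using that R(2,3) by (simp add: mat_assoc)
      finally have "1\<^sub>m (fst W) = (0\<^sub>m (fst W) (fst W) :: complex mat)" .
      then have "(1\<^sub>m (fst W) :: complex mat) $$ (0, 0) = 0\<^sub>m (fst W) (fst W) $$ (0, 0)" by simp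
      then show "fst W = 0" by (cases "fst W") auto
    qed
    have "iso_mor (cat \<Lambda> ss) X X (1\<^sub>m (fst X))"
      using Xm by (simp add: iso_endo_iff)
    then have "iso_mor (cat \<Lambda> ss) X X (i * p + j * q)"
      unfolding b(11) .
    moreover have "i * p \<in> hom X X" "j * q \<in> hom X X"
      using hom_comp[OF Xm fam_mods[OF b(1)] Xm b(4,3)] hom_comp[OF Xm fam_mods[OF b(2)] Xm b(6,5)] by auto
    ultimately have "iso_mor (cat \<Lambda> ss) X X (i * p) \<or> iso_mor (cat \<Lambda> ss) X X (j * q)"
      using assms unfolding local_end_def by (simp del: split_paired_All)
    then show ?thesis
    proof
      assume "iso_mor (cat \<Lambda> ss) X X (i * p)"
      from key[OF this b(9,8) d] show ?thesis by simp
    next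
      assume "iso_mor (cat \<Lambda> ss) X X (j * q)"
      from key[OF this b(10,7) d(5,6,7,8,1,2,3,4)] show ?thesis by simp
    qed
  qed
  moreover have "Y \<in> fam \<Lambda> ss" "Z \<in> fam \<Lambda> ss" if "biproduct (cat \<Lambda> ss) X Y Z" for Y Z
    using that by (auto simp: biproduct_def)
  ultimately have "zero_obj (cat \<Lambda> ss) Y \<or> zero_obj (cat \<Lambda> ss) Z"
    if "biproduct (cat \<Lambda> ss) X Y Z" for Y Z
    using that unfolding zero_obj_iff by blast
  with X nz show ?thesis
    unfolding indecomposable_def zero_obj_iff sub_cat_simps by blast
qed

lemma jordan_decomposition:
  assumes "X \<in> fam \<Lambda> ss"
  obtains ns where "direct_sum (cat \<Lambda> ss) X (map (\<lambda>(n, z). J n z) ns)" "set ns \<subseteq> jordan_blocks \<Lambda> ss"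
proof -
  obtain ns P Q where w: "0 \<notin> fst ` set ns" "similar_mat_wit (act X) (jordan_matrix ns) P Q"
    by (rule jordan_nf_complex[OF act_carrier[OF fam_mods[OF assms]]])
  have "spec_in \<Lambda> ss (jordan_matrix ns)"
    using assms spec_in_similar[OF _ act_carrier[OF fam_mods[OF assms]] w(2)] by (simp add: fam_def)
  note blocks = jordan_matrix_blocks[OF this]
  have "set ns \<subseteq> jordan_blocks \<Lambda> ss"
  proof
    fix b assume b: "b \<in> set ns"
    obtain n z where nz: "b = (n, z)" by force
    with b w(1) have "0 < n" by (force simp: image_iff)
    with blocks[of n z] b nz show "b \<in> jordan_blocks \<Lambda> ss" by (auto simp: jordan_blocks_def)
  qed
  with direct_sum_jordan[OF assms w(2)] show thesis by (rule that)
qed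

text \<open>The direct sum is formed among all modules, as in the additive closure, so the spectral
  condition on \<open>X\<close> has to be assembled from the summands.\<close>

lemma direct_sum_spec_in:
  assumes "direct_sum (cat UNIV False) X Ys" "\<And>Y. Y \<in> set Ys \<Longrightarrow> Y \<in> fam \<Lambda> ss"
  shows "X \<in> fam \<Lambda> ss"
  using assms
proof (induction Ys arbitrary: X)
  case Nil
  then have "zero_obj (cat UNIV False) X" by simp
  then have "X \<in> mods" "fst X = 0" unfolding zero_obj_iff by (auto dest: fam_mods)
  then show ?case by (auto simp: fam_def intro!: spec_inI eq_vecI)
next
  case (Cons Y Ys)
  from Cons.prems(1) obtain Z where bp: "biproduct (cat UNIV False) X Y Z" and "direct_sum (cat UNIV False) Z Ys"
    unfolding direct_sum.simps by blast
  with Cons have Z: "Z \<in> fam \<Lambda> ss" and Y: "Y \<in> fam \<Lambda> ss" by auto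
  obtain i p j q where b: "X \<in> fam UNIV False" "i \<in> hom Y X" "p \<in> hom X Y" "j \<in> hom Z X" "q \<in> hom X Z"
    "i * p + j * q = 1\<^sub>m (fst X)"
    using bp by (rule biproductE)
  have "spec_in \<Lambda> ss (act X)"
    by (rule spec_in_biproduct[of _ "fst X" "act Y" "fst Y" "act Z" "fst Z" i p j q])
      (use Y Z b fam_UNIV in \<open>auto simp: fam_def homD(3) intro: act_carrier hom_carrier\<close>)
  then show ?case using b(1) by (simp add: fam_def)
qed

lemma additive_closure_eq:
  "additive_closure (sub_mod (line g)) {J n z | n z. (n, z) \<in> jordan_blocks \<Lambda> ss} = fam \<Lambda> ss"
proof (intro equalityI subsetI)
  \<comment> \<open>The additive closure refers to the category of all modules, which is the member
    of the family of categories \<open>cat\<close> without spectral condition.\<close>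
  have eq: "cat UNIV False = sub_mod (line g)"
    unfolding fam_UNIV by (rule sub_mod_eq[symmetric])
  fix X
  {
    assume "X \<in> additive_closure (sub_mod (line g)) {J n z | n z. (n, z) \<in> jordan_blocks \<Lambda> ss}"
    then obtain Ys Z where Z: "set Ys \<subseteq> {J n z | n z. (n, z) \<in> jordan_blocks \<Lambda> ss}"
      "direct_sum (cat UNIV False) Z Ys" "direct_summand (cat UNIV False) X Z"
      unfolding additive_closure_def eq by blast
    have "Z \<in> fam \<Lambda> ss"
      by (rule direct_sum_spec_in[OF Z(2)]) (use Z(1) J_fam in blast)
    obtain i p where "i \<in> hom X Z" "p \<in> hom Z X" "p * i = 1\<^sub>m (fst X)" "X \<in> fam UNIV False"
      using Z(3) by (rule direct_summandE)
    with fam_summand[OF \<open>Z \<in> fam \<Lambda> ss\<close>] show "X \<in> fam \<Lambda> ss"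
      using fam_UNIV by blast
  }
  assume X: "X \<in> fam \<Lambda> ss"
  then have XU: "X \<in> fam UNIV False" by (auto simp: fam_UNIV dest: fam_mods)
  \<comment> \<open>\<open>jordan_decomposition\<close> would give a direct sum inside
    \<open>cat \<Lambda> ss\<close>. Here it has to be taken in the ambient category, while the
    blocks still satisfy the spectral condition of \<open>X\<close>.\<close>
  obtain ns P Q where w: "0 \<notin> fst ` set ns" "similar_mat_wit (act X) (jordan_matrix ns) P Q"
    by (rule jordan_nf_complex[OF act_carrier[OF fam_mods[OF X]]])
  have "spec_in \<Lambda> ss (jordan_matrix ns)"
    using X spec_in_similar[OF _ act_carrier[OF fam_mods[OF X]] w(2)] by (simp add: fam_def)
  note blocks = jordan_matrix_blocks[OF this]
  have "set (map (\<lambda>(n, z). J n z) ns) \<subseteq> {J n z | n z. (n, z) \<in> jordan_blocks \<Lambda> ss}"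
  proof
    fix Y assume "Y \<in> set (map (\<lambda>(n, z). J n z) ns)"
    then obtain n z where nz: "(n, z) \<in> set ns" "Y = J n z" by auto
    with w(1) have "0 < n" by (force simp: image_iff)
    with blocks[of n z] nz show "Y \<in> {J n z | n z. (n, z) \<in> jordan_blocks \<Lambda> ss}"
      by (auto simp: jordan_blocks_def)
  qed
  moreover have "direct_sum (cat UNIV False) X (map (\<lambda>(n, z). J n z) ns)"
    by (rule direct_sum_jordan[OF XU w(2)])
  moreover have "direct_summand (cat UNIV False) X X"
    using fam_mods[OF X] by (intro direct_summandI[OF XU, of X "1\<^sub>m (fst X)" "1\<^sub>m (fst X)"]) auto
  ultimately show "X \<in> additive_closure (sub_mod (line g)) {J n z | n z. (n, z) \<in> jordan_blocks \<Lambda> ss}"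
    unfolding additive_closure_def eq by blast
qed

lemma krull_schmidt_cat: "krull_schmidt (cat \<Lambda> ss)"
  unfolding krull_schmidt_def sub_cat_simps
proof
  fix X assume "X \<in> fam \<Lambda> ss"
  then obtain ns where ns: "direct_sum (cat \<Lambda> ss) X (map (\<lambda>(n, z). J n z) ns)" "set ns \<subseteq> jordan_blocks \<Lambda> ss"
    by (rule jordan_decomposition)
  have "local_end (cat \<Lambda> ss) Y" if Y: "Y \<in> set (map (\<lambda>(n, z). J n z) ns)" for Y
  proof -
    from Y obtain n z where nz: "(n, z) \<in> set ns" "Y = J n z" by auto
    then have "(n, z) \<in> jordan_blocks \<Lambda> ss" using ns(2) by blast
    then have "0 < n" "J n z \<in> fam \<Lambda> ss" by (auto simp: jordan_blocks_def intro: J_fam)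
    then show ?thesis using nz(2) local_end_J by simp
  qed
  with ns(1) show "\<exists>Ys. direct_sum (cat \<Lambda> ss) X Ys \<and> (\<forall>Y\<in>set Ys. local_end (cat \<Lambda> ss) Y)"
    by blast
qed

lemma indecomposable_J: "(n, z) \<in> jordan_blocks \<Lambda> ss \<Longrightarrow> indecomposable (cat \<Lambda> ss) (J n z)"
  by (rule local_end_indecomposable, rule local_end_J) (auto simp: jordan_blocks_def intro!: J_fam)

lemma biproduct_zero_iso:
  assumes bp: "biproduct (cat \<Lambda> ss) X Y Z" and Z: "fst Z = 0"
  shows "iso_obj (cat \<Lambda> ss) X Y"
proof -
  obtain i p j q where b: "X \<in> fam \<Lambda> ss" "Y \<in> fam \<Lambda> ss"
    "i \<in> hom Y X" "p \<in> hom X Y" "j \<in> hom Z X" "q \<in> hom X Z" "p * i = 1\<^sub>m (fst Y)"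
    "i * p + j * q = 1\<^sub>m (fst X)"
    using bp by (rule biproductE)
  have "j * q = 0\<^sub>m (fst X) (fst X)"
    using homD(1,2)[OF b(5)] homD(1,2)[OF b(6)] Z by (intro eq_matI) (auto simp: scalar_prod_def)
  moreover have "i * p + 0\<^sub>m (fst X) (fst X) = i * p"
    by (rule right_add_zero_mat[OF carrier_matI]) (simp_all add: homD(1,2)[OF b(3)] homD(1,2)[OF b(4)])
  ultimately have "i * p = 1\<^sub>m (fst X)"
    using b(8) by simp
  with b show ?thesis
    unfolding iso_obj_def iso_mor_def inverse_mor_def sub_cat_simps by blast
qed

lemma indecomposable_imp_J:
  assumes X: "indecomposable (cat \<Lambda> ss) X"
  obtains n z where "(n, z) \<in> jordan_blocks \<Lambda> ss" "iso_obj (cat \<Lambda> ss) X (J n z)"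
proof -
  have Xf: "X \<in> fam \<Lambda> ss" and nz: "fst X \<noteq> 0"
    using X by (auto simp: indecomposable_def zero_obj_iff)
  obtain ns where ns: "direct_sum (cat \<Lambda> ss) X (map (\<lambda>(n, z). J n z) ns)" "set ns \<subseteq> jordan_blocks \<Lambda> ss"
    using Xf by (rule jordan_decomposition)
  obtain n z ns' where ns': "ns = (n, z) # ns'"
    using ns(1) nz by (cases ns) (auto simp: zero_obj_iff)
  then have nz: "(n, z) \<in> jordan_blocks \<Lambda> ss" using ns(2) by simp
  obtain Z where Z: "biproduct (cat \<Lambda> ss) X (J n z) Z"
    using ns(1) unfolding ns' list.map direct_sum.simps prod.case by blast
  with X have "zero_obj (cat \<Lambda> ss) (J n z) \<or> zero_obj (cat \<Lambda> ss) Z"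
    unfolding indecomposable_def by blast
  then have "fst Z = 0"
    using nz by (auto simp: zero_obj_iff jordan_blocks_def)
  from biproduct_zero_iso[OF Z this] nz show thesis by (intro that)
qed

text \<open>The dimensions agree by \<open>mat_left_inverse_le\<close> in both directions; the trace
  \<open>n * z\<close> then determines the eigenvalue, as \<open>n > 0\<close>.\<close>

lemma iso_J_imp_eq:
  assumes "iso_obj (cat \<Lambda> ss) (J n z) (J m y)" "0 < n"
  shows "n = m" "z = y"
proof -
  obtain T R where T: "T \<in> hom (J n z) (J m y)" "R \<in> hom (J m y) (J n z)" "R * T = 1\<^sub>m n" "T * R = 1\<^sub>m m"
    using assms by (auto simp: iso_obj_def iso_mor_def inverse_mor_def)
  show nm: "n = m"
    using mat_left_inverse_le[of T m n R] mat_left_inverse_le[of R n m T] T hom_carrier[OF T(1)] hom_carrier[OF T(2)]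
    by simp
  have d: "dim_row T = m" "dim_col T = n" "dim_row R = n" "dim_col R = m"
    and comm: "T * jordan_block n z = jordan_block m y * T"
    using homD[OF T(1)] homD[OF T(2)] by auto
  have tr: "mtrace (jordan_block n z) = of_nat n * z" for n z
    by (simp add: mtrace_def)
  have "mtrace (jordan_block m y) = mtrace (jordan_block m y * (T * R))"
    by (simp add: T(4))
  also have "\<dots> = mtrace (T * jordan_block n z * R)"
    unfolding comm using d by (simp add: mat_assoc)
  also have "\<dots> = mtrace (R * (T * jordan_block n z))"
    using d nm by (intro mtrace_comm) auto
  also have "\<dots> = mtrace (jordan_block n z)"
    using d by (simp add: mat_mult_eq[OF T(3)])
  finally show "z = y"
    using nm assms(2) by (simp add: tr)
qed

lemma countably_many_indecomposables_cat:
  assumes "countable \<Lambda>"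
  shows "countably_many_indecomposables (cat \<Lambda> ss)"
  unfolding countably_many_indecomposables_def
proof (intro exI conjI allI impI)
  let ?S = "(\<lambda>(n, z). J n z) ` jordan_blocks \<Lambda> ss"
  have "jordan_blocks \<Lambda> ss \<subseteq> UNIV \<times> \<Lambda>" by (auto simp: jordan_blocks_def)
  then show "countable ?S"
    using countable_subset[of "jordan_blocks \<Lambda> ss" "UNIV \<times> \<Lambda>"] assms by simp
  show "?S \<subseteq> Obj (cat \<Lambda> ss)" by (auto intro: J_fam)
  show "\<exists>Y\<in>?S. iso_obj (cat \<Lambda> ss) X Y" if "indecomposable (cat \<Lambda> ss) X" for X
    using that by (rule indecomposable_imp_J) force
qed

text \<open>Spanning is expressed through subspaces \<open>S\<close> containing \<open>B\<close>, as
  in \<open>finite_dim_homs\<close>. Elimination enlarges the set \<open>C\<close> of positions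
  where entries may be nonzero; each new position costs at most one generator.\<close>

lemma finite_spanning_set:
  fixes W :: "complex mat set"
  assumes W: "W \<subseteq> carrier_mat m n" "\<And>S T. S \<in> W \<Longrightarrow> T \<in> W \<Longrightarrow> S + T \<in> W"
    "\<And>a T. T \<in> W \<Longrightarrow> a \<cdot>\<^sub>m T \<in> W"
  obtains B where "finite B" "B \<subseteq> W"
    "\<And>S. 0\<^sub>m m n \<in> S \<Longrightarrow> (\<And>f g. f \<in> S \<Longrightarrow> g \<in> S \<Longrightarrow> f + g \<in> S) \<Longrightarrow> (\<And>a f. f \<in> S \<Longrightarrow> a \<cdot>\<^sub>m f \<in> S) \<Longrightarrow>
      B \<subseteq> S \<Longrightarrow> W \<subseteq> S"
proof -
  let ?I = "{..<m} \<times> {..<n}"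
  define closed where "closed S \<longleftrightarrow> 0\<^sub>m m n \<in> S \<and> (\<forall>f\<in>S. \<forall>g\<in>S. f + g \<in> S) \<and> (\<forall>a. \<forall>f\<in>S. a \<cdot>\<^sub>m f \<in> S)"
    for S :: "complex mat set"
  define WC where "WC C = {T \<in> W. \<forall>c\<in>?I - C. T $$ c = 0}" for C
  have "\<exists>B. finite B \<and> B \<subseteq> W \<and> (\<forall>S. closed S \<and> B \<subseteq> S \<longrightarrow> WC C \<subseteq> S)" if "finite C" for C
    using that
  proof (induction C)
    case empty
    have "T = 0\<^sub>m m n" if "T \<in> WC {}" for T
      using that W(1) by (auto simp: WC_def intro!: eq_matI)
    then show ?case
      by (intro exI[of _ "{}"]) (auto simp: closed_def)
  next
    case (insert c C)
    from insert.IH obtain B where B: "finite B" "B \<subseteq> W" and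
      B3: "\<forall>S. closed S \<and> B \<subseteq> S \<longrightarrow> WC C \<subseteq> S"
      by blast
    show ?case
    proof (cases "\<exists>T\<in>WC (insert c C). c \<in> ?I \<and> T $$ c \<noteq> 0")
      case False
      then have "WC (insert c C) \<subseteq> WC C"
        by (auto simp: WC_def)
      then show ?thesis using B B3 by (intro exI[of _ B]) blast
    next
      case True
      then obtain T where T: "T \<in> WC (insert c C)" "c \<in> ?I" "T $$ c \<noteq> 0" by blast
      have "WC (insert c C) \<subseteq> S" if S: "closed S" "insert T B \<subseteq> S" for S
      proof
        fix U assume U: "U \<in> WC (insert c C)"
        \<comment> \<open>Chosen so that \<open>U - a T\<close> vanishes at \<open>c\<close> and
          hence lies in the smaller space \<open>WC C\<close>.\<close>
        define a where "a = U $$ c / T $$ c"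
        have d: "dim_row T = m" "dim_col T = n" "dim_row U = m" "dim_col U = n"
          using T U W(1) by (auto simp: WC_def)
        have entry: "(U + - a \<cdot>\<^sub>m T) $$ b = U $$ b - a * T $$ b" if "b \<in> ?I" for b
          using that d by (cases b) auto
        have "(U + - a \<cdot>\<^sub>m T) $$ b = 0" if b: "b \<in> ?I - C" for b
        proof (cases "b = c")
          case True
          then show ?thesis using entry[of c] T(2,3) by (simp add: a_def)
        next
          case False
          have "T $$ b = 0" "U $$ b = 0"
            using T(1) U b False unfolding WC_def by blast+
          then show ?thesis using entry[of b] b by simp
        qed
        moreover have "U + - a \<cdot>\<^sub>m T \<in> W"
          using T(1) U W(2,3) unfolding WC_def by blast
        ultimately have "U + - a \<cdot>\<^sub>m T \<in> WC C"
          unfolding WC_def by blast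
        then have "U + - a \<cdot>\<^sub>m T \<in> S"
          using B3 S by blast
        moreover have "a \<cdot>\<^sub>m T \<in> S"
          using S by (auto simp: closed_def)
        ultimately have "(U + - a \<cdot>\<^sub>m T) + a \<cdot>\<^sub>m T \<in> S"
          using S by (auto simp: closed_def)
        also have "(U + - a \<cdot>\<^sub>m T) + a \<cdot>\<^sub>m T = U"
          using d by (auto intro!: eq_matI)
        finally show "U \<in> S" .
      qed
      then show ?thesis
        using B T by (intro exI[of _ "insert T B"]) (auto simp: WC_def)
    qed
  qed
  from this[of ?I] obtain B where B: "finite B" "B \<subseteq> W" and
    B3: "\<forall>S. closed S \<and> B \<subseteq> S \<longrightarrow> WC ?I \<subseteq> S"
    by auto
  show thesis
  proof (rule that[OF B])
    fix S assume "0\<^sub>m m n \<in> S" "\<And>f g. f \<in> S \<Longrightarrow> g \<in> S \<Longrightarrow> f + g \<in> S"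
      "\<And>a f. f \<in> S \<Longrightarrow> a \<cdot>\<^sub>m f \<in> S" and "B \<subseteq> S"
    then have "WC ?I \<subseteq> S" using B3 by (simp add: closed_def)
    then show "W \<subseteq> S" by (simp add: WC_def)
  qed
qed

lemma finite_dim_homs_cat: "finite_dim_homs (cat \<Lambda> ss)"
  unfolding finite_dim_homs_def
proof (intro ballI)
  fix X Y assume "X \<in> Obj (cat \<Lambda> ss)" "Y \<in> Obj (cat \<Lambda> ss)"
  then have XY: "X \<in> mods" "Y \<in> mods" by (auto dest: fam_mods)
  obtain B where B: "finite B" "B \<subseteq> hom X Y"
    "\<And>S. 0\<^sub>m (fst Y) (fst X) \<in> S \<Longrightarrow> (\<And>f g. f \<in> S \<Longrightarrow> g \<in> S \<Longrightarrow> f + g \<in> S) \<Longrightarrow> (\<And>a f. f \<in> S \<Longrightarrow> a \<cdot>\<^sub>m f \<in> S) \<Longrightarrow>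
      B \<subseteq> S \<Longrightarrow> hom X Y \<subseteq> S"
    by (rule finite_spanning_set[of "hom X Y" "fst Y" "fst X"])
      (use XY in \<open>auto intro: module_homs_add module_homs_smult hom_carrier\<close>)
  then show "\<exists>B. finite B \<and> B \<subseteq> Hom (cat \<Lambda> ss) X Y \<and>
      (\<forall>S. hom_subspace (cat \<Lambda> ss) X Y S \<and> B \<subseteq> S \<longrightarrow> S = Hom (cat \<Lambda> ss) X Y)"
  proof (intro exI[of _ B] conjI allI impI)
    fix S assume "hom_subspace (cat \<Lambda> ss) X Y S \<and> B \<subseteq> S"
    then have S: "S \<subseteq> hom X Y" "0\<^sub>m (fst Y) (fst X) \<in> S" "B \<subseteq> S"
      "\<And>f h. f \<in> S \<Longrightarrow> h \<in> S \<Longrightarrow> f + h \<in> S" "\<And>a f. f \<in> S \<Longrightarrow> a \<cdot>\<^sub>m f \<in> S"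
      by (auto simp: hom_subspace_def)
    from B(3)[OF S(2,4,5,3)] S(1) show "S = Hom (cat \<Lambda> ss) X Y"
      by simp
  qed simp_all
qed

end

subsection \<open>The radical and the invariant ideals\<close>

lemma sum_mult_index: "(\<Sum>k<m * n. f k) = (\<Sum>a<m. \<Sum>b<n. f (a * n + b))" for n :: nat
proof -
  have "(\<Sum>k<m * n. f k) = (\<Sum>k<m * n. f (k div n * n + k mod n))"
    by simp
  then show ?thesis
    by (simp only: sum_div_mod[of "\<lambda>a b. f (a * n + b)"])
qed

lemma mult_index_less: "a < m \<Longrightarrow> b < n \<Longrightarrow> a * n + b < m * n" for a b m n :: nat
  using mult_le_mono1[of "Suc a" m n] by simp

lemma kron_entry:
  assumes "a < dim_row A" "b < dim_row B" "c < dim_col A" "d < dim_col B"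
  shows "kron A B $$ (a * dim_row B + b, c * dim_col B + d) = A $$ (a, c) * B $$ (b, d)"
  using assms by (simp add: kron_index mult_index_less)

text \<open>This map is adjoint to \<open>f \<mapsto> 1 \<otimes> f\<close> under the trace form; it shows below that the radical
  is invariant.\<close>

definition partial_trace :: "nat \<Rightarrow> nat \<Rightarrow> nat \<Rightarrow> complex mat \<Rightarrow> complex mat" where
  "partial_trace v x y h = mat x y (\<lambda>(a, b). \<Sum>i<v. h $$ (i * x + a, i * y + b))"

lemma mtrace_partial_trace:
  assumes h: "h \<in> carrier_mat (v * x) (v * y)" and f: "f \<in> carrier_mat y x"
  shows "mtrace (h * kron (1\<^sub>m v) f) = mtrace (partial_trace v x y h * f)"
proof -
  have d: "dim_row h = v * x" "dim_col h = v * y" "dim_row f = y" "dim_col f = x"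
    using h f by auto
  have entry: "(h * kron (1\<^sub>m v) f) $$ (i * x + a, i * x + a) = (\<Sum>b<y. h $$ (i * x + a, i * y + b) * f $$ (b, a))"
    if "i < v" "a < x" for i a
  proof -
    have "(h * kron (1\<^sub>m v) f) $$ (i * x + a, i * x + a) =
        (\<Sum>c<v. \<Sum>b<y. h $$ (i * x + a, c * y + b) * kron (1\<^sub>m v) f $$ (c * y + b, i * x + a))"
      using that d by (subst mat_mult_index) (simp_all add: mult_index_less sum_mult_index)
    also have "\<dots> = (\<Sum>c<v. if c = i then \<Sum>b<y. h $$ (i * x + a, i * y + b) * f $$ (b, a) else 0)"
    proof (rule sum.cong[OF refl])
      fix c assume "c \<in> {..<v}"
      then have "kron (1\<^sub>m v) f $$ (c * y + b, i * x + a) = (if c = i then f $$ (b, a) else 0)" if "b < y" for b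
        using kron_entry[of c "1\<^sub>m v" b f i a] that \<open>i < v\<close> \<open>a < x\<close> d by simp
      then show "(\<Sum>b<y. h $$ (i * x + a, c * y + b) * kron (1\<^sub>m v) f $$ (c * y + b, i * x + a)) =
          (if c = i then \<Sum>b<y. h $$ (i * x + a, i * y + b) * f $$ (b, a) else 0)"
        by (auto intro!: sum.neutral)
    qed
    also have "\<dots> = (\<Sum>b<y. h $$ (i * x + a, i * y + b) * f $$ (b, a))"
      using that by simp
    finally show ?thesis .
  qed
  have "mtrace (h * kron (1\<^sub>m v) f) = (\<Sum>i<v. \<Sum>a<x. \<Sum>b<y. h $$ (i * x + a, i * y + b) * f $$ (b, a))"
    using entry d by (simp add: mtrace_def sum_mult_index del: index_mult_mat(1))
  also have "\<dots> = (\<Sum>a<x. \<Sum>i<v. \<Sum>b<y. h $$ (i * x + a, i * y + b) * f $$ (b, a))"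
    by (rule sum.swap)
  also have "\<dots> = (\<Sum>a<x. \<Sum>b<y. \<Sum>i<v. h $$ (i * x + a, i * y + b) * f $$ (b, a))"
    by (rule sum.cong[OF refl], rule sum.swap)
  also have "\<dots> = mtrace (partial_trace v x y h * f)"
    using d by (simp add: mtrace_def mat_mult_index partial_trace_def sum_distrib_right del: index_mult_mat(1))
  finally show ?thesis .
qed

text \<open>Sum the diagonal blocks \<open>(i, i)\<close> of \<open>comm\<close> over
  \<open>i\<close>. The two terms containing \<open>R\<close> agree by cyclicity of the trace over
  the first factor, and what remains is the claim. So the partial trace of a module map is a module
  map.\<close>

lemma partial_trace_intertwines:
  assumes h: "h \<in> carrier_mat (v * x) (v * y)" and R: "R \<in> carrier_mat v v"
    and A: "A \<in> carrier_mat x x" and B: "B \<in> carrier_mat y y"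
    and comm: "h * (kron R (1\<^sub>m y) + kron (1\<^sub>m v) B) = (kron R (1\<^sub>m x) + kron (1\<^sub>m v) A) * h"
  shows "partial_trace v x y h * B = A * partial_trace v x y h"
proof (rule eq_matI)
  have d: "dim_row h = v * x" "dim_col h = v * y" "dim_row R = v" "dim_col R = v"
    "dim_row A = x" "dim_col A = x" "dim_row B = y" "dim_col B = y"
    using h R A B by auto
  have pt: "dim_row (partial_trace v x y h) = x" "dim_col (partial_trace v x y h) = y"
    by (simp_all add: partial_trace_def)
  fix a b assume "a < dim_row (A * partial_trace v x y h)" "b < dim_col (A * partial_trace v x y h)"
  then have ab: "a < x" "b < y" using d pt by auto
  have delta: "(\<Sum>k<n. f k * (if k = j then c else 0)) = f j * c" "(\<Sum>k<n. (if j = k then c else 0) * f k) = c * f j"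
    if "j < n" for f :: "nat \<Rightarrow> complex" and n j c
    using that by (subst sum.remove[of _ j], simp_all)+
  have eq: "(\<Sum>c<v. h $$ (i * x + a, c * y + b) * R $$ (c, i)) + (\<Sum>e<y. h $$ (i * x + a, i * y + e) * B $$ (e, b)) =
      (\<Sum>c<v. R $$ (i, c) * h $$ (c * x + a, i * y + b)) + (\<Sum>e<x. A $$ (a, e) * h $$ (i * x + e, i * y + b))"
    if i: "i < v" for i
  proof -
    note small = mult_index_less[OF i ab(1)] mult_index_less[OF i ab(2)]
    have "(h * kron R (1\<^sub>m y)) $$ (i * x + a, i * y + b) = (\<Sum>c<v. h $$ (i * x + a, c * y + b) * R $$ (c, i))"
    proof -
      have "(h * kron R (1\<^sub>m y)) $$ (i * x + a, i * y + b) =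
          (\<Sum>c<v. \<Sum>e<y. h $$ (i * x + a, c * y + e) * kron R (1\<^sub>m y) $$ (c * y + e, i * y + b))"
        using small d by (subst mat_mult_index) (simp_all add: sum_mult_index)
      also have "\<dots> = (\<Sum>c<v. \<Sum>e<y. h $$ (i * x + a, c * y + e) * (if e = b then R $$ (c, i) else 0))"
      proof (intro sum.cong refl)
        fix c e assume "c \<in> {..<v}" "e \<in> {..<y}"
        then show "h $$ (i * x + a, c * y + e) * kron R (1\<^sub>m y) $$ (c * y + e, i * y + b) =
            h $$ (i * x + a, c * y + e) * (if e = b then R $$ (c, i) else 0)"
          using kron_entry[of c R e "1\<^sub>m y" i b] d ab i by simp
      qed
      finally show ?thesis by (simp only: delta(1)[OF ab(2)])
    qed
    moreover have "(h * kron (1\<^sub>m v) B) $$ (i * x + a, i * y + b) = (\<Sum>e<y. h $$ (i * x + a, i * y + e) * B $$ (e, b))"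
    proof -
      have "(h * kron (1\<^sub>m v) B) $$ (i * x + a, i * y + b) =
          (\<Sum>c<v. \<Sum>e<y. h $$ (i * x + a, c * y + e) * kron (1\<^sub>m v) B $$ (c * y + e, i * y + b))"
        using small d by (subst mat_mult_index) (simp_all add: sum_mult_index)
      also have "\<dots> = (\<Sum>e<y. \<Sum>c<v. h $$ (i * x + a, c * y + e) * kron (1\<^sub>m v) B $$ (c * y + e, i * y + b))"
        by (rule sum.swap)
      also have "\<dots> = (\<Sum>e<y. \<Sum>c<v. h $$ (i * x + a, c * y + e) * (if c = i then B $$ (e, b) else 0))"
      proof (intro sum.cong refl)
        fix c e assume "c \<in> {..<v}" "e \<in> {..<y}"
        then show "h $$ (i * x + a, c * y + e) * kron (1\<^sub>m v) B $$ (c * y + e, i * y + b) =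
            h $$ (i * x + a, c * y + e) * (if c = i then B $$ (e, b) else 0)"
          using kron_entry[of c "1\<^sub>m v" e B i b] d ab i by simp
      qed
      finally show ?thesis by (simp only: delta(1)[OF i])
    qed
    moreover have "(kron R (1\<^sub>m x) * h) $$ (i * x + a, i * y + b) = (\<Sum>c<v. R $$ (i, c) * h $$ (c * x + a, i * y + b))"
    proof -
      have "(kron R (1\<^sub>m x) * h) $$ (i * x + a, i * y + b) =
          (\<Sum>c<v. \<Sum>e<x. kron R (1\<^sub>m x) $$ (i * x + a, c * x + e) * h $$ (c * x + e, i * y + b))"
        using small d by (subst mat_mult_index) (simp_all add: sum_mult_index)
      also have "\<dots> = (\<Sum>c<v. \<Sum>e<x. (if a = e then R $$ (i, c) else 0) * h $$ (c * x + e, i * y + b))"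
      proof (intro sum.cong refl)
        fix c e assume "c \<in> {..<v}" "e \<in> {..<x}"
        then show "kron R (1\<^sub>m x) $$ (i * x + a, c * x + e) * h $$ (c * x + e, i * y + b) =
            (if a = e then R $$ (i, c) else 0) * h $$ (c * x + e, i * y + b)"
          using kron_entry[of i R a "1\<^sub>m x" c e] d ab i by simp
      qed
      finally show ?thesis by (simp only: delta(2)[OF ab(1)])
    qed
    moreover have "(kron (1\<^sub>m v) A * h) $$ (i * x + a, i * y + b) = (\<Sum>e<x. A $$ (a, e) * h $$ (i * x + e, i * y + b))"
    proof -
      have "(kron (1\<^sub>m v) A * h) $$ (i * x + a, i * y + b) =
          (\<Sum>c<v. \<Sum>e<x. kron (1\<^sub>m v) A $$ (i * x + a, c * x + e) * h $$ (c * x + e, i * y + b))"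
        using small d by (subst mat_mult_index) (simp_all add: sum_mult_index)
      also have "\<dots> = (\<Sum>e<x. \<Sum>c<v. kron (1\<^sub>m v) A $$ (i * x + a, c * x + e) * h $$ (c * x + e, i * y + b))"
        by (rule sum.swap)
      also have "\<dots> = (\<Sum>e<x. \<Sum>c<v. (if i = c then A $$ (a, e) else 0) * h $$ (c * x + e, i * y + b))"
      proof (intro sum.cong refl)
        fix c e assume "c \<in> {..<v}" "e \<in> {..<x}"
        then show "kron (1\<^sub>m v) A $$ (i * x + a, c * x + e) * h $$ (c * x + e, i * y + b) =
            (if i = c then A $$ (a, e) else 0) * h $$ (c * x + e, i * y + b)"
          using kron_entry[of i "1\<^sub>m v" a A c e] d ab i by simp
      qed
      finally show ?thesis by (simp only: delta(2)[OF i])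
    qed
    moreover have "(h * kron R (1\<^sub>m y) + h * kron (1\<^sub>m v) B) $$ (i * x + a, i * y + b) =
        (kron R (1\<^sub>m x) * h + kron (1\<^sub>m v) A * h) $$ (i * x + a, i * y + b)"
      using comm d by (simp only: mat_distribs dim_kron index_one_mat index_add_mat index_mult_mat)
    ultimately show ?thesis
      using small d by (simp del: index_mult_mat(1))
  qed
  have "(\<Sum>i<v. (\<Sum>c<v. h $$ (i * x + a, c * y + b) * R $$ (c, i)) + (\<Sum>e<y. h $$ (i * x + a, i * y + e) * B $$ (e, b))) =
      (\<Sum>i<v. (\<Sum>c<v. R $$ (i, c) * h $$ (c * x + a, i * y + b)) + (\<Sum>e<x. A $$ (a, e) * h $$ (i * x + e, i * y + b)))"
    by (rule sum.cong) (auto simp: eq)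
  moreover have "(\<Sum>i<v. \<Sum>c<v. R $$ (i, c) * h $$ (c * x + a, i * y + b)) =
      (\<Sum>i<v. \<Sum>c<v. h $$ (i * x + a, c * y + b) * R $$ (c, i))"
    by (subst sum.swap) (simp add: mult.commute)
  ultimately have "(\<Sum>i<v. \<Sum>e<y. h $$ (i * x + a, i * y + e) * B $$ (e, b)) =
      (\<Sum>i<v. \<Sum>e<x. A $$ (a, e) * h $$ (i * x + e, i * y + b))"
    by (simp add: sum.distrib)
  then have "(\<Sum>e<y. \<Sum>i<v. h $$ (i * x + a, i * y + e) * B $$ (e, b)) =
      (\<Sum>e<x. \<Sum>i<v. A $$ (a, e) * h $$ (i * x + e, i * y + b))"
    by (simp only: sum.swap[of _ "{..<v}"])
  then show "(partial_trace v x y h * B) $$ (a, b) = (A * partial_trace v x y h) $$ (a, b)"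
    using d ab by (simp add: mat_mult_index pt del: index_mult_mat(1))
      (simp add: partial_trace_def sum_distrib_right sum_distrib_left)
qed (use A B in \<open>auto simp: partial_trace_def\<close>)

context line_element begin

section \<open>Components of a morphism along a direct sum\<close>

lemma direct_sum_ConsE:
  assumes "direct_sum (cat \<Lambda> ss) X (Y # Ys)"
  obtains Z i p j q where "direct_sum (cat \<Lambda> ss) Z Ys" "X \<in> fam \<Lambda> ss" "Y \<in> fam \<Lambda> ss" "Z \<in> fam \<Lambda> ss"
    "i \<in> hom Y X" "p \<in> hom X Y" "j \<in> hom Z X" "q \<in> hom X Z" "i * p + j * q = 1\<^sub>m (fst X)"
proof -
  from assms obtain Z where Z: "biproduct (cat \<Lambda> ss) X Y Z" "direct_sum (cat \<Lambda> ss) Z Ys"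
    unfolding direct_sum.simps by blast
  from Z(1) show thesis
    by (rule biproductE) (rule that[OF Z(2)])
qed

lemma direct_sum_mem: "direct_sum (cat \<Lambda> ss) X Ys \<Longrightarrow> X \<in> fam \<Lambda> ss \<and> set Ys \<subseteq> fam \<Lambda> ss"
  by (induction Ys arbitrary: X) (auto simp: zero_obj_iff elim!: direct_sum_ConsE simp del: direct_sum.simps(2))

text \<open>One induction for three uses: \<open>\<phi> A\<close> will say that the trace of
  \<open>h * A\<close>, the matrix \<open>f * A\<close> or the matrix \<open>A * f\<close> is
  nonzero. The identity is a sum of terms \<open>i * p\<close>, and a property that holds for a sum
  only if it holds for a summand must hold for one of them.\<close>

lemma direct_sum_component:
  assumes "direct_sum (cat \<Lambda> ss) X Ys" "\<phi> (1\<^sub>m (fst X))" "\<not> \<phi> (0\<^sub>m (fst X) (fst X))"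
    and "\<And>A B. A \<in> hom X X \<Longrightarrow> B \<in> hom X X \<Longrightarrow> \<phi> (A + B) \<Longrightarrow> \<phi> A \<or> \<phi> B"
  obtains Y i p where "Y \<in> set Ys" "i \<in> hom Y X" "p \<in> hom X Y" "\<phi> (i * p)"
proof -
  have "\<exists>Y\<in>set Ys. \<exists>i\<in>hom Y X. \<exists>p\<in>hom X Y. \<phi> (i * p)"
    using assms
  proof (induction Ys arbitrary: X \<phi>)
    case Nil
    then have "fst X = 0" by (simp add: zero_obj_iff)
    moreover have "1\<^sub>m 0 = (0\<^sub>m 0 0 :: complex mat)" by (rule eq_matI) auto
    ultimately show ?case using Nil(2,3) by simp
  next
    case (Cons Y Ys)
    from Cons.prems(1) obtain Z i p j q where Z: "direct_sum (cat \<Lambda> ss) Z Ys" "X \<in> fam \<Lambda> ss" "Y \<in> fam \<Lambda> ss"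
      "Z \<in> fam \<Lambda> ss" "i \<in> hom Y X" "p \<in> hom X Y" "j \<in> hom Z X" "q \<in> hom X Z" "i * p + j * q = 1\<^sub>m (fst X)"
      by (rule direct_sum_ConsE)
    note m = fam_mods[OF Z(2)] fam_mods[OF Z(3)] fam_mods[OF Z(4)]
    note d = homD(1,2)[OF Z(7)] homD(1,2)[OF Z(8)]
    have jq: "j * A * q \<in> hom X X" if "A \<in> hom Z Z" for A
      using hom_comp[OF m(1,3,1) Z(8) hom_comp[OF m(3,3,1) that Z(7)]] .
    have "\<phi> (i * p) \<or> \<phi> (j * q)"
      using Cons.prems(2) unfolding Z(9)[symmetric]
      by (rule Cons.prems(4)[OF hom_comp[OF m(1,2,1) Z(6,5)] hom_comp[OF m(1,3,1) Z(8,7)]])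
    then show ?case
    proof
      assume "\<phi> (i * p)"
      then show ?thesis using Z(5,6) by auto
    next
      assume "\<phi> (j * q)"
      \<comment> \<open>The induction hypothesis is applied to the transported predicate
        \<open>\<lambda>A. \<phi> (j * A * q)\<close> on endomorphisms of \<open>Z\<close>, which is
        why \<open>\<phi>\<close> is generalised.\<close>
      have "\<exists>W\<in>set Ys. \<exists>k\<in>hom W Z. \<exists>r\<in>hom Z W. \<phi> (j * (k * r) * q)"
      proof (rule Cons.IH[OF Z(1)])
        show "\<phi> (j * 1\<^sub>m (fst Z) * q)" using \<open>\<phi> (j * q)\<close> d by simp
        show "\<not> \<phi> (j * 0\<^sub>m (fst Z) (fst Z) * q)" using Cons.prems(3) d by simp
        show "\<phi> (j * A * q) \<or> \<phi> (j * B * q)"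
          if AB: "A \<in> hom Z Z" "B \<in> hom Z Z" "\<phi> (j * (A + B) * q)" for A B
        proof (rule Cons.prems(4)[OF jq[OF AB(1)] jq[OF AB(2)]])
          have "j * (A + B) * q = j * A * q + j * B * q"
            using d homD(1,2)[OF AB(1)] homD(1,2)[OF AB(2)] by (simp add: mat_distribs)
          then show "\<phi> (j * A * q + j * B * q)" using AB(3) by simp
        qed
      qed
      then obtain W k r where W: "W \<in> set Ys" "k \<in> hom W Z" "r \<in> hom Z W" "\<phi> (j * (k * r) * q)" by blast
      have Wm: "W \<in> mods" using direct_sum_mem[OF Z(1)] W(1) fam_mods by blast
      have "\<phi> ((j * k) * (r * q))"
        using W(4) d homD(1,2)[OF W(2)] homD(1,2)[OF W(3)] by (simp add: mat_assoc)
      then show ?thesis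
        using W(1) hom_comp[OF Wm m(3,1) W(2) Z(7)] hom_comp[OF m(1,3) Wm Z(8) W(3)] by auto
    qed
  qed
  then show thesis using that by blast
qed

lemma trace_component:
  assumes "direct_sum (cat \<Lambda> ss) X Ys" "h \<in> hom X X" "mtrace h \<noteq> 0"
  shows "\<exists>Y\<in>set Ys. \<exists>i\<in>hom Y X. \<exists>p\<in>hom X Y. mtrace (p * h * i) \<noteq> 0"
proof (rule direct_sum_component[OF assms(1), of "\<lambda>A. mtrace (h * A) \<noteq> 0"])
  note d = homD(1,2)[OF assms(2)]
  show "mtrace (h * 1\<^sub>m (fst X)) \<noteq> 0" "\<not> mtrace (h * 0\<^sub>m (fst X) (fst X)) \<noteq> 0"
    using assms(3) d by simp_all
  show "mtrace (h * A) \<noteq> 0 \<or> mtrace (h * B) \<noteq> 0"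
    if "A \<in> hom X X" "B \<in> hom X X" "mtrace (h * (A + B)) \<noteq> 0" for A B
    using that(3) d homD(1,2)[OF that(1)] homD(1,2)[OF that(2)] by (auto simp: mat_distribs)
  fix Y i p assume Y: "Y \<in> set Ys" "i \<in> hom Y X" "p \<in> hom X Y" "mtrace (h * (i * p)) \<noteq> 0"
  moreover have "mtrace (h * (i * p)) = mtrace (p * h * i)"
    using d homD(1,2)[OF Y(2)] homD(1,2)[OF Y(3)] mtrace_comm[of "h * i" p] by (simp add: mat_assoc)
  ultimately show ?thesis by auto
qed

lemma source_component:
  assumes "direct_sum (cat \<Lambda> ss) X Ys" "dim_row f = m" "dim_col f = fst X" "f \<noteq> 0\<^sub>m m (fst X)"
  shows "\<exists>Y\<in>set Ys. \<exists>i\<in>hom Y X. f * i \<noteq> 0\<^sub>m m (fst Y)"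
proof (rule direct_sum_component[OF assms(1), of "\<lambda>A. f * A \<noteq> 0\<^sub>m m (fst X)"])
  show "f * A \<noteq> 0\<^sub>m m (fst X) \<or> f * B \<noteq> 0\<^sub>m m (fst X)"
    if "A \<in> hom X X" "B \<in> hom X X" "f * (A + B) \<noteq> 0\<^sub>m m (fst X)" for A B
    using that(3) assms(2,3) homD(1,2)[OF that(1)] homD(1,2)[OF that(2)] by (auto simp: mat_distribs)
  fix Y i p assume Y: "Y \<in> set Ys" "i \<in> hom Y X" "p \<in> hom X Y" "f * (i * p) \<noteq> 0\<^sub>m m (fst X)"
  have "f * (i * p) = f * i * p"
    using assms(2,3) homD(1,2)[OF Y(2)] homD(1,2)[OF Y(3)] by (simp add: mat_assoc)
  then have "f * i \<noteq> 0\<^sub>m m (fst Y)"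
    using Y(4) homD(1,2)[OF Y(3)] by auto
  with Y show ?thesis by blast
qed (use assms in simp_all)

lemma target_component:
  assumes "direct_sum (cat \<Lambda> ss) X Ys" "dim_row f = fst X" "dim_col f = m" "f \<noteq> 0\<^sub>m (fst X) m"
  shows "\<exists>Y\<in>set Ys. \<exists>p\<in>hom X Y. p * f \<noteq> 0\<^sub>m (fst Y) m"
proof (rule direct_sum_component[OF assms(1), of "\<lambda>A. A * f \<noteq> 0\<^sub>m (fst X) m"])
  show "A * f \<noteq> 0\<^sub>m (fst X) m \<or> B * f \<noteq> 0\<^sub>m (fst X) m"
    if "A \<in> hom X X" "B \<in> hom X X" "(A + B) * f \<noteq> 0\<^sub>m (fst X) m" for A B
    using that(3) assms(2,3) homD(1,2)[OF that(1)] homD(1,2)[OF that(2)] by (auto simp: mat_distribs)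
  fix Y i p assume Y: "Y \<in> set Ys" "i \<in> hom Y X" "p \<in> hom X Y" "i * p * f \<noteq> 0\<^sub>m (fst X) m"
  have "i * p * f = i * (p * f)"
    using assms(2,3) homD(1,2)[OF Y(2)] homD(1,2)[OF Y(3)] by (simp add: mat_assoc)
  then have "p * f \<noteq> 0\<^sub>m (fst Y) m"
    using Y(4) homD(1,2)[OF Y(2)] by auto
  with Y show ?thesis by blast
qed (use assms in simp_all)

section \<open>The radical in terms of traces\<close>

lemma det_one_minus:
  fixes A :: "complex mat"
  assumes A: "A \<in> carrier_mat n n"
  shows "det (1\<^sub>m n + - 1 \<cdot>\<^sub>m A) \<noteq> 0 \<longleftrightarrow> \<not> eigenvalue A 1"
proof -
  have c: "1\<^sub>m n + - 1 \<cdot>\<^sub>m A \<in> carrier_mat n n" and d: "dim_row A = n" "dim_col A = n"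
    using A by auto
  have eq: "(1\<^sub>m n + - 1 \<cdot>\<^sub>m A) *\<^sub>v v = 0\<^sub>v n \<longleftrightarrow> A *\<^sub>v v = 1 \<cdot>\<^sub>v v" if "dim_vec v = n" for v
  proof -
    have e: "(1\<^sub>m n + - 1 \<cdot>\<^sub>m A) *\<^sub>v v = v + - 1 \<cdot>\<^sub>v (A *\<^sub>v v)"
      using that d by (simp add: mat_vec_simps)
    show ?thesis
      unfolding e using that d by (auto simp: vec_eq_iff simp del: index_mult_mat_vec)
  qed
  have "det (1\<^sub>m n + - 1 \<cdot>\<^sub>m A) = 0 \<longleftrightarrow> (\<exists>v. v \<in> carrier_vec n \<and> v \<noteq> 0\<^sub>v n \<and> (1\<^sub>m n + - 1 \<cdot>\<^sub>m A) *\<^sub>v v = 0\<^sub>v n)"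
    by (rule det_0_iff_vec_prod_zero_field[OF c])
  also have "\<dots> \<longleftrightarrow> eigenvalue A 1"
    unfolding eigenvalue_def eigenvector_def d(1) using eq carrier_vecD by blast
  finally show ?thesis by simp
qed

lemma eigenvalue_smult: "eigenvalue A z \<Longrightarrow> eigenvalue (c \<cdot>\<^sub>m A) (c * z)" if "dim_row A = dim_col A" for A :: "complex mat"
  by (erule eigenvalueE, rule eigenvalueI) (use that in \<open>auto simp: mat_vec_simps smult_smult_assoc\<close>)

text \<open>If \<open>h f\<close> has an eigenvalue \<open>z \<noteq> 0\<close>, then \<open>1 - z\<inverse> h f\<close> is not invertible; and if all \<open>h f\<close> are
  nilpotent, their traces vanish. Conversely, the traces of the powers of \<open>h f\<close> detect nonzero
  eigenvalues.\<close>

lemma radical_iff_trace: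
  assumes "X \<in> mods" "Y \<in> mods"
  shows "f \<in> radical (sub_cat (line g) S) X Y \<longleftrightarrow> f \<in> hom X Y \<and> (\<forall>h\<in>hom Y X. mtrace (h * f) = 0)"
proof (cases "f \<in> hom X Y")
  case f: True
  have hf: "h * f \<in> hom X X" "h * f \<in> carrier_mat (fst X) (fst X)" if "h \<in> hom Y X" for h
    using hom_comp[OF assms(1,2,1) f that] hom_carrier by blast+
  have inv: "iso_mor (sub_cat (line g) S) X X (1\<^sub>m (fst X) + - 1 \<cdot>\<^sub>m (h * f)) \<longleftrightarrow> \<not> eigenvalue (h * f) 1"
    if "h \<in> hom Y X" for h
    using det_one_minus[OF hf(2)[OF that]] that hf assms
    by (auto simp: iso_endo_iff intro!: module_homs_add module_homs_smult)
  have "(\<forall>h\<in>hom Y X. \<not> eigenvalue (h * f) 1) \<longleftrightarrow> (\<forall>h\<in>hom Y X. mtrace (h * f) = 0)"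
  proof (intro iffI ballI)
    fix h assume all: "\<forall>h\<in>hom Y X. \<not> eigenvalue (h * f) 1" and h: "h \<in> hom Y X"
    show "mtrace (h * f) = 0"
    proof (rule eigenvalue_zero_imp_trace_zero[OF hf(2)[OF h]], rule ccontr)
      fix z assume ev: "eigenvalue (h * f) z" and z: "z \<noteq> 0"
      have "eigenvalue ((1 / z) \<cdot>\<^sub>m (h * f)) (1 / z * z)"
        using homD(1,2)[OF f] homD(1,2)[OF h] by (intro eigenvalue_smult ev) simp
      moreover have "(1 / z) \<cdot>\<^sub>m (h * f) = ((1 / z) \<cdot>\<^sub>m h) * f"
        using homD(1,2)[OF f] homD(1,2)[OF h] by (simp add: mat_distribs)
      moreover have "(1 / z) \<cdot>\<^sub>m h \<in> hom Y X"
        by (rule module_homs_smult[OF assms(2,1) h])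
      ultimately show False using all z by simp
    qed
  next
    fix h assume all: "\<forall>h\<in>hom Y X. mtrace (h * f) = 0" and h: "h \<in> hom Y X"
    \<comment> \<open>Every positive power of \<open>h * f\<close> is again of the form
      \<open>k * f\<close>, so the hypothesis on all \<open>h\<close> makes the traces of all these
      powers vanish.\<close>
    have pow: "\<exists>k\<in>hom Y X. (h * f) ^\<^sub>m Suc l = k * f" for l
    proof (induction l)
      case 0
      then show ?case using h hf(2)[OF h] by (intro bexI[of _ h]) auto
    next
      case (Suc l)
      then obtain k where k: "k \<in> hom Y X" "(h * f) ^\<^sub>m Suc l = k * f" by blast
      have "(h * f) ^\<^sub>m Suc (Suc l) = k * f * (h * f)"
        using k(2) by simp
      also have "\<dots> = (k * f * h) * f"
        using homD(1,2)[OF f] homD(1,2)[OF h] homD(1,2)[OF k(1)] by (simp add: mat_assoc)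
      finally show ?case
        using hom_comp[OF assms(2,1,1) h hf(1)[OF k(1)]] by blast
    qed
    show "\<not> eigenvalue (h * f) 1"
    proof
      assume ev: "eigenvalue (h * f) 1"
      have "mtrace ((h * f) ^\<^sub>m k) = 0" if "k > 0" for k
        using pow[of "k - 1"] all that by auto
      then have "(1::complex) = 0"
        by (rule trace_pow_zero_imp_eigenvalue_zero[OF hf(2)[OF h] _ ev])
      then show False by simp
    qed
  qed
  then show ?thesis
    using f inv by (simp add: radical_def)
qed (simp add: radical_def)

text \<open>In the form of \<open>radical_iff_trace\<close> everything is linearity and
  associativity, together with cyclicity of the trace when a morphism is precomposed.\<close>

lemma radical_cat_ideal: "cat_ideal (cat \<Lambda> ss) (radical (cat \<Lambda> ss))"
  unfolding cat_ideal_def hom_subspace_def sub_cat_simps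
proof (intro conjI ballI allI subsetI)
  fix X Y assume "X \<in> fam \<Lambda> ss" "Y \<in> fam \<Lambda> ss"
  then have m: "X \<in> mods" "Y \<in> mods" by (auto dest: fam_mods)
  note iff = radical_iff_trace[OF m, of _ "fam \<Lambda> ss"]
  show "f \<in> hom X Y" if "f \<in> radical (cat \<Lambda> ss) X Y" for f
    using that by (simp add: iff)
  show "0\<^sub>m (fst Y) (fst X) \<in> radical (cat \<Lambda> ss) X Y"
    using m by (auto simp: iff module_homs_zero homD(1,2))
  show "f + h \<in> radical (cat \<Lambda> ss) X Y" if "f \<in> radical (cat \<Lambda> ss) X Y" "h \<in> radical (cat \<Lambda> ss) X Y" for f h
    using that m by (auto simp: iff module_homs_add homD(1,2) mat_distribs)
  show "a \<cdot>\<^sub>m f \<in> radical (cat \<Lambda> ss) X Y" if "f \<in> radical (cat \<Lambda> ss) X Y" for f a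
    using that m by (auto simp: iff module_homs_smult homD(1,2) mat_distribs)
  fix Z assume "Z \<in> fam \<Lambda> ss"
  then have mZ: "Z \<in> mods" by (auto dest: fam_mods)
  show "h * f \<in> radical (cat \<Lambda> ss) X Z" if f: "f \<in> radical (cat \<Lambda> ss) X Y" and h: "h \<in> hom Y Z" for f h
    unfolding radical_iff_trace[OF m(1) mZ]
  proof (intro conjI ballI)
    have f: "f \<in> hom X Y" "\<And>k. k \<in> hom Y X \<Longrightarrow> mtrace (k * f) = 0" using f by (auto simp: iff)
    show "h * f \<in> hom X Z" by (rule hom_comp[OF m mZ f(1) h])
    fix k assume k: "k \<in> hom Z X"
    have "mtrace (k * h * f) = 0"
      by (rule f(2)[OF hom_comp[OF m(2) mZ m(1) h k]])
    then show "mtrace (k * (h * f)) = 0"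
      using homD(1,2)[OF f(1)] homD(1,2)[OF h] homD(1,2)[OF k] by (simp add: mat_assoc)
  qed
  show "h * f \<in> radical (cat \<Lambda> ss) X Z" if f: "f \<in> hom X Y" and h: "h \<in> radical (cat \<Lambda> ss) Y Z" for f h
    unfolding radical_iff_trace[OF m(1) mZ]
  proof (intro conjI ballI)
    have h: "h \<in> hom Y Z" "\<And>k. k \<in> hom Z Y \<Longrightarrow> mtrace (k * h) = 0"
      using h by (auto simp: radical_iff_trace[OF m(2) mZ])
    show "h * f \<in> hom X Z" by (rule hom_comp[OF m mZ f h(1)])
    fix k assume k: "k \<in> hom Z X"
    note d = homD(1,2)[OF f] homD(1,2)[OF h(1)] homD(1,2)[OF k]
    have "mtrace (k * h * f) = mtrace (f * (k * h))"
      using d by (intro mtrace_comm) auto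
    also have "\<dots> = mtrace (f * k * h)"
      using d by (simp add: mat_assoc)
    also have "\<dots> = 0"
      by (rule h(2)[OF hom_comp[OF mZ m k f]])
    finally show "mtrace (k * (h * f)) = 0"
      using d by (simp add: mat_assoc)
  qed
qed

text \<open>Since idempotents split, this says that \<open>Y\<close> is a direct summand of some \<open>F \<cdot> X\<close>.\<close>

definition reach :: "lie_module \<Rightarrow> lie_module \<Rightarrow> bool" where
  "reach X Y \<longleftrightarrow> (\<exists>F\<in>lie_modules sl2. \<exists>i\<in>hom Y (module_tensor (line g) (module_restrict (line g) F) X).
     \<exists>p\<in>hom (module_tensor (line g) (module_restrict (line g) F) X) Y. p * i = 1\<^sub>m (fst Y))"

lemma restrict_mem: "F \<in> lie_modules sl2 \<Longrightarrow> module_restrict (line g) F \<in> mods"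
  by (rule restrict_closed[OF line_lie_algebra line_subset])

lemma tensor_mem: "F \<in> lie_modules sl2 \<Longrightarrow> X \<in> mods \<Longrightarrow>
    module_tensor (line g) (module_restrict (line g) F) X \<in> mods"
  by (intro line.module_tensor_closed restrict_mem)

text \<open>The trivial module acts as the identity, so it realises retracts of \<open>X\<close>
  itself.\<close>

lemma reach_retract:
  assumes "X \<in> mods" "i \<in> hom Y X" "p \<in> hom X Y" "p * i = 1\<^sub>m (fst Y)"
  shows "reach X Y"
  unfolding reach_def
  using assms sl2.trivial_module_closed
  by (intro bexI[of _ "trivial_module sl2"] bexI[of _ i] bexI[of _ p])
    (simp_all add: restrict_trivial[OF line_subset] line.module_tensor_trivial)

text \<open>If \<open>F\<close> leads from \<open>X\<close> to \<open>Y\<close> and \<open>G\<close>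
  from \<open>Y\<close> to \<open>Z\<close>, then \<open>G \<otimes> F\<close> leads from
  \<open>X\<close> to \<open>Z\<close>: tensor the first retraction with the identity of
  \<open>G\<close> and compose it with the second.\<close>

lemma reach_trans:
  assumes m: "X \<in> mods" "Y \<in> mods" "Z \<in> mods" and XY: "reach X Y" and YZ: "reach Y Z"
  shows "reach X Z"
proof -
  let ?t = "\<lambda>F X. module_tensor (line g) (module_restrict (line g) F) X"
  obtain F i p where F: "F \<in> lie_modules sl2" "i \<in> hom Y (?t F X)" "p \<in> hom (?t F X) Y" "p * i = 1\<^sub>m (fst Y)"
    using XY by (auto simp: reach_def)
  obtain G j q where G: "G \<in> lie_modules sl2" "j \<in> hom Z (?t G Y)" "q \<in> hom (?t G Y) Z" "q * j = 1\<^sub>m (fst Z)"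
    using YZ by (auto simp: reach_def)
  let ?H = "module_tensor sl2 G F"
  have H: "?H \<in> lie_modules sl2" "?t ?H X = ?t G (?t F X)"
    using F(1) G(1) m restrict_mem
    by (auto simp: sl2.module_tensor_closed restrict_tensor[OF line_lie_algebra line_subset] line.module_tensor_assoc)
  let ?i = "kron (1\<^sub>m (fst G)) i" and ?p = "kron (1\<^sub>m (fst G)) p"
  have Gid: "1\<^sub>m (fst G) \<in> hom (module_restrict (line g) G) (module_restrict (line g) G)"
    using module_homs_ident[OF restrict_mem[OF G(1)]] by simp
  have tm: "?t F X \<in> mods" "?t G Y \<in> mods" "?t G (?t F X) \<in> mods"
    using F(1) G(1) m by (auto intro!: tensor_mem)
  have ip: "?i \<in> hom (?t G Y) (?t G (?t F X))" "?p \<in> hom (?t G (?t F X)) (?t G Y)"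
    using restrict_mem[OF G(1)] m tm F Gid by (auto intro!: line.kron_hom)
  have "?i * j \<in> hom Z (?t ?H X)" "q * ?p \<in> hom (?t ?H X) Z"
    unfolding H(2) by (rule hom_comp[OF m(3) tm(2,3) G(2) ip(1)], rule hom_comp[OF tm(3,2) m(3) ip(2) G(3)])
  moreover have "q * ?p * (?i * j) = 1\<^sub>m (fst Z)"
  proof -
    note d = homD(1,2)[OF F(2)] homD(1,2)[OF F(3)] homD(1,2)[OF G(2)] homD(1,2)[OF G(3)]
    have "?p * ?i = 1\<^sub>m (fst G * fst Y)"
      using d F(4) by (simp add: kron_mult)
    then have "q * (?p * ?i) * j = 1\<^sub>m (fst Z)"
      using d G(4) by simp
    then show ?thesis
      using d by (simp add: mat_assoc)
  qed
  ultimately show ?thesis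
    unfolding reach_def using H(1) by blast
qed

end

text \<open>Common frame of the two cases: stability under the action has to be supplied by each of
  them, while the ideal theory is shared. A point of the spectrum supplies a nonzero object, which
  makes the radical proper.\<close>

locale closed_family = line_element +
  fixes \<Lambda> :: "complex set" and ss :: bool
  assumes countable_spectrum: "countable \<Lambda>" and nonempty_spectrum: "\<Lambda> \<noteq> {}"
    and tensor_closed: "V \<in> lie_modules sl2 \<Longrightarrow> N \<in> fam \<Lambda> ss \<Longrightarrow>
      module_tensor (line g) (module_restrict (line g) V) N \<in> fam \<Lambda> ss"
begin

abbreviation "M \<equiv> cat \<Lambda> ss"

lemma locally_finitary: "locally_finitary sl2_mod M"
proof -
  have "module_category sl2_mod M"
    by (rule sub_cat_module_category[OF line_lie_algebra line_subset]) (auto dest: fam_mods intro: tensor_closed)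
  then show ?thesis
    unfolding locally_finitary_def
    by (intro conjI additive_cat idempotent_split_cat krull_schmidt_cat finite_dim_homs_cat
      countably_many_indecomposables_cat countable_spectrum)
qed

lemma radical_invariant: "invariant_ideal sl2_mod M (radical M)"
  unfolding invariant_ideal_def
proof (intro conjI radical_cat_ideal ballI)
  fix F X Y f assume "F \<in> Obj sl2_mod" "X \<in> Obj M" "Y \<in> Obj M" "f \<in> radical M X Y"
  then have F: "F \<in> lie_modules sl2" and XYf: "X \<in> fam \<Lambda> ss" "Y \<in> fam \<Lambda> ss" and rad: "f \<in> radical M X Y"
    by auto
  note XY = fam_mods[OF XYf(1)] fam_mods[OF XYf(2)]
  have f: "f \<in> hom X Y" "\<And>h. h \<in> hom Y X \<Longrightarrow> mtrace (h * f) = 0"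
    using rad by (auto simp: radical_iff_trace[OF XY])
  let ?t = "module_tensor (line g) (module_restrict (line g) F)"
  note tm = tensor_mem[OF F XY(1)] tensor_mem[OF F XY(2)]
  have "kron (1\<^sub>m (fst F)) f \<in> radical M (?t X) (?t Y)"
    unfolding radical_iff_trace[OF tm]
  proof (intro conjI ballI)
    show "kron (1\<^sub>m (fst F)) f \<in> hom (?t X) (?t Y)"
      using module_homs_ident[OF restrict_mem[OF F]] XY f(1) restrict_mem[OF F]
      by (intro line.kron_hom) auto
    fix h assume h: "h \<in> hom (?t Y) (?t X)"
    have hc: "h \<in> carrier_mat (fst F * fst X) (fst F * fst Y)"
      using hom_carrier[OF h] by simp
    have "partial_trace (fst F) (fst X) (fst Y) h * act Y = act X * partial_trace (fst F) (fst X) (fst Y) h"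
    proof (rule partial_trace_intertwines[OF hc])
      show "snd F g \<in> carrier_mat (fst F) (fst F)"
        using lie_module_dims[OF F g_sl2] by auto
      show "h * (kron (snd F g) (1\<^sub>m (fst Y)) + kron (1\<^sub>m (fst F)) (act Y)) =
          (kron (snd F g) (1\<^sub>m (fst X)) + kron (1\<^sub>m (fst F)) (act X)) * h"
        using homD(3)[OF h] unfolding act_tensor .
    qed (use XY in \<open>auto intro: act_carrier\<close>)
    then have "partial_trace (fst F) (fst X) (fst Y) h \<in> hom Y X"
      using XY by (intro homI) (auto simp: partial_trace_def)
    then show "mtrace (h * kron (1\<^sub>m (fst F)) f) = 0"
      using f(2) mtrace_partial_trace[OF hc hom_carrier[OF f(1)]] by simp
  qed
  then show "ActMor M F F X Y (Ident sl2_mod F) f \<in> radical M (Act M F X) (Act M F Y)"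
    by simp
qed

section \<open>Invariant ideals and the identities they contain\<close>

context
  fixes I :: "lie_module \<Rightarrow> lie_module \<Rightarrow> complex mat set"
  assumes I: "invariant_ideal sl2_mod M I"
begin

lemma ideal_props:
  assumes "X \<in> fam \<Lambda> ss" "Y \<in> fam \<Lambda> ss"
  shows "f \<in> I X Y \<Longrightarrow> f \<in> hom X Y" "0\<^sub>m (fst Y) (fst X) \<in> I X Y"
    "f \<in> I X Y \<Longrightarrow> h \<in> I X Y \<Longrightarrow> f + h \<in> I X Y"
    "Z \<in> fam \<Lambda> ss \<Longrightarrow> f \<in> I X Y \<Longrightarrow> h \<in> hom Y Z \<Longrightarrow> h * f \<in> I X Z"
    "Z \<in> fam \<Lambda> ss \<Longrightarrow> f \<in> hom X Y \<Longrightarrow> h \<in> I Y Z \<Longrightarrow> h * f \<in> I X Z"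
    "F \<in> lie_modules sl2 \<Longrightarrow> f \<in> I X Y \<Longrightarrow> kron (1\<^sub>m (fst F)) f \<in>
      I (module_tensor (line g) (module_restrict (line g) F) X) (module_tensor (line g) (module_restrict (line g) F) Y)"
proof -
  have ideal: "cat_ideal M I"
    and inv: "\<forall>F\<in>lie_modules sl2. \<forall>X\<in>fam \<Lambda> ss. \<forall>Y\<in>fam \<Lambda> ss. \<forall>f\<in>I X Y. kron (1\<^sub>m (fst F)) f \<in>
      I (module_tensor (line g) (module_restrict (line g) F) X) (module_tensor (line g) (module_restrict (line g) F) Y)"
    using I unfolding invariant_ideal_def sub_cat_simps sl2_mod_simps by (rule conjunct1, rule conjunct2)
  note c = ideal[unfolded cat_ideal_def sub_cat_simps]
  have sub: "hom_subspace M X Y (I X Y)"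
    using c[THEN conjunct1, THEN bspec, OF assms(1), THEN bspec, OF assms(2)] .
  show "f \<in> I X Y \<Longrightarrow> f \<in> hom X Y" "0\<^sub>m (fst Y) (fst X) \<in> I X Y"
    "f \<in> I X Y \<Longrightarrow> h \<in> I X Y \<Longrightarrow> f + h \<in> I X Y"
    using sub by (auto simp: hom_subspace_def)
  show "h * f \<in> I X Z" if "Z \<in> fam \<Lambda> ss" "f \<in> I X Y" "h \<in> hom Y Z"
    using c[THEN conjunct2, THEN conjunct1, THEN bspec, OF assms(1), THEN bspec, OF assms(2),
      THEN bspec, OF that(1), THEN bspec, OF that(2), THEN bspec, OF that(3)] .
  show "h * f \<in> I X Z" if "Z \<in> fam \<Lambda> ss" "f \<in> hom X Y" "h \<in> I Y Z"
    using c[THEN conjunct2, THEN conjunct2, THEN bspec, OF assms(1), THEN bspec, OF assms(2),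
      THEN bspec, OF that(1), THEN bspec, OF that(2), THEN bspec, OF that(3)] .
  show "kron (1\<^sub>m (fst F)) f \<in>
      I (module_tensor (line g) (module_restrict (line g) F) X) (module_tensor (line g) (module_restrict (line g) F) Y)"
    if "F \<in> lie_modules sl2" "f \<in> I X Y"
    using inv[THEN bspec, OF that(1), THEN bspec, OF assms(1), THEN bspec, OF assms(2), THEN bspec, OF that(2)] .
qed

lemma ideal_retract:
  assumes X: "X \<in> fam \<Lambda> ss" "1\<^sub>m (fst X) \<in> I X X" and Y: "Y \<in> fam \<Lambda> ss"
    and ip: "i \<in> hom Y X" "p \<in> hom X Y" "p * i = 1\<^sub>m (fst Y)"
  shows "1\<^sub>m (fst Y) \<in> I Y Y"
proof -
  have "1\<^sub>m (fst X) * i \<in> I Y X"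
    by (rule ideal_props(5)[OF Y X(1) X(1) ip(1) X(2)])
  then have "i \<in> I Y X" using homD(1)[OF ip(1)] by simp
  from ideal_props(4)[OF Y X(1) Y this ip(2)] show ?thesis by (simp add: ip(3))
qed

text \<open>Invariance turns the identity of \<open>X\<close> into that of
  \<open>F \<cdot> X\<close>, and identities in an ideal pass to retracts.\<close>

lemma ideal_reach:
  assumes X: "X \<in> fam \<Lambda> ss" "1\<^sub>m (fst X) \<in> I X X" and Y: "Y \<in> fam \<Lambda> ss" and "reach X Y"
  shows "1\<^sub>m (fst Y) \<in> I Y Y"
proof -
  obtain F i p where F: "F \<in> lie_modules sl2" "i \<in> hom Y (module_tensor (line g) (module_restrict (line g) F) X)"
    "p \<in> hom (module_tensor (line g) (module_restrict (line g) F) X) Y" "p * i = 1\<^sub>m (fst Y)"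
    using assms(4) by (auto simp: reach_def)
  show ?thesis
    by (rule ideal_retract[OF tensor_closed[OF F(1) X(1)] _ Y F(2-4)])
      (use ideal_props(6)[OF X(1,1) F(1) X(2)] in simp)
qed

text \<open>The identity of \<open>X\<close> is a sum of morphisms factoring through identities that
  lie in the ideal.\<close>

lemma ideal_direct_sum:
  assumes "direct_sum M X Ys" "\<And>Y. Y \<in> set Ys \<Longrightarrow> 1\<^sub>m (fst Y) \<in> I Y Y"
  shows "1\<^sub>m (fst X) \<in> I X X"
  using assms
proof (induction Ys arbitrary: X)
  case Nil
  then have X: "X \<in> fam \<Lambda> ss" "fst X = 0" by (simp_all add: zero_obj_iff)
  moreover have "1\<^sub>m 0 = (0\<^sub>m 0 0 :: complex mat)" by auto
  ultimately show ?case using ideal_props(2)[OF X(1,1)] by simp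
next
  case (Cons Y Ys)
  from Cons.prems(1) obtain Z i p j q where Z: "direct_sum M Z Ys" "X \<in> fam \<Lambda> ss" "Y \<in> fam \<Lambda> ss"
    "Z \<in> fam \<Lambda> ss" "i \<in> hom Y X" "p \<in> hom X Y" "j \<in> hom Z X" "q \<in> hom X Z" "i * p + j * q = 1\<^sub>m (fst X)"
    by (rule direct_sum_ConsE)
  have *: "k * r \<in> I X X" if W: "W \<in> fam \<Lambda> ss" "1\<^sub>m (fst W) \<in> I W W" and k: "k \<in> hom W X" and r: "r \<in> hom X W" for W k r
  proof -
    have "k * 1\<^sub>m (fst W) \<in> I W X"
      by (rule ideal_props(4)[OF W(1) W(1) Z(2) W(2) k])
    then have "k \<in> I W X" using homD(2)[OF k] by simp
    then show ?thesis by (rule ideal_props(5)[OF Z(2) W(1) Z(2) r])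
  qed
  have "1\<^sub>m (fst Z) \<in> I Z Z"
    by (rule Cons.IH[OF Z(1)]) (use Cons.prems(2) in simp)
  then have "i * p + j * q \<in> I X X"
    using Cons.prems(2)[of Y] *[OF Z(3) _ Z(5,6)] *[OF Z(4) _ Z(7,8)] by (intro ideal_props(3)[OF Z(2,2)]) auto
  then show ?case by (simp add: Z(9))
qed

text \<open>Reachability between Jordan modules enters as a hypothesis because it is proved
  separately in the two cases. Every object is a direct sum of Jordan modules, and an ideal
  containing all identities contains all morphisms.\<close>

lemma ideal_whole:
  assumes reach: "\<And>n z m y. (n, z) \<in> jordan_blocks \<Lambda> ss \<Longrightarrow> (m, y) \<in> jordan_blocks \<Lambda> ss \<Longrightarrow> reach (J n z) (J m y)"
    and nz: "(n, z) \<in> jordan_blocks \<Lambda> ss" and id: "1\<^sub>m n \<in> I (J n z) (J n z)"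
  shows "whole_ideal M I"
proof -
  have idX: "1\<^sub>m (fst X) \<in> I X X" if X: "X \<in> fam \<Lambda> ss" for X
  proof -
    obtain ns where ns: "direct_sum M X (map (\<lambda>(n, z). J n z) ns)" "set ns \<subseteq> jordan_blocks \<Lambda> ss"
      using X by (rule jordan_decomposition)
    show ?thesis
    proof (rule ideal_direct_sum[OF ns(1)])
      fix Y assume "Y \<in> set (map (\<lambda>(n, z). J n z) ns)"
      then obtain m y where my: "(m, y) \<in> set ns" "Y = J m y" by auto
      then have blk: "(m, y) \<in> jordan_blocks \<Lambda> ss" using ns(2) by blast
      have "1\<^sub>m (fst (J n z)) \<in> I (J n z) (J n z)" using id by simp
      from ideal_reach[OF J_fam[OF nz] this J_fam[OF blk] reach[OF nz blk]]
      show "1\<^sub>m (fst Y) \<in> I Y Y" by (simp add: my(2))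
    qed
  qed
  have "f \<in> I X Y" if X: "X \<in> fam \<Lambda> ss" and Y: "Y \<in> fam \<Lambda> ss" and f: "f \<in> hom X Y" for X Y f
  proof -
    have "f * 1\<^sub>m (fst X) \<in> I X Y"
      by (rule ideal_props(4)[OF X X Y idX[OF X] f])
    then show ?thesis using homD(2)[OF f] by simp
  qed
  then show ?thesis
    unfolding whole_ideal_def sub_cat_simps using ideal_props(1) by blast
qed

text \<open>A nonzero trace survives on some Jordan component. The resulting endomorphism
  \<open>T\<close> of \<open>J n z\<close> lies in the ideal and has trace
  \<open>n * T $$ (0, 0)\<close>, so it is invertible and the ideal contains an identity.\<close>

lemma ideal_le_radical:
  assumes reach: "\<And>n z m y. (n, z) \<in> jordan_blocks \<Lambda> ss \<Longrightarrow> (m, y) \<in> jordan_blocks \<Lambda> ss \<Longrightarrow> reach (J n z) (J m y)"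
    and proper: "\<not> whole_ideal M I" and X: "X \<in> fam \<Lambda> ss" and Y: "Y \<in> fam \<Lambda> ss"
  shows "I X Y \<subseteq> radical M X Y"
proof (rule ccontr)
  assume "\<not> I X Y \<subseteq> radical M X Y"
  then obtain f where f: "f \<in> I X Y" "f \<notin> radical M X Y" by blast
  have fh: "f \<in> hom X Y" by (rule ideal_props(1)[OF X Y f(1)])
  have "\<not> (\<forall>h\<in>hom Y X. mtrace (h * f) = 0)"
    using f(2) fh unfolding radical_iff_trace[OF fam_mods[OF X] fam_mods[OF Y]] by simp
  then obtain h where h: "h \<in> hom Y X" "mtrace (h * f) \<noteq> 0"
    by blast
  have hf: "h * f \<in> I X X" by (rule ideal_props(4)[OF X Y X f(1) h(1)])
  obtain ns where ns: "direct_sum M X (map (\<lambda>(n, z). J n z) ns)" "set ns \<subseteq> jordan_blocks \<Lambda> ss"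
    using X by (rule jordan_decomposition)
  obtain W i p where W: "W \<in> set (map (\<lambda>(n, z). J n z) ns)" "i \<in> hom W X" "p \<in> hom X W" "mtrace (p * (h * f) * i) \<noteq> 0"
    using trace_component[OF ns(1) ideal_props(1)[OF X X hf] h(2)] by (elim bexE)
  from W(1) obtain n z where nz: "(n, z) \<in> set ns" "W = J n z" by auto
  then have blk: "(n, z) \<in> jordan_blocks \<Lambda> ss" using ns(2) by blast
  then have n: "0 < n" by (simp add: jordan_blocks_def)
  define T where "T = p * (h * f) * i"
  have Wf: "W \<in> fam \<Lambda> ss"
    unfolding nz(2) by (rule J_fam[OF blk])
  have "p * (h * f) \<in> I X W"
    by (rule ideal_props(4)[OF X X Wf hf W(3)])
  then have TI: "T \<in> I W W"
    unfolding T_def by (rule ideal_props(5)[OF Wf X Wf W(2)])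
  have T: "T \<in> hom (J n z) (J n z)"
    using ideal_props(1)[OF Wf Wf TI] unfolding nz(2) .
  have "T $$ (0, 0) \<noteq> 0"
    using W(4) det_endo_J(2)[OF T] unfolding T_def[symmetric] by auto
  then obtain R where R: "R \<in> hom (J n z) (J n z)" "R * T = 1\<^sub>m n"
    using iso_endo_J[OF n, of "fam \<Lambda> ss" z T] T by (auto simp: iso_mor_def inverse_mor_def)
  have "R * T \<in> I (J n z) (J n z)"
    using ideal_props(4)[OF J_fam[OF blk] J_fam[OF blk] J_fam[OF blk] TI[unfolded nz(2)] R(1)] .
  then have "1\<^sub>m n \<in> I (J n z) (J n z)"
    unfolding R(2) .
  then have "whole_ideal M I"
    by (intro ideal_whole[OF _ blk]) (rule reach)
  with proper show False ..
qed

end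

lemma radical_proper: "\<not> whole_ideal M (radical M)"
proof
  assume whole: "whole_ideal M (radical M)"
  obtain z where z: "z \<in> \<Lambda>" using nonempty_spectrum by blast
  then have J1: "J 1 z \<in> fam \<Lambda> ss" by (intro J_fam) (simp add: jordan_blocks_def)
  have id: "1\<^sub>m 1 \<in> hom (J 1 z) (J 1 z)"
    using module_homs_ident[OF J_simps(3)[of 1 z]] by simp
  then have "1\<^sub>m 1 \<in> radical M (J 1 z) (J 1 z)"
    using whole J1 unfolding whole_ideal_def sub_cat_simps by blast
  then have "mtrace (1\<^sub>m 1 * 1\<^sub>m 1) = 0"
    using id unfolding radical_iff_trace[OF J_simps(3) J_simps(3)] by blast
  then show False by (simp add: mtrace_def)
qed

context
  assumes reach: "\<And>n z m y. (n, z) \<in> jordan_blocks \<Lambda> ss \<Longrightarrow> (m, y) \<in> jordan_blocks \<Lambda> ss \<Longrightarrow> reach (J n z) (J m y)"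
begin

lemma transitive: "transitive_modcat sl2_mod M"
  unfolding transitive_modcat_def
proof (intro allI impI)
  fix X Y assume XY: "indecomposable M X \<and> indecomposable M Y"
  then have f: "X \<in> fam \<Lambda> ss" "Y \<in> fam \<Lambda> ss" by (simp_all add: indecomposable_def)
  note m = fam_mods[OF f(1)] fam_mods[OF f(2)]
  obtain n z where nz: "(n, z) \<in> jordan_blocks \<Lambda> ss" "iso_obj M X (J n z)"
    using XY by (blast elim: indecomposable_imp_J)
  obtain k y where ky: "(k, y) \<in> jordan_blocks \<Lambda> ss" "iso_obj M Y (J k y)"
    using XY by (blast elim: indecomposable_imp_J)
  have iso: "reach V W \<and> reach W V" if vw: "iso_obj M V W" "V \<in> mods" "W \<in> mods" for V W
  proof -
    obtain f h where "f \<in> hom V W" "h \<in> hom W V" "h * f = 1\<^sub>m (fst V)" "f * h = 1\<^sub>m (fst W)"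
      using vw(1) by (auto simp: iso_obj_def iso_mor_def inverse_mor_def)
    then show ?thesis using reach_retract vw(2,3) by blast
  qed
  have "reach X (J n z)" "reach (J k y) Y"
    using iso[OF nz(2) m(1) J_simps(3)] iso[OF ky(2) m(2) J_simps(3)] by blast+
  then have "reach X Y"
    using reach[OF nz(1) ky(1)] reach_trans[OF m(1) J_simps(3) J_simps(3)] reach_trans[OF m(1) J_simps(3) m(2)] by blast
  then obtain F i p where F: "F \<in> lie_modules sl2" "i \<in> hom Y (module_tensor (line g) (module_restrict (line g) F) X)"
    "p \<in> hom (module_tensor (line g) (module_restrict (line g) F) X) Y" "p * i = 1\<^sub>m (fst Y)"
    unfolding reach_def by blast
  have "direct_summand M Y (module_tensor (line g) (module_restrict (line g) F) X)"
    by (rule direct_summandI[OF tensor_closed[OF F(1) f(1)] m(2) F(2-4)])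
  then show "\<exists>F\<in>Obj sl2_mod. direct_summand M Y (Act M F X)"
    using F(1) by (intro bexI[of _ F]) simp_all
qed

lemma radical_maximal: "maximal_invariant_ideal sl2_mod M (radical M)"
  unfolding maximal_invariant_ideal_def sub_cat_simps
proof (intro conjI radical_invariant radical_proper allI impI ballI)
  fix I X Y assume "invariant_ideal sl2_mod M I \<and> \<not> whole_ideal M I" "X \<in> fam \<Lambda> ss" "Y \<in> fam \<Lambda> ss"
  then show "I X Y \<subseteq> radical M X Y"
    by (intro ideal_le_radical) (auto intro: reach)
qed

text \<open>A nonzero \<open>f\<close> in the radical has a nonzero component from some
  \<open>J 1 z\<close> to some \<open>J 1 y\<close>. Intertwining forces \<open>z = y\<close>, so
  the component can be closed up by \<open>h = i * p\<close> with \<open>h * f\<close> of nonzero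
  trace, a contradiction.\<close>

lemma simple_transitive_if_semisimple:
  assumes ss
  shows "simple_transitive sl2_mod M"
  unfolding simple_transitive_def
proof (intro conjI transitive allI impI)
  fix I assume I: "invariant_ideal sl2_mod M I"
  have "I X Y = {0\<^sub>m (fst Y) (fst X)}" if proper: "\<not> whole_ideal M I" and X: "X \<in> fam \<Lambda> ss" and Y: "Y \<in> fam \<Lambda> ss" for X Y
  proof
    note m = fam_mods[OF X] fam_mods[OF Y]
    show "{0\<^sub>m (fst Y) (fst X)} \<subseteq> I X Y"
      using ideal_props(2)[OF I X Y] by simp
    show "I X Y \<subseteq> {0\<^sub>m (fst Y) (fst X)}"
    proof (rule subsetI, rule ccontr)
      fix f assume "f \<in> I X Y" and nz: "f \<notin> {0\<^sub>m (fst Y) (fst X)}"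
      then have rad: "f \<in> radical M X Y"
        using ideal_le_radical[OF I _ proper X Y] reach by blast
      then have f: "f \<in> hom X Y" "\<And>h. h \<in> hom Y X \<Longrightarrow> mtrace (h * f) = 0"
        unfolding radical_iff_trace[OF m] by blast+
      obtain ns where ns: "direct_sum M X (map (\<lambda>(n, z). J n z) ns)" "set ns \<subseteq> jordan_blocks \<Lambda> ss"
        using X by (rule jordan_decomposition)
      obtain ms where ms: "direct_sum M Y (map (\<lambda>(n, z). J n z) ms)" "set ms \<subseteq> jordan_blocks \<Lambda> ss"
        using Y by (rule jordan_decomposition)
      have "\<exists>V\<in>set (map (\<lambda>(n, z). J n z) ns). \<exists>i\<in>hom V X. f * i \<noteq> 0\<^sub>m (fst Y) (fst V)"
        by (rule source_component[OF ns(1)]) (use homD(1,2)[OF f(1)] nz in auto)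
      then obtain V i where V: "V \<in> set (map (\<lambda>(n, z). J n z) ns)" "i \<in> hom V X" "f * i \<noteq> 0\<^sub>m (fst Y) (fst V)"
        by blast
      have "\<exists>W\<in>set (map (\<lambda>(n, z). J n z) ms). \<exists>p\<in>hom Y W. p * (f * i) \<noteq> 0\<^sub>m (fst W) (fst V)"
        by (rule target_component[OF ms(1)]) (use homD(1,2)[OF f(1)] homD(1,2)[OF V(2)] V(3) in auto)
      then obtain W p where W: "W \<in> set (map (\<lambda>(n, z). J n z) ms)" "p \<in> hom Y W" "p * (f * i) \<noteq> 0\<^sub>m (fst W) (fst V)"
        by blast
      have one: "\<exists>z. U = J 1 z" if "U \<in> set (map (\<lambda>(n, z). J n z) ks)" "set ks \<subseteq> jordan_blocks \<Lambda> ss" for U ks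
        using that \<open>ss\<close> by (auto simp: jordan_blocks_def)
      obtain z y where zy: "V = J 1 z" "W = J 1 y"
        using one[OF V(1) ns(2)] one[OF W(1) ms(2)] by blast
      note d = homD(1,2)[OF f(1)] homD(1,2)[OF V(2)] homD(1,2)[OF W(2)]
      define T where "T = p * (f * i)"
      have fi: "f * i \<in> hom V Y" by (rule hom_comp[OF _ m V(2) f(1)]) (simp add: zy)
      have T: "T \<in> hom (J 1 z) (J 1 y)"
        unfolding T_def using hom_comp[OF _ m(2) _ fi W(2)] zy by simp
      have T0: "T $$ (0, 0) \<noteq> 0"
      proof
        assume "T $$ (0, 0) = 0"
        then have "T = 0\<^sub>m 1 1" using homD(1,2)[OF T] by (intro eq_matI) auto
        with W(3) show False by (simp add: T_def zy)
      qed
      have "(T * jordan_block 1 z) $$ (0, 0) = (jordan_block 1 y * T) $$ (0, 0)"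
        using homD(3)[OF T] by simp
      then have "z = y"
        using homD(1,2)[OF T] T0 by (simp add: scalar_prod_def)
      then have p: "p \<in> hom Y V" using W(2) zy by simp
      have "i * p \<in> hom Y X"
        by (rule hom_comp[OF m(2) _ m(1) p V(2)]) (simp add: zy)
      then have "mtrace (i * p * f) = 0" by (rule f(2))
      moreover have "mtrace (i * p * f) = mtrace (p * f * i)"
        using d zy \<open>z = y\<close> mtrace_comm[of i "p * f"] by (simp add: mat_assoc)
      moreover have "p * f * i = T"
        using d zy by (simp add: T_def mat_assoc)
      ultimately show False
        using T0 homD(1,2)[OF T] by (simp add: mtrace_def)
    qed
  qed
  then show "zero_ideal M I \<or> whole_ideal M I"
    unfolding zero_ideal_def sub_cat_simps by blast
qed

end

end

subsection \<open>The Clebsch--Gordan rule\<close>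

lemma mult_jordan_block:
  fixes A :: "complex mat"
  assumes "dim_col A = n" "i < dim_row A" "j < n"
  shows "(A * jordan_block n z) $$ (i, j) = A $$ (i, j) * z + (if j = 0 then 0 else A $$ (i, j - 1))"
proof -
  have "(A * jordan_block n z) $$ (i, j) = (\<Sum>k<n. A $$ (i, k) * jordan_block n z $$ (k, j))"
    using assms by (subst mat_mult_index) auto
  also have "\<dots> = (\<Sum>k<n. (if k = j then A $$ (i, j) * z else 0) + (if Suc k = j then A $$ (i, k) else 0))"
    using assms by (intro sum.cong) auto
  also have "\<dots> = A $$ (i, j) * z + (if j = 0 then 0 else A $$ (i, j - 1))"
    using assms by (cases j) (simp_all add: sum.distrib)
  finally show ?thesis .
qed

lemma sum_double: "(\<Sum>k<2 * n. f k) = (\<Sum>k<n. f k) + (\<Sum>k<n. f (n + k))" for f :: "nat \<Rightarrow> complex"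
  using sum_mult_index[of f 2 n] by (simp add: numeral_2_eq_2)

text \<open>With \<open>N u\<^sub>1 = u\<^sub>0\<close> in \<open>\<complex>\<^sup>2\<close> and the standard basis \<open>w\<^sub>k\<close> of the Jordan block, the two summands
  of the tensor product have the bases \<open>u\<^sub>1 \<otimes> w\<^sub>t\<^sub>-\<^sub>1 + (n - t) u\<^sub>0 \<otimes> w\<^sub>t\<close> (\<open>0 \<le> t \<le> n\<close>) and
  \<open>u\<^sub>1 \<otimes> w\<^sub>t\<^sub>-\<^sub>1 - t u\<^sub>0 \<otimes> w\<^sub>t\<close> (\<open>0 < t < n\<close>).\<close>

definition cg_up :: "nat \<Rightarrow> complex mat" where
  "cg_up n = mat (2 * n) (n + 1) (\<lambda>(r, t). if r < n then if r = t then of_nat n - of_nat t else 0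
     else if r + 1 = n + t then 1 else 0)"

definition cg_down :: "nat \<Rightarrow> complex mat" where
  "cg_down n = mat (2 * n) (n - 1) (\<lambda>(r, j). if r < n then if r = j + 1 then - of_nat (j + 1) else 0
     else if r = n + j then 1 else 0)"

text \<open>Call the basis vectors of the two summands \<open>a\<close> and \<open>b\<close>, at the
  same \<open>t\<close>. Then \<open>u0 \<otimes> w\<close> with index \<open>t\<close> is
  \<open>(a - b) / n\<close>, and \<open>u1 \<otimes> w\<close> with index \<open>t - 1\<close> is
  \<open>(t a + (n - t) b) / n\<close>; the coefficients of \<open>a\<close> are recorded here,
  those of \<open>b\<close> in \<open>cg_down_inv\<close>.\<close>

definition cg_up_inv :: "nat \<Rightarrow> complex mat" where
  "cg_up_inv n = mat (n + 1) (2 * n) (\<lambda>(t, r). if r < n then if r = t then 1 / of_nat n else 0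
     else if r + 1 = n + t then of_nat t / of_nat n else 0)"

definition cg_down_inv :: "nat \<Rightarrow> complex mat" where
  "cg_down_inv n = mat (n - 1) (2 * n) (\<lambda>(j, r). if r < n then if r = j + 1 then - 1 / of_nat n else 0
     else if r = n + j then (of_nat n - of_nat (j + 1)) / of_nat n else 0)"

lemmas cg_defs = cg_up_def cg_down_def cg_up_inv_def cg_down_inv_def

lemma cg_dims:
  "dim_row (cg_up n) = 2 * n" "dim_col (cg_up n) = n + 1" "dim_row (cg_down n) = 2 * n" "dim_col (cg_down n) = n - 1"
  "dim_row (cg_up_inv n) = n + 1" "dim_col (cg_up_inv n) = 2 * n"
  "dim_row (cg_down_inv n) = n - 1" "dim_col (cg_down_inv n) = 2 * n"
  by (simp_all add: cg_defs)

lemma sum_delta_mult: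
  fixes f :: "nat \<Rightarrow> complex"
  shows "(\<Sum>k<n. (if k = a then c else 0) * f k) = (if a < n then c * f a else 0)"
    and "(\<Sum>k<n. (if Suc k = a then c else 0) * f k) = (if 0 < a \<and> a \<le> n then c * f (a - 1) else 0)"
    and "(\<Sum>k<n. (if k = Suc a then c else 0) * f k) = (if Suc a < n then c * f (Suc a) else 0)"
proof -
  show *: "(\<Sum>k<n. (if k = a then c else 0) * f k) = (if a < n then c * f a else 0)" for a
    by (cases "a < n") (auto simp: sum.remove[of "{..<n}" a] intro!: sum.neutral)
  show "(\<Sum>k<n. (if k = Suc a then c else 0) * f k) = (if Suc a < n then c * f (Suc a) else 0)"
    by (rule *)
  show "(\<Sum>k<n. (if Suc k = a then c else 0) * f k) = (if 0 < a \<and> a \<le> n then c * f (a - 1) else 0)"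
    using *[of "a - 1"] by (cases a) auto
qed

lemma cg_inverse:
  assumes n: "n > 0"
  shows "cg_up_inv n * cg_up n = 1\<^sub>m (n + 1)" "cg_down_inv n * cg_down n = 1\<^sub>m (n - 1)"
    "cg_up_inv n * cg_down n = 0\<^sub>m (n + 1) (n - 1)" "cg_down_inv n * cg_up n = 0\<^sub>m (n - 1) (n + 1)"
proof -
  have n0: "of_nat n \<noteq> (0::complex)" using n by simp
  have entry: "(A * B) $$ (i, j) = (\<Sum>k<n. A $$ (i, k) * B $$ (k, j)) + (\<Sum>k<n. A $$ (i, n + k) * B $$ (n + k, j))"
    if "i < dim_row A" "j < dim_col B" "dim_col A = 2 * n" "dim_row B = 2 * n" for A B :: "complex mat" and i j
    using that by (subst mat_mult_index) (simp_all add: sum_double)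
  have U: "cg_up_inv n $$ (t, k) = (if k = t then 1 / of_nat n else 0)"
    "cg_up_inv n $$ (t, n + k) = (if Suc k = t then of_nat t / of_nat n else 0)" if "t < n + 1" "k < n" for t k
    using that by (auto simp: cg_up_inv_def)
  have D: "cg_down_inv n $$ (j, k) = (if k = Suc j then - 1 / of_nat n else 0)"
    "cg_down_inv n $$ (j, n + k) = (if k = j then (of_nat n - of_nat (j + 1)) / of_nat n else 0)"
    if "j < n - 1" "k < n" for j k
    using that by (auto simp: cg_down_inv_def)
  have Ue: "(cg_up_inv n * B) $$ (t, j) = (if t < n then 1 / of_nat n * B $$ (t, j) else 0) +
      (if 0 < t \<and> t \<le> n then of_nat t / of_nat n * B $$ (n + (t - 1), j) else 0)"
    if "t < n + 1" "j < dim_col B" "dim_row B = 2 * n" for B :: "complex mat" and t j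
  proof -
    have "(cg_up_inv n * B) $$ (t, j) = (\<Sum>k<n. (if k = t then 1 / of_nat n else 0) * B $$ (k, j)) +
        (\<Sum>k<n. (if Suc k = t then of_nat t / of_nat n else 0) * B $$ (n + k, j))"
      using that U[of t] by (subst entry) (simp_all add: cg_dims)
    then show ?thesis by (simp only: sum_delta_mult)
  qed
  have De: "(cg_down_inv n * B) $$ (i, j) = (if Suc i < n then - 1 / of_nat n * B $$ (Suc i, j) else 0) +
      (if i < n then (of_nat n - of_nat (i + 1)) / of_nat n * B $$ (n + i, j) else 0)"
    if "i < n - 1" "j < dim_col B" "dim_row B = 2 * n" for B :: "complex mat" and i j
  proof -
    have "(cg_down_inv n * B) $$ (i, j) = (\<Sum>k<n. (if k = Suc i then - 1 / of_nat n else 0) * B $$ (k, j)) +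
        (\<Sum>k<n. (if k = i then (of_nat n - of_nat (i + 1)) / of_nat n else 0) * B $$ (n + k, j))"
      using that D[of i] by (subst entry) (simp_all add: cg_dims)
    then show ?thesis by (simp only: sum_delta_mult)
  qed
  show "cg_up_inv n * cg_up n = 1\<^sub>m (n + 1)"
    using n0 n by (intro eq_matI) (auto simp: Ue cg_dims cg_up_def field_simps simp del: index_mult_mat(1))
  show "cg_up_inv n * cg_down n = 0\<^sub>m (n + 1) (n - 1)"
    using n0 n by (intro eq_matI) (auto simp: Ue cg_dims cg_down_def field_simps simp del: index_mult_mat(1))
  show "cg_down_inv n * cg_down n = 1\<^sub>m (n - 1)"
    using n0 n by (intro eq_matI) (auto simp: De cg_dims cg_down_def field_simps simp del: index_mult_mat(1))
  show "cg_down_inv n * cg_up n = 0\<^sub>m (n - 1) (n + 1)"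
    using n0 n by (intro eq_matI) (auto simp: De cg_dims cg_up_def field_simps simp del: index_mult_mat(1))
qed

lemma cg_complete:
  assumes n: "n > 0"
  shows "cg_down n * cg_down_inv n + cg_up n * cg_up_inv n = 1\<^sub>m (2 * n)"
proof -
  have n0: "of_nat n \<noteq> (0::complex)" using n by simp
  have up: "(cg_up n * B) $$ (r, c) = (if r < n then (of_nat n - of_nat r) * B $$ (r, c) else B $$ (r + 1 - n, c))"
    if "r < 2 * n" "c < dim_col B" "dim_row B = n + 1" for B :: "complex mat" and r c
  proof -
    have "(cg_up n * B) $$ (r, c) = (\<Sum>k<n + 1. cg_up n $$ (r, k) * B $$ (k, c))"
      using that by (subst mat_mult_index) (auto simp: cg_dims)
    also have "\<dots> = (\<Sum>k<n + 1. (if k = (if r < n then r else r + 1 - n)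
        then (if r < n then of_nat n - of_nat r else 1) else 0) * B $$ (k, c))"
      using that by (intro sum.cong) (auto simp: cg_up_def)
    finally show ?thesis using that by (simp only: sum_delta_mult) auto
  qed
  have down: "(cg_down n * B) $$ (r, c) = (if r < n then if r = 0 then 0 else - of_nat r * B $$ (r - 1, c)
      else if r < 2 * n - 1 then B $$ (r - n, c) else 0)"
    if "r < 2 * n" "c < dim_col B" "dim_row B = n - 1" for B :: "complex mat" and r c
  proof -
    have "(cg_down n * B) $$ (r, c) = (\<Sum>k<n - 1. cg_down n $$ (r, k) * B $$ (k, c))"
      using that by (subst mat_mult_index) (auto simp: cg_dims)
    also have "\<dots> = (\<Sum>k<n - 1. if r < n then (if Suc k = r then - of_nat r else 0) * B $$ (k, c)
        else (if k = r - n then 1 else 0) * B $$ (k, c))"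
      using that by (intro sum.cong) (auto simp: cg_down_def)
    also have "\<dots> = (if r < n then (\<Sum>k<n - 1. (if Suc k = r then - of_nat r else 0) * B $$ (k, c))
        else (\<Sum>k<n - 1. (if k = r - n then 1 else 0) * B $$ (k, c)))"
      by simp
    finally show ?thesis using that by (simp only: sum_delta_mult) auto
  qed
  show ?thesis
  proof (rule eq_matI)
    fix r c assume rc: "r < dim_row (1\<^sub>m (2 * n) :: complex mat)" "c < dim_col (1\<^sub>m (2 * n) :: complex mat)"
    \<comment> \<open>The last index \<open>2 n - 1\<close> corresponds to \<open>t = n\<close>,
      where the longer summand alone has a basis vector and the coefficient \<open>t / n\<close> is
      1.\<close>
    have last: "1 + complex_of_nat c = of_nat n * 2" if "\<not> c < n * 2 - Suc 0" "c < n * 2"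
    proof -
      from that have "Suc c = n * 2" by linarith
      from arg_cong[OF this, of complex_of_nat] show ?thesis by simp
    qed
    from rc show "(cg_down n * cg_down_inv n + cg_up n * cg_up_inv n) $$ (r, c) = 1\<^sub>m (2 * n) $$ (r, c)"
      using n0 n by (simp add: up down cg_dims del: index_mult_mat(1))
        (auto simp: cg_up_inv_def cg_down_inv_def field_simps of_nat_diff last)
  qed (simp_all add: cg_dims)
qed

text \<open>The nilpotent part lowers \<open>t\<close> by one on both tensor terms, and the first
  tensor factor contributes one further \<open>u0 \<otimes> w\<close> of index \<open>t - 1\<close>.
  So the coefficient of \<open>u0 \<otimes> w\<close> must grow by one as \<open>t\<close> drops by
  one, as \<open>n - t\<close> and \<open>- t\<close> do. They vanish at \<open>t = n\<close> and
  \<open>t = 0\<close>, where the chains have to end.\<close>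

lemma cg_intertwines:
  fixes z :: complex
  assumes n: "n > 0"
  defines "A \<equiv> kron (jordan_block 2 0) (1\<^sub>m n) + kron (1\<^sub>m 2) (jordan_block n z)"
  shows "A * cg_up n = cg_up n * jordan_block (n + 1) z" "A * cg_down n = cg_down n * jordan_block (n - 1) z"
proof -
  have dA: "dim_row A = 2 * n" "dim_col A = 2 * n" by (simp_all add: A_def)
  have A: "A $$ (k, l) = jordan_block n z $$ (k, l)" "A $$ (k, n + l) = (if k = l then 1 else 0)"
    "A $$ (n + k, l) = 0" "A $$ (n + k, n + l) = jordan_block n z $$ (k, l)" if "k < n" "l < n" for k l
    using that by (simp_all add: A_def kron_index del: jordan_block_index(1)) (auto simp: jordan_block_index)
  have low: "(A * B) $$ (k, j) = z * B $$ (k, j) + (if Suc k < n then B $$ (Suc k, j) else 0) + B $$ (n + k, j)"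
    and high: "(A * B) $$ (n + k, j) = z * B $$ (n + k, j) + (if Suc k < n then B $$ (n + Suc k, j) else 0)"
    if "k < n" "j < dim_col B" "dim_row B = 2 * n" for B :: "complex mat" and k j
  proof -
    have e: "(A * B) $$ (i, j) = (\<Sum>l<n. A $$ (i, l) * B $$ (l, j)) + (\<Sum>l<n. A $$ (i, n + l) * B $$ (n + l, j))"
      if "i < 2 * n" for i
      using that \<open>j < dim_col B\<close> \<open>dim_row B = 2 * n\<close> dA by (subst mat_mult_index) (simp_all add: sum_double)
    have Jsum: "(\<Sum>l<n. jordan_block n z $$ (k, l) * f l) = z * f k + (if Suc k < n then f (Suc k) else 0)" for f
    proof -
      have "(\<Sum>l<n. jordan_block n z $$ (k, l) * f l) =
          (\<Sum>l<n. (if l = k then z else 0) * f l + (if l = Suc k then 1 else 0) * f l)"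
        using \<open>k < n\<close> by (intro sum.cong) auto
      then show ?thesis
        using \<open>k < n\<close> by (simp only: sum.distrib sum_delta_mult) simp
    qed
    have "(\<Sum>l<n. A $$ (k, n + l) * B $$ (n + l, j)) = (\<Sum>l<n. (if l = k then 1 else 0) * B $$ (n + l, j))"
      using that A by (intro sum.cong) auto
    then show "(A * B) $$ (k, j) = z * B $$ (k, j) + (if Suc k < n then B $$ (Suc k, j) else 0) + B $$ (n + k, j)"
      using that A e[of k] Jsum[of "\<lambda>l. B $$ (l, j)"] sum_delta_mult(1)[of k 1 "\<lambda>l. B $$ (n + l, j)" n] by simp
    show "(A * B) $$ (n + k, j) = z * B $$ (n + k, j) + (if Suc k < n then B $$ (n + Suc k, j) else 0)"
      using that A e[of "n + k"] Jsum[of "\<lambda>l. B $$ (n + l, j)"] by simp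
  qed
  have split: "\<exists>k<n. r = k \<or> r = n + k" if "r < 2 * n" for r
    using that by (cases "r < n") (auto intro!: exI[of _ "r - n"])
  show "A * cg_up n = cg_up n * jordan_block (n + 1) z"
  proof (rule eq_matI)
    fix r t assume "r < dim_row (cg_up n * jordan_block (n + 1) z)" "t < dim_col (cg_up n * jordan_block (n + 1) z)"
    then have rt: "r < 2 * n" "t < n + 1" by (simp_all add: cg_dims)
    obtain k where k: "k < n" "r = k \<or> r = n + k" using split[OF rt(1)] by blast
    have "(cg_up n * jordan_block (n + 1) z) $$ (r, t) = cg_up n $$ (r, t) * z + (if t = 0 then 0 else cg_up n $$ (r, t - 1))"
      using rt by (intro mult_jordan_block) (simp_all add: cg_dims)
    moreover have "(A * cg_up n) $$ (r, t) = cg_up n $$ (r, t) * z + (if t = 0 then 0 else cg_up n $$ (r, t - 1))"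
      using k(2)
    proof
      assume "r = k"
      then show ?thesis
        using low[of k t "cg_up n"] k(1) rt by (simp add: cg_dims del: index_mult_mat(1)) (auto simp: cg_up_def of_nat_diff)
    next
      assume "r = n + k"
      then show ?thesis
        using high[of k t "cg_up n"] k(1) rt by (simp add: cg_dims del: index_mult_mat(1)) (auto simp: cg_up_def)
    qed
    ultimately show "(A * cg_up n) $$ (r, t) = (cg_up n * jordan_block (n + 1) z) $$ (r, t)" by simp
  qed (simp_all add: cg_dims dA)
  show "A * cg_down n = cg_down n * jordan_block (n - 1) z"
  proof (rule eq_matI)
    fix r t assume "r < dim_row (cg_down n * jordan_block (n - 1) z)" "t < dim_col (cg_down n * jordan_block (n - 1) z)"
    then have rt: "r < 2 * n" "t < n - 1" by (simp_all add: cg_dims)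
    obtain k where k: "k < n" "r = k \<or> r = n + k" using split[OF rt(1)] by blast
    have "(cg_down n * jordan_block (n - 1) z) $$ (r, t) = cg_down n $$ (r, t) * z + (if t = 0 then 0 else cg_down n $$ (r, t - 1))"
      using rt by (intro mult_jordan_block) (simp_all add: cg_dims)
    moreover have "(A * cg_down n) $$ (r, t) = cg_down n $$ (r, t) * z + (if t = 0 then 0 else cg_down n $$ (r, t - 1))"
      using k(2)
    proof
      assume "r = k"
      then show ?thesis
        using low[of k t "cg_down n"] k(1) rt by (simp add: cg_dims del: index_mult_mat(1)) (auto simp: cg_down_def)
    next
      assume "r = n + k"
      then show ?thesis
        using high[of k t "cg_down n"] k(1) rt by (simp add: cg_dims del: index_mult_mat(1)) (auto simp: cg_down_def)
    qed
    ultimately show "(A * cg_down n) $$ (r, t) = (cg_down n * jordan_block (n - 1) z) $$ (r, t)" by simp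
  qed (simp_all add: cg_dims dA)
qed

lemma mat_add_zero:
  fixes A :: "complex mat"
  assumes "dim_row A = m" "dim_col A = n"
  shows "A + 0\<^sub>m m n = A" "0\<^sub>m m n + A = A"
  using assms by (auto intro!: eq_matI)

section \<open>The action of the natural module on the indecomposables\<close>

context line_element begin

text \<open>The projections are the inverse of the pair \<open>(i, j)\<close>. Writing
  \<open>act X\<close> as \<open>i * act Y * p + j * act Z * q\<close> shows that they intertwine,
  so this has to be checked for the inclusions only.\<close>

lemma biproductI_inverse:
  assumes X: "X \<in> fam \<Lambda> ss" and YZ: "Y \<in> mods" "Z \<in> mods" and ij: "i \<in> hom Y X" "j \<in> hom Z X"
    and pq: "dim_row p = fst Y" "dim_col p = fst X" "dim_row q = fst Z" "dim_col q = fst X"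
    and inv: "p * i = 1\<^sub>m (fst Y)" "q * j = 1\<^sub>m (fst Z)" "p * j = 0\<^sub>m (fst Y) (fst Z)" "q * i = 0\<^sub>m (fst Z) (fst Y)"
      "i * p + j * q = 1\<^sub>m (fst X)"
  shows "biproduct (cat \<Lambda> ss) X Y Z"
proof (rule biproductI[OF X YZ ij(1) _ ij(2) _ inv])
  note Xm = fam_mods[OF X]
  note d = homD(1,2)[OF ij(1)] homD(1,2)[OF ij(2)] pq
  have AX: "act X = i * (act Y * p) + j * (act Z * q)"
  proof -
    have "act X = act X * (i * p + j * q)" using Xm by (simp add: inv(5))
    also have "\<dots> = act X * i * p + act X * j * q"
      using d Xm by (simp add: mat_distribs mat_assoc)
    also have "\<dots> = i * act Y * p + j * act Z * q"
      by (simp only: homD(3)[OF ij(1)] homD(3)[OF ij(2)])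
    finally show ?thesis using d YZ by (simp add: mat_assoc)
  qed
  have "p * act X = act Y * p"
    unfolding AX using d YZ by (simp add: mat_distribs mat_mult_eq[OF inv(1)] mat_mult_eq[OF inv(3)] mat_add_zero)
  then show "p \<in> hom X Y" using Xm YZ pq by (intro homI) auto
  have "q * act X = act Z * q"
    unfolding AX using d YZ by (simp add: mat_distribs mat_mult_eq[OF inv(2)] mat_mult_eq[OF inv(4)] mat_add_zero)
  then show "q \<in> hom X Z" using Xm YZ pq by (intro homI) auto
qed

lemma biproduct_swap: "biproduct (cat \<Lambda> ss) X Y Z \<Longrightarrow> biproduct (cat \<Lambda> ss) X Z Y"
proof -
  assume "biproduct (cat \<Lambda> ss) X Y Z"
  then obtain i p j q where b: "X \<in> fam \<Lambda> ss" "Y \<in> fam \<Lambda> ss" "Z \<in> fam \<Lambda> ss"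
    "i \<in> hom Y X" "p \<in> hom X Y" "j \<in> hom Z X" "q \<in> hom X Z"
    "p * i = 1\<^sub>m (fst Y)" "q * j = 1\<^sub>m (fst Z)" "p * j = 0\<^sub>m (fst Y) (fst Z)" "q * i = 0\<^sub>m (fst Z) (fst Y)"
    "i * p + j * q = 1\<^sub>m (fst X)"
    by (rule biproductE)
  note d = homD(1,2)[OF b(4)] homD(1,2)[OF b(5)] homD(1,2)[OF b(6)] homD(1,2)[OF b(7)]
  have "j * q + i * p = i * p + j * q"
    using d by (intro eq_matI) (auto simp del: index_mult_mat(1))
  then show ?thesis
    using biproductI[OF b(1) fam_mods[OF b(3)] fam_mods[OF b(2)] b(6,7,4,5,9,8,11,10)] b(12) by simp
qed

lemma natural_mem: "natural_module \<in> lie_modules sl2"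
proof (rule lie_modulesI)
  fix x assume "x \<in> sl2"
  then show "dim_row (snd natural_module x) = fst natural_module" "dim_col (snd natural_module x) = fst natural_module"
    by (auto simp: natural_module_def sl2_def)
qed (simp_all add: natural_module_def sl2.add_mem sl2.smult_mem sl2.bracket_mem)

lemma fst_natural [simp]: "fst natural_module = 2"
  by (simp add: natural_module_def)

abbreviation nat_act :: "lie_module \<Rightarrow> lie_module" where
  "nat_act N \<equiv> module_tensor (line g) (module_restrict (line g) natural_module) N"

lemma natural_act: "fst (nat_act N) = 2 * fst N"
  "act (nat_act N) = kron g (1\<^sub>m (fst N)) + kron (1\<^sub>m 2) (act N)"
  using g_sl2 unfolding act_tensor by (simp_all add: natural_module_def)

text \<open>Conjugation with \<open>kron P (1\<^sub>m n)\<close> replaces \<open>g\<close> by its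
  Jordan cell, where the \<open>cg\<close> matrices apply. For \<open>n = 1\<close> the summand
  \<open>J (n - 1) z\<close> is the zero module.\<close>

lemma clebsch_gordan_nilpotent:
  assumes w: "similar_mat_wit g (jordan_block 2 0) P Q" and n: "n > 0"
    and X: "nat_act (J n z) \<in> fam \<Lambda> ss"
  shows "biproduct (cat \<Lambda> ss) (nat_act (J n z)) (J (n - 1) z) (J (n + 1) z)"
proof -
  have "g \<in> carrier_mat 2 2" using g_dims by auto
  note wd = similar_mat_witD2[OF this w]
  have d: "dim_row P = 2" "dim_col P = 2" "dim_row Q = 2" "dim_col Q = 2" using wd by auto
  define N where "N = kron (jordan_block 2 0) (1\<^sub>m n) + kron (1\<^sub>m 2) (jordan_block n z)"
  let ?P = "kron P (1\<^sub>m n)" and ?Q = "kron Q (1\<^sub>m n)"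
  have dN: "dim_row N = 2 * n" "dim_col N = 2 * n" by (simp_all add: N_def)
  have gP: "g * P = P * jordan_block 2 0"
    using d by (subst wd(3)) (simp add: mat_assoc wd(2))
  have act: "act (nat_act (J n z)) = kron g (1\<^sub>m n) + kron (1\<^sub>m 2) (jordan_block n z)"
    by (simp add: natural_act)
  have comm: "act (nat_act (J n z)) * ?P = ?P * N"
    unfolding act N_def using d g_dims gP by (simp add: mat_distribs kron_mult)
  have PQ: "?Q * ?P = 1\<^sub>m (2 * n)" "?P * ?Q = 1\<^sub>m (2 * n)"
    using d wd(1,2) by (simp_all add: kron_mult)
  note cg = cg_inverse[OF n] cg_complete[OF n] cg_intertwines[OF n, of z, folded N_def]
  have Xd: "dim_row (act (nat_act (J n z))) = 2 * n" "dim_col (act (nat_act (J n z))) = 2 * n"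
    by (simp_all add: act g_dims)
  have hom: "?P * C \<in> hom (J k z) (nat_act (J n z))"
    if C: "dim_row C = 2 * n" "dim_col C = k" "N * C = C * jordan_block k z" for C k
  proof (rule homI[OF J_simps(3) fam_mods[OF X]])
    have "act (nat_act (J n z)) * (?P * C) = ?P * (N * C)"
      using C d dN Xd by (simp add: mat_mult_eq[OF comm] mat_assoc)
    then show "?P * C * act (J k z) = act (nat_act (J n z)) * (?P * C)"
      using C d by (simp add: mat_assoc)
  qed (simp_all add: C d natural_act)
  show ?thesis
  proof (rule biproductI_inverse[OF X, where i = "?P * cg_down n" and j = "?P * cg_up n" and
        p = "cg_down_inv n * ?Q" and q = "cg_up_inv n * ?Q"])
    show "?P * cg_down n \<in> hom (J (n - 1) z) (nat_act (J n z))" "?P * cg_up n \<in> hom (J (n + 1) z) (nat_act (J n z))"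
      by (rule hom; simp add: cg_dims cg)+
    show "cg_down_inv n * ?Q * (?P * cg_down n) = 1\<^sub>m (fst (J (n - 1) z))"
      "cg_up_inv n * ?Q * (?P * cg_up n) = 1\<^sub>m (fst (J (n + 1) z))"
      "cg_down_inv n * ?Q * (?P * cg_up n) = 0\<^sub>m (fst (J (n - 1) z)) (fst (J (n + 1) z))"
      "cg_up_inv n * ?Q * (?P * cg_down n) = 0\<^sub>m (fst (J (n + 1) z)) (fst (J (n - 1) z))"
      using d cg(1-4) by (simp_all add: mat_assoc cg_dims mat_mult_eq[OF PQ(1)])
    have "?P * cg_down n * (cg_down_inv n * ?Q) + ?P * cg_up n * (cg_up_inv n * ?Q) =
        ?P * (cg_down n * cg_down_inv n + cg_up n * cg_up_inv n) * ?Q"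
      using d by (simp add: mat_distribs mat_assoc cg_dims)
    also have "\<dots> = 1\<^sub>m (fst (nat_act (J n z)))"
      unfolding cg(5) using d PQ(2) by (simp add: natural_act)
    finally show "?P * cg_down n * (cg_down_inv n * ?Q) + ?P * cg_up n * (cg_up_inv n * ?Q) =
        1\<^sub>m (fst (nat_act (J n z)))" .
  qed (simp_all add: cg_dims d natural_act)
qed

text \<open>On the tensor product with a one-dimensional module \<open>g\<close> acts by
  \<open>g + z\<close>, which is conjugate to the diagonal matrix with entries \<open>z + a\<close>
  and \<open>z - a\<close>.\<close>

lemma clebsch_gordan_semisimple:
  assumes w: "similar_mat_wit g (jordan_matrix [(1, a), (1, - a)]) P Q"
    and X: "nat_act (J 1 z) \<in> fam \<Lambda> ss"
  shows "biproduct (cat \<Lambda> ss) (nat_act (J 1 z)) (J 1 (z + a)) (J 1 (z - a))"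
proof (rule biproduct_similar[OF X])
  have g: "g \<in> carrier_mat 2 2" using g_dims by auto
  note wd = similar_mat_witD2[OF g w]
  have d: "dim_row P = 2" "dim_col P = 2" "dim_row Q = 2" "dim_col Q = 2" using wd by auto
  have shift: "four_block_mat (jordan_block 1 (z + a)) (0\<^sub>m 1 1) (0\<^sub>m 1 1) (jordan_block 1 (z - a)) =
      jordan_matrix [(1, a), (1, - a)] + z \<cdot>\<^sub>m 1\<^sub>m 2"
    unfolding jordan_matrix_def by (rule eq_matI) (auto simp: Let_def)
  have "kron (1\<^sub>m 2) (jordan_block 1 z) = z \<cdot>\<^sub>m 1\<^sub>m 2"
    by (rule eq_matI) (auto simp: kron_index)
  then have act: "act (nat_act (J 1 z)) = g + z \<cdot>\<^sub>m 1\<^sub>m 2"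
    by (simp add: natural_act)
  have "g + z \<cdot>\<^sub>m 1\<^sub>m 2 = P * (jordan_matrix [(1, a), (1, - a)] + z \<cdot>\<^sub>m 1\<^sub>m 2) * Q"
    using d wd(1,3) carrier_matD[OF wd(5)] by (simp add: mat_distribs mat_assoc)
  then have "similar_mat_wit (act (nat_act (J 1 z)))
      (four_block_mat (jordan_block 1 (z + a)) (0\<^sub>m 1 1) (0\<^sub>m 1 1) (jordan_block 1 (z - a))) P Q"
    unfolding act shift using wd g by (intro similar_mat_witI[of _ _ 2]) auto
  then show "similar_mat_wit (act (nat_act (J 1 z))) (four_block_mat (act (J 1 (z + a)))
      (0\<^sub>m (fst (J 1 (z + a))) (fst (J 1 (z - a)))) (0\<^sub>m (fst (J 1 (z - a))) (fst (J 1 (z + a)))) (act (J 1 (z - a)))) P Q"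
    by simp
qed simp_all

lemma reach_biproduct:
  assumes "biproduct (cat \<Lambda> ss) (nat_act X) Y Z"
  shows "reach X Y"
proof -
  from assms obtain i p where "i \<in> hom Y (nat_act X)" "p \<in> hom (nat_act X) Y" "p * i = 1\<^sub>m (fst Y)"
    by (rule biproductE)
  then show ?thesis unfolding reach_def using natural_mem by blast
qed

end

subsection \<open>Nilpotent and semisimple elements of \<open>sl2\<close>\<close>

lemma sl2_iff_mtrace: "x \<in> sl2 \<longleftrightarrow> x \<in> carrier_mat 2 2 \<and> mtrace x = 0"
  by (auto simp: sl2_def mtrace_def numeral_2_eq_2)

lemma mtrace_similar:
  assumes "A \<in> carrier_mat n n" "similar_mat_wit A B P Q"
  shows "mtrace A = mtrace B"
proof -
  note wd = similar_mat_witD2[OF assms]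
  have d: "dim_row P = n" "dim_col P = n" "dim_row Q = n" "dim_col Q = n" "dim_row B = n" "dim_col B = n"
    using wd by auto
  have "mtrace A = mtrace (Q * (P * B))"
    unfolding wd(3) using d by (intro mtrace_comm) auto
  then show ?thesis using d by (simp add: mat_mult_eq[OF wd(2)])
qed

lemma bracket_conj:
  fixes P Q x y :: "complex mat"
  assumes PQ: "P \<in> carrier_mat n n" "Q \<in> carrier_mat n n" "Q * P = 1\<^sub>m n"
    and xy: "x \<in> carrier_mat n n" "y \<in> carrier_mat n n"
  shows "bracket (P * x * Q) (P * y * Q) = P * bracket x y * Q"
proof -
  have d: "dim_row P = n" "dim_col P = n" "dim_row Q = n" "dim_col Q = n" "dim_row x = n" "dim_col x = n"
    "dim_row y = n" "dim_col y = n"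
    using PQ xy by auto
  then show ?thesis
    by (simp add: bracket_def mat_assoc mat_distribs mat_mult_eq[OF PQ(3)])
qed

context line_element begin

lemma g_carrier: "g \<in> carrier_mat 2 2"
  using g_dims by auto

text \<open>Trace zero in size 2 leaves a single cell, whose eigenvalue must be 0, or two cells of
  size 1 with opposite eigenvalues, nonzero because \<open>g\<close> is.\<close>

lemma jordan_cases:
  obtains (nilpotent) P Q where "similar_mat_wit g (jordan_block 2 0) P Q"
  | (semisimple) a P Q where "a \<noteq> 0" "similar_mat_wit g (jordan_matrix [(1, a), (1, - a)]) P Q"
proof -
  obtain ns P Q where ns: "0 \<notin> fst ` set ns" "similar_mat_wit g (jordan_matrix ns) P Q" "sum_list (map fst ns) = 2"
    by (rule jordan_nf_complex[OF g_carrier])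
  have tr: "mtrace (jordan_matrix ns) = 0"
    using mtrace_similar[OF g_carrier ns(2)] g_sl2 by (simp add: sl2_iff_mtrace)
  obtain n a ns' where n: "ns = (n, a) # ns'" using ns(3) by (cases ns) auto
  have "n = 2 \<and> ns' = [] \<or> n = 1 \<and> (\<exists>b. ns' = [(1, b)])"
  proof -
    have n0: "n \<noteq> 0" using ns(1) n by force
    show ?thesis
    proof (cases ns')
      case Nil
      then show ?thesis using ns(3) n by simp
    next
      case (Cons b ns'')
      obtain m y where b: "b = (m, y)" by force
      have "m \<noteq> 0" using ns(1) n Cons b by force
      moreover have "n + (m + sum_list (map fst ns'')) = 2"
        using ns(3) n Cons b by simp
      ultimately have "n = 1" "m = 1" "sum_list (map fst ns'') = 0"
        using n0 by linarith+
      moreover have "ns'' = []"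
      proof (cases ns'')
        case (Cons c ns3)
        then have "fst c = 0" "c \<in> set ns"
          using \<open>sum_list (map fst ns'') = 0\<close> \<open>ns' = b # ns''\<close> n by simp_all
        then show ?thesis using ns(1) by (metis imageI)
      qed
      ultimately show ?thesis using Cons b by simp
    qed
  qed
  then show thesis
  proof (elim disjE conjE exE)
    assume "n = 2" "ns' = []"
    then have ns2: "ns = [(2, a)]" using n by simp
    have J: "jordan_matrix ns = jordan_block 2 a"
      unfolding ns2 jordan_matrix_def by (rule eq_matI) (auto simp: Let_def)
    have "a = 0"
      using tr unfolding J by (simp add: mtrace_def numeral_2_eq_2)
    then show thesis using nilpotent ns(2) J by simp
  next
    fix b assume "n = 1" "ns' = [(1, b)]"
    then have ns2: "ns = [(1, a), (1, b)]" using n by simp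
    have J: "jordan_matrix ns $$ (0, 0) = a" "jordan_matrix ns $$ (1, 1) = b" "dim_row (jordan_matrix ns) = 2"
      unfolding ns2 jordan_matrix_def by (auto simp: Let_def)
    have "a + b = 0"
      using tr J unfolding mtrace_def J(3) by (simp add: numeral_2_eq_2)
    then have b: "b = - a" by (simp add: eq_neg_iff_add_eq_0 add.commute)
    have "a \<noteq> 0"
    proof
      assume "a = 0"
      then have "jordan_matrix ns = 0\<^sub>m 2 2"
        unfolding ns2 b jordan_matrix_def by (intro eq_matI) (auto simp: Let_def)
      then have "g = 0\<^sub>m 2 2"
        using similar_mat_witD2[OF g_carrier ns(2)] by auto
      with g_nonzero show False by simp
    qed
    then show thesis using semisimple ns(2) unfolding ns2 b by blast
  qed
qed

lemma diag_matrix: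
  "jordan_matrix [(1, a), (1, - a)] \<in> carrier_mat 2 2" "diagonal_mat (jordan_matrix [(1, a), (1, - a :: complex)])"
  "jordan_matrix [(1, a), (1, - a)] $$ (0, 0) = a" "jordan_matrix [(1, a), (1, - a)] $$ (Suc 0, Suc 0) = - a"
  "jordan_matrix [(1, a), (1, - a)] $$ (0, Suc 0) = 0" "jordan_matrix [(1, a), (1, - a)] $$ (Suc 0, 0) = 0"
  unfolding jordan_matrix_def diagonal_mat_def by (auto simp: Let_def)

lemma nilpotent_if:
  assumes "similar_mat_wit g (jordan_block 2 0) P Q"
  shows "nilpotent_mat g"
proof -
  have "jordan_block 2 0 ^\<^sub>m 2 = (0\<^sub>m 2 2 :: complex mat)"
    unfolding jordan_block_zero_pow by (rule eq_matI) auto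
  then have "g ^\<^sub>m 2 = 0\<^sub>m 2 2"
    using similar_mat_wit_pow_id[OF assms, of 2] similar_mat_witD2[OF g_carrier assms] by auto
  then show ?thesis unfolding nilpotent_mat_def using g_dims by auto
qed

lemma semisimple_if:
  assumes "similar_mat_wit g (jordan_matrix [(1, a), (1, - a)]) P Q"
  shows "semisimple_mat g"
  unfolding semisimple_mat_def similar_mat_def using assms diag_matrix(2) by blast

text \<open>The diagonal form is excluded because its powers have the nonzero entry
  \<open>a ^ k\<close>.\<close>

lemma nilpotent_imp:
  assumes "nilpotent_mat g"
  obtains P Q where "similar_mat_wit g (jordan_block 2 0) P Q"
proof (rule jordan_cases)
  fix a P Q assume a: "a \<noteq> 0" and w: "similar_mat_wit g (jordan_matrix [(1, a), (1, - a)]) P Q"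
  let ?D = "jordan_matrix [(1, a), (1, - a)]"
  obtain k where k: "g ^\<^sub>m k = 0\<^sub>m 2 2"
    using assms g_dims by (auto simp: nilpotent_mat_def)
  have "?D ^\<^sub>m k = Q * g ^\<^sub>m k * P"
    by (rule similar_mat_wit_pow_id[OF similar_mat_wit_sym[OF w]])
  then have "?D ^\<^sub>m k = 0\<^sub>m 2 2"
    unfolding k using similar_mat_witD2[OF g_carrier w] by auto
  moreover have "(?D ^\<^sub>m k) $$ (0, 0) = a ^ k"
    using upper_triangular_pow[OF diag_matrix(1) jordan_matrix_upper, of a k] diag_matrix(3)[of a] by auto
  ultimately have "a ^ k = 0" by simp
  with a show thesis by simp
qed (rule that)

text \<open>A nonzero eigenvalue rules out the nilpotent cell. The Jordan form may list the two
  eigenvalues in either order, hence the disjunction.\<close>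

lemma semisimple_imp:
  assumes "spectrum g = {\<mu>, - \<mu>}" "\<mu> \<noteq> 0"
  obtains a P Q where "a = \<mu> \<or> a = - \<mu>" "similar_mat_wit g (jordan_matrix [(1, a), (1, - a)]) P Q"
proof -
  have ev: "poly (char_poly g) \<mu> = 0"
    using assms eigenvalue_root_char_poly[OF g_carrier, of \<mu>] by (auto simp: spectrum_def)
  show thesis
  proof (rule jordan_cases)
    fix P Q assume "similar_mat_wit g (jordan_block 2 0) P Q"
    then have "char_poly g = char_poly (jordan_block 2 0)"
      by (intro char_poly_similar) (auto simp: similar_mat_def)
    with ev assms(2) show thesis by (simp add: jordan_block_char_poly)
  next
    fix a P Q assume w: "similar_mat_wit g (jordan_matrix [(1, a), (1, - a)]) P Q"
    then have "char_poly g = char_poly (jordan_matrix [(1, a), (1, - a)])"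
      by (intro char_poly_similar) (auto simp: similar_mat_def)
    with ev have "poly ([:- a, 1:] * [:a, 1:]) \<mu> = 0"
      by (simp add: jordan_matrix_char_poly del: mult_pCons_left mult_pCons_right)
    then have "\<mu> - a = 0 \<or> \<mu> + a = 0"
      by (simp only: poly_mult mult_eq_0_iff) (simp add: add.commute)
    then have "a = \<mu> \<or> a = - \<mu>"
      by (simp add: eq_neg_iff_add_eq_0 add.commute[of a] eq_commute[of a])
    from this w show thesis by (rule that)
  qed
qed

section \<open>Completing \<open>g\<close> to an sl2-triple in a representation\<close>

lemma conj_mem:
  assumes "similar_mat_wit g B P Q" "x \<in> carrier_mat 2 2" "mtrace x = 0"
  shows "P * x * Q \<in> sl2"
proof -
  note wd = similar_mat_witD2[OF g_carrier assms(1)]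
  have "similar_mat_wit (P * x * Q) x P Q"
    using wd assms(2) by (intro similar_mat_witI[of _ _ 2]) auto
  moreover have "P * x * Q \<in> carrier_mat 2 2" using wd assms(2) by auto
  ultimately show ?thesis
    using mtrace_similar assms(3) by (auto simp: sl2_iff_mtrace)
qed

text \<open>The standard Cartan element, written as a Jordan matrix so that
  \<open>diag_matrix\<close> applies.\<close>

definition diag1 :: "complex mat" where "diag1 = jordan_matrix [(1, 1), (1, - 1)]"

lemma diag1_index: "diag1 \<in> carrier_mat 2 2" "diag1 $$ (0, 0) = 1" "diag1 $$ (Suc 0, Suc 0) = - 1"
  "diag1 $$ (0, Suc 0) = 0" "diag1 $$ (Suc 0, 0) = 0" "dim_row diag1 = 2" "dim_col diag1 = 2"
  using diag_matrix[of 1] by (auto simp: diag1_def)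

lemma mtrace_diag1: "mtrace diag1 = 0"
  using diag1_index by (simp add: mtrace_def numeral_2_eq_2)

lemma rep_bracket:
  assumes "V \<in> lie_modules sl2" "x \<in> sl2" "y \<in> sl2" "bracket x y = c \<cdot>\<^sub>m z" "z \<in> sl2"
  shows "snd V x * snd V y - snd V y * snd V x = c \<cdot>\<^sub>m snd V z"
  using lie_module_hom(3)[OF assms(1-3)] lie_module_hom(2)[OF assms(1,5,5)] assms(4)
  by (simp add: bracket_def)

lemma rep_carrier: "V \<in> lie_modules sl2 \<Longrightarrow> x \<in> sl2 \<Longrightarrow> snd V x \<in> carrier_mat (fst V) (fst V)"
  using lie_module_dims by auto

text \<open>The Cartan element conjugated by \<open>P\<close> is some \<open>h\<close> with
  \<open>[h, g] = 2 g\<close>. The representation preserves this relation, and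
  \<open>bracket_eigen_nilpotent\<close> applies.\<close>

lemma nilpotent_rep:
  assumes w: "similar_mat_wit g (jordan_block 2 0) P Q" and V: "V \<in> lie_modules sl2"
  shows "snd V g ^\<^sub>m fst V = 0\<^sub>m (fst V) (fst V)"
proof -
  note wd = similar_mat_witD2[OF g_carrier w]
  define h where "h = P * diag1 * Q"
  have h: "h \<in> sl2"
    unfolding h_def by (rule conj_mem[OF w diag1_index(1) mtrace_diag1])
  have "bracket diag1 (jordan_block 2 0) = 2 \<cdot>\<^sub>m jordan_block 2 0"
    by (rule eq_matI) (auto simp: bracket_def diag1_index scalar_prod_def numeral_2_eq_2 less_Suc_eq)
  then have "bracket h g = P * (2 \<cdot>\<^sub>m jordan_block 2 0) * Q"
    using bracket_conj[OF wd(6,7,2) diag1_index(1) wd(5)] wd(3) by (simp add: h_def)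
  also have "\<dots> = 2 \<cdot>\<^sub>m (P * jordan_block 2 0 * Q)"
    using carrier_matD[OF wd(6)] carrier_matD[OF wd(7)] by (simp add: mat_distribs)
  finally have "bracket h g = 2 \<cdot>\<^sub>m g"
    unfolding wd(3)[symmetric] .
  from rep_bracket[OF V h g_sl2 this g_sl2] show ?thesis
    by (intro bracket_eigen_nilpotent[OF rep_carrier[OF V h] rep_carrier[OF V g_sl2], of 2]) simp_all
qed

text \<open>Conjugation by \<open>P\<close> moves the standard triple to one whose Cartan element
  \<open>H\<close> satisfies \<open>g = a H\<close>. By \<open>sl2_triple_spectrum\<close> the
  Jordan form of \<open>H\<close> on \<open>V\<close> has cells of size 1 with integer entries only,
  and \<open>D\<close> is \<open>a\<close> times this form.\<close>

lemma semisimple_rep: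
  assumes w: "similar_mat_wit g (jordan_matrix [(1, a), (1, - a)]) P Q" and V: "V \<in> lie_modules sl2"
  obtains D P' Q' where "D \<in> carrier_mat (fst V) (fst V)" "P' \<in> carrier_mat (fst V) (fst V)"
    "Q' \<in> carrier_mat (fst V) (fst V)" "P' * Q' = 1\<^sub>m (fst V)" "Q' * snd V g = D * Q'" "diagonal_mat D"
    "\<forall>k<fst V. \<exists>i::int. D $$ (k, k) = of_int i * a"
proof -
  note wd = similar_mat_witD2[OF g_carrier w]
  have d: "dim_row P = 2" "dim_col P = 2" "dim_row Q = 2" "dim_col Q = 2" using wd by auto
  define e0 :: "complex mat" where "e0 = mat 2 2 (\<lambda>(i, j). if i = 0 \<and> j = 1 then 1 else 0)"
  define f0 :: "complex mat" where "f0 = mat 2 2 (\<lambda>(i, j). if i = 1 \<and> j = 0 then 1 else 0)"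
  have c: "e0 \<in> carrier_mat 2 2" "f0 \<in> carrier_mat 2 2" by (simp_all add: e0_def f0_def)
  have b0: "bracket diag1 e0 = 2 \<cdot>\<^sub>m e0" "bracket diag1 f0 = - 2 \<cdot>\<^sub>m f0" "bracket e0 f0 = 1 \<cdot>\<^sub>m diag1"
    by (rule eq_matI; auto simp: e0_def f0_def bracket_def diag1_index scalar_prod_def numeral_2_eq_2 less_Suc_eq)+
  define E where "E = P * e0 * Q"
  define F where "F = P * f0 * Q"
  define H where "H = P * diag1 * Q"
  have mem: "E \<in> sl2" "F \<in> sl2" "H \<in> sl2"
    unfolding E_def F_def H_def using c mtrace_diag1 diag1_index(1)
    by (auto intro!: conj_mem[OF w] simp: mtrace_def e0_def f0_def numeral_2_eq_2)
  have scale: "P * (k \<cdot>\<^sub>m x) * Q = k \<cdot>\<^sub>m (P * x * Q)" if "x \<in> carrier_mat 2 2" for k x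
    using that d by (auto simp: mat_distribs)
  have b: "bracket H E = 2 \<cdot>\<^sub>m E" "bracket H F = - 2 \<cdot>\<^sub>m F" "bracket E F = 1 \<cdot>\<^sub>m H"
    unfolding E_def F_def H_def
    by (simp_all only: bracket_conj[OF wd(6,7,2)] c diag1_index(1) b0 scale)
  let ?\<rho> = "snd V"
  have "spec_in (range of_int) True (?\<rho> H)"
  proof (rule sl2_triple_spectrum[OF rep_carrier[OF V mem(1)] rep_carrier[OF V mem(2)] rep_carrier[OF V mem(3)]])
    show "?\<rho> H * ?\<rho> E - ?\<rho> E * ?\<rho> H = 2 \<cdot>\<^sub>m ?\<rho> E"
      by (rule rep_bracket[OF V mem(3,1) b(1) mem(1)])
    show "?\<rho> H * ?\<rho> F - ?\<rho> F * ?\<rho> H = - 2 \<cdot>\<^sub>m ?\<rho> F"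
      by (rule rep_bracket[OF V mem(3,2) b(2) mem(2)])
    have "?\<rho> E * ?\<rho> F - ?\<rho> F * ?\<rho> E = 1 \<cdot>\<^sub>m ?\<rho> H"
      by (rule rep_bracket[OF V mem(1,2) b(3) mem(3)])
    then show "?\<rho> E * ?\<rho> F - ?\<rho> F * ?\<rho> E = ?\<rho> H"
      by (auto intro!: eq_matI)
  qed
  note spec = this
  note Hc = rep_carrier[OF V mem(3)]
  obtain ns P' Q' where ns: "0 \<notin> fst ` set ns" "similar_mat_wit (?\<rho> H) (jordan_matrix ns) P' Q'"
    "sum_list (map fst ns) = fst V"
    by (rule jordan_nf_complex[OF Hc])
  note blocks = jordan_matrix_blocks[OF spec_in_similar[OF spec Hc ns(2)]]
  have one: "n = 1 \<and> z \<in> range of_int" if "(n, z) \<in> set ns" for n z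
  proof -
    have "0 < n" using that ns(1) by (force simp: image_iff)
    then show ?thesis using blocks[OF that] by simp
  qed
  have diag: "diagonal_mat (jordan_matrix ns) \<and> (\<forall>k<sum_list (map fst ns). jordan_matrix ns $$ (k, k) \<in> range of_int)"
    using one
  proof (induction ns)
    case Nil
    then show ?case by (simp add: diagonal_mat_def)
  next
    case (Cons b ns)
    obtain n z where "b = (n, z)" by force
    then have b: "b = (1, z)" "z \<in> range of_int" using Cons.prems[of n z] by simp_all
    have "\<And>n z. (n, z) \<in> set ns \<Longrightarrow> n = 1 \<and> z \<in> range of_int"
      by (rule Cons.prems) simp
    note IH' = Cons.IH[OF this]
    have IH: "diagonal_mat (jordan_matrix ns)" "\<And>k. k < sum_list (map fst ns) \<Longrightarrow> jordan_matrix ns $$ (k, k) \<in> range of_int"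
      using IH' by simp_all
    show ?case
      using IH b(2) unfolding b(1) jordan_matrix_Cons by (auto simp: diagonal_mat_def)
  qed
  note wd' = similar_mat_witD2[OF Hc ns(2)]
  let ?J = "jordan_matrix ns"
  have "jordan_matrix [(1, a), (1, - a)] = a \<cdot>\<^sub>m diag1"
    by (rule eq_matI) (use diag_matrix[of a] in \<open>auto simp: diag1_index numeral_2_eq_2 less_Suc_eq\<close>)
  then have "g = a \<cdot>\<^sub>m H"
    using wd(3) scale[OF diag1_index(1)] by (simp add: H_def)
  then have gV: "?\<rho> g = a \<cdot>\<^sub>m ?\<rho> H"
    using lie_module_hom(2)[OF V mem(3,3)] by simp
  have d': "dim_row P' = fst V" "dim_col P' = fst V" "dim_row Q' = fst V" "dim_col Q' = fst V"
    "dim_row ?J = fst V" "dim_col ?J = fst V"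
    using wd' by auto
  have "Q' * ?\<rho> H = ?J * Q'"
    using d' by (subst wd'(3)) (simp add: mat_assoc mat_mult_eq[OF wd'(2)])
  then have "Q' * ?\<rho> g = (a \<cdot>\<^sub>m ?J) * Q'"
    unfolding gV using d' carrier_matD[OF Hc] by (simp add: mat_distribs)
  show thesis
  proof (rule that[of "a \<cdot>\<^sub>m ?J" P' Q'])
    show "diagonal_mat (a \<cdot>\<^sub>m ?J)"
      using diag by (auto simp: diagonal_mat_def)
    show "\<forall>k<fst V. \<exists>i::int. (a \<cdot>\<^sub>m ?J) $$ (k, k) = of_int i * a"
    proof (intro allI impI)
      fix k assume "k < fst V"
      then have "?J $$ (k, k) \<in> range of_int" using diag ns(3) by simp
      then obtain i :: int where "?J $$ (k, k) = of_int i" by blast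
      then show "\<exists>i::int. (a \<cdot>\<^sub>m ?J) $$ (k, k) = of_int i * a"
        using \<open>k < fst V\<close> d' by (auto simp: mult.commute)
    qed
  qed (use wd' \<open>Q' * ?\<rho> g = (a \<cdot>\<^sub>m ?J) * Q'\<close> in auto)
qed

end

subsection \<open>The categories attached to nilpotent and semisimple elements\<close>

definition coset :: "complex \<Rightarrow> complex \<Rightarrow> complex set"
  where "coset \<mu> \<alpha> = range (\<lambda>n::int. \<alpha> + of_int n * \<mu>)"

lemma coset_mem: "\<alpha> + of_int n * \<mu> \<in> coset \<mu> \<alpha>"
  unfolding coset_def by (rule rangeI)

context line_element begin

lemma reach_refl: "X \<in> mods \<Longrightarrow> reach X X"
  by (rule reach_retract[where i = "1\<^sub>m (fst X)" and p = "1\<^sub>m (fst X)"]) (simp_all add: module_homs_ident)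

lemma one_dim_module_eq: "one_dim_module g \<nu> = J 1 \<nu>"
  unfolding one_dim_module_def jordan_module_def
  by (rule arg_cong[where f = "line_module g"]) (auto intro!: eq_matI)

lemma Y_cat_eq: "Y_cat g \<alpha> = cat {\<alpha>} False"
proof -
  have "{J n \<alpha> | n. n > 0} = {J n z | n z. (n, z) \<in> jordan_blocks {\<alpha>} False}"
    by (auto simp: jordan_blocks_def)
  then show ?thesis by (simp only: Y_cat_def additive_closure_eq)
qed

lemma X_cat_eq: "X_cat g \<mu> \<alpha> = cat (coset \<mu> \<alpha>) True"
proof -
  have "{one_dim_module g (\<alpha> + of_int n * \<mu>) | n :: int. True} =
    {J n z | n z. (n, z) \<in> jordan_blocks (coset \<mu> \<alpha>) True}"
    unfolding one_dim_module_eq jordan_blocks_def coset_def by auto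
  then show ?thesis by (simp only: X_cat_def additive_closure_eq)
qed

end

locale nilpotent_element = line_element +
  fixes P Q :: "complex mat"
  assumes similar_block: "similar_mat_wit g (jordan_block 2 0) P Q"

sublocale nilpotent_element \<subseteq> closed_family g "{\<alpha>}" False for \<alpha>
proof
  fix V N assume V: "V \<in> lie_modules sl2" and N: "N \<in> fam {\<alpha>} False"
  then show "module_tensor (line g) (module_restrict (line g) V) N \<in> fam {\<alpha>} False"
    using tensor_mem[OF V fam_mods[OF N]]
      spec_in_kron_nilpotent[OF rep_carrier[OF V g_sl2] nilpotent_rep[OF similar_block V] act_carrier[OF fam_mods[OF N]]]
    by (simp add: fam_def act_tensor)
qed simp_all

context nilpotent_element begin

lemma natural_J:
  "n > 0 \<Longrightarrow> biproduct (cat {\<alpha>} False) (nat_act (J n \<alpha>)) (J (n - 1) \<alpha>) (J (n + 1) \<alpha>)"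
  by (intro clebsch_gordan_nilpotent[OF similar_block] tensor_closed natural_mem J_fam) (simp_all add: jordan_blocks_def)

lemma reach_up: "n > 0 \<Longrightarrow> reach (J n \<alpha>) (J (n + k) \<alpha>)"
proof (induction k)
  case 0
  show ?case by (simp add: reach_refl)
next
  case (Suc k)
  have "reach (J (n + k) \<alpha>) (J (n + Suc k) \<alpha>)"
    using reach_biproduct[OF biproduct_swap[OF natural_J[of "n + k" \<alpha>]]] Suc.prems by simp
  then show ?case
    using reach_trans[OF J_simps(3) J_simps(3) J_simps(3) Suc.IH[OF Suc.prems]] by blast
qed

lemma reach_down: "n > 0 \<Longrightarrow> reach (J (n + k) \<alpha>) (J n \<alpha>)"
proof (induction k)
  case 0
  show ?case by (simp add: reach_refl)
next
  case (Suc k)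
  have "reach (J (n + Suc k) \<alpha>) (J (n + k) \<alpha>)"
    using reach_biproduct[OF natural_J[of "n + Suc k" \<alpha>]] by simp
  from reach_trans[OF J_simps(3) J_simps(3) J_simps(3) this Suc.IH[OF Suc.prems]] show ?case .
qed

lemma reach_J:
  assumes "(n, z) \<in> jordan_blocks {\<alpha>} False" "(m, y) \<in> jordan_blocks {\<alpha>} False"
  shows "reach (J n z) (J m y)"
proof (cases "n \<le> m")
  case True
  then show ?thesis using reach_up[of n \<alpha> "m - n"] assms by (simp add: jordan_blocks_def)
next
  case False
  then show ?thesis using reach_down[of m "n - m" \<alpha>] assms by (simp add: jordan_blocks_def)
qed

lemma type_A_inf: "type_A_inf (cat {\<alpha>} False)"
  unfolding type_A_inf_def
\<comment> \<open>\<open>J 0 \<alpha>\<close> is the zero module, so vertex \<open>i\<close> carries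
  the cell of size \<open>i + 1\<close>.\<close>
proof (intro exI[of _ "\<lambda>i. J (i + 1) \<alpha>"] conjI allI impI)
  show "indecomposable (cat {\<alpha>} False) (J (i + 1) \<alpha>)" for i
    by (rule indecomposable_J) (simp add: jordan_blocks_def)
  show "i = j" if "iso_obj (cat {\<alpha>} False) (J (i + 1) \<alpha>) (J (j + 1) \<alpha>)" for i j
    using iso_J_imp_eq(1)[OF that] by simp
  show "\<exists>i. iso_obj (cat {\<alpha>} False) Y (J (i + 1) \<alpha>)" if "indecomposable (cat {\<alpha>} False) Y" for Y
  proof -
    obtain n z where nz: "(n, z) \<in> jordan_blocks {\<alpha>} False" "iso_obj (cat {\<alpha>} False) Y (J n z)"
      using \<open>indecomposable (cat {\<alpha>} False) Y\<close> by (rule indecomposable_imp_J)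
    then show ?thesis by (intro exI[of _ "n - 1"]) (simp add: jordan_blocks_def)
  qed
  \<comment> \<open>The general rule also covers the end vertex: its second summand
    \<open>J 0 \<alpha>\<close> is zero, so the biproduct is an isomorphism.\<close>
  have "biproduct (cat {\<alpha>} False) (nat_act (J 1 \<alpha>)) (J 2 \<alpha>) (J 0 \<alpha>)"
    using biproduct_swap[OF natural_J[of 1 \<alpha>]] by (simp add: numeral_2_eq_2)
  from biproduct_zero_iso[OF this]
  show "iso_obj (cat {\<alpha>} False) (Act (cat {\<alpha>} False) natural_module (J (0 + 1) \<alpha>)) (J (1 + 1) \<alpha>)"
    by (simp add: numeral_2_eq_2)
  show "biproduct (cat {\<alpha>} False) (Act (cat {\<alpha>} False) natural_module (J (i + 1) \<alpha>)) (J (i - 1 + 1) \<alpha>) (J (i + 1 + 1) \<alpha>)"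
    if "1 \<le> i" for i
    using natural_J[of "i + 1" \<alpha>] that by simp
qed

lemma nilpotent_case:
  "locally_finitary sl2_mod (Y_cat g \<alpha>)" "transitive_modcat sl2_mod (Y_cat g \<alpha>)"
  "type_A_inf (Y_cat g \<alpha>)" "simple_transitive_quotient sl2_mod (Y_cat g \<alpha>) (Y_tilde_cat g \<alpha>)"
proof -
  show "locally_finitary sl2_mod (Y_cat g \<alpha>)"
    unfolding Y_cat_eq by (rule locally_finitary)
  show "transitive_modcat sl2_mod (Y_cat g \<alpha>)"
    unfolding Y_cat_eq by (rule transitive[OF reach_J])
  show "type_A_inf (Y_cat g \<alpha>)"
    unfolding Y_cat_eq by (rule type_A_inf)
  have "maximal_invariant_ideal sl2_mod (cat {\<alpha>} False) (radical (cat {\<alpha>} False))"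
    by (rule radical_maximal[OF reach_J])
  then show "simple_transitive_quotient sl2_mod (Y_cat g \<alpha>) (Y_tilde_cat g \<alpha>)"
    unfolding simple_transitive_quotient_def Y_tilde_cat_def Y_cat_eq by blast
qed

end

text \<open>\<open>a\<close> is the eigenvalue listed first in the diagonal form, while \<mu> is the
  prescribed one; they agree up to sign, and the coset of \<alpha> modulo integer multiples is the
  same for both.\<close>

locale semisimple_element = line_element +
  fixes P Q :: "complex mat" and \<mu> a :: complex
  assumes similar_diagonal: "similar_mat_wit g (jordan_matrix [(1, a), (1, - a)]) P Q"
    and a_cases: "a = \<mu> \<or> a = - \<mu>" and mu_nonzero: "\<mu> \<noteq> 0"

sublocale semisimple_element \<subseteq> closed_family g "coset \<mu> \<alpha>" True for \<alpha>
proof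
  show "countable (coset \<mu> \<alpha>)" "coset \<mu> \<alpha> \<noteq> {}"
    by (simp_all add: coset_def)
  fix V N assume V: "V \<in> lie_modules sl2" and N: "N \<in> fam (coset \<mu> \<alpha>) True"
  obtain D P' Q' where D: "D \<in> carrier_mat (fst V) (fst V)" "P' \<in> carrier_mat (fst V) (fst V)"
    "Q' \<in> carrier_mat (fst V) (fst V)" "P' * Q' = 1\<^sub>m (fst V)" "Q' * snd V g = D * Q'" "diagonal_mat D"
    "\<forall>k<fst V. \<exists>i::int. D $$ (k, k) = of_int i * a"
    by (rule semisimple_rep[OF similar_diagonal V])
  have shift: "z + D $$ (k, k) \<in> coset \<mu> \<alpha>" if k: "k < fst V" and z: "z \<in> coset \<mu> \<alpha>" for k z
  proof -
    obtain i :: int where i: "D $$ (k, k) = of_int i * a" using D(7) k by blast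
    obtain n :: int where n: "z = \<alpha> + of_int n * \<mu>" using z by (auto simp: coset_def)
    from a_cases show ?thesis
    proof
      assume "a = \<mu>"
      then show ?thesis unfolding coset_def i n
        by (intro image_eqI[of _ _ "n + i"]) (simp_all add: algebra_simps)
    next
      assume "a = - \<mu>"
      then show ?thesis unfolding coset_def i n
        by (intro image_eqI[of _ _ "n - i"]) (simp_all add: algebra_simps)
    qed
  qed
  have "spec_in (coset \<mu> \<alpha>) True (act N)" using N by (simp add: fam_def)
  from spec_in_kron_diagonal[OF rep_carrier[OF V g_sl2] act_carrier[OF fam_mods[OF N]] this D(3,2,4,5,1,6) shift]
  show "module_tensor (line g) (module_restrict (line g) V) N \<in> fam (coset \<mu> \<alpha>) True"
    using tensor_mem[OF V fam_mods[OF N]] by (simp add: fam_def act_tensor)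
qed

context semisimple_element begin

abbreviation L :: "complex \<Rightarrow> int \<Rightarrow> lie_module" where "L \<alpha> i \<equiv> J 1 (\<alpha> + of_int i * \<mu>)"

lemma natural_L: "biproduct (cat (coset \<mu> \<alpha>) True) (nat_act (L \<alpha> i)) (L \<alpha> (i - 1)) (L \<alpha> (i + 1))"
proof -
  let ?z = "\<alpha> + of_int i * \<mu>"
  have "nat_act (L \<alpha> i) \<in> fam (coset \<mu> \<alpha>) True"
    by (intro tensor_closed natural_mem J_fam) (simp add: jordan_blocks_def coset_mem)
  note bp = clebsch_gordan_semisimple[OF similar_diagonal this]
  have eq: "\<alpha> + of_int (i - 1) * \<mu> = ?z - \<mu>" "\<alpha> + of_int (i + 1) * \<mu> = ?z + \<mu>"
    by (simp_all add: algebra_simps)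
  \<comment> \<open>For \<open>a = - \<mu>\<close> the two summands already come in this order, for
    \<open>a = \<mu>\<close> they are swapped.\<close>
  from a_cases show ?thesis unfolding eq
    using bp biproduct_swap[OF bp] by (elim disjE) simp_all
qed

lemma reach_up: "reach (L \<alpha> i) (L \<alpha> (i + int k))"
proof (induction k)
  case 0
  show ?case by (simp add: reach_refl)
next
  case (Suc k)
  have "reach (L \<alpha> (i + int k)) (L \<alpha> (i + int k + 1))"
    by (rule reach_biproduct[OF biproduct_swap[OF natural_L]])
  from reach_trans[OF J_simps(3) J_simps(3) J_simps(3) Suc.IH this] show ?case
    by (simp add: add.assoc add.commute[of 1])
qed

lemma reach_down: "reach (L \<alpha> i) (L \<alpha> (i - int k))"
proof (induction k)
  case 0
  show ?case by (simp add: reach_refl)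
next
  case (Suc k)
  have "reach (L \<alpha> (i - int k)) (L \<alpha> (i - int k - 1))"
    by (rule reach_biproduct[OF natural_L])
  then have "reach (L \<alpha> (i - int k)) (L \<alpha> (i - int (Suc k)))"
    by (simp add: algebra_simps)
  from reach_trans[OF J_simps(3) J_simps(3) J_simps(3) Suc.IH this] show ?case .
qed

lemma reach_J:
  assumes "(n, z) \<in> jordan_blocks (coset \<mu> \<alpha>) True" "(m, y) \<in> jordan_blocks (coset \<mu> \<alpha>) True"
  shows "reach (J n z) (J m y)"
proof -
  obtain i j :: int where ij: "n = 1" "z = \<alpha> + of_int i * \<mu>" "m = 1" "y = \<alpha> + of_int j * \<mu>"
    using assms by (auto simp: jordan_blocks_def coset_def)
  show ?thesis
  proof (cases "i \<le> j")
    case True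
    then show ?thesis using reach_up[of \<alpha> i "nat (j - i)"] by (simp add: ij)
  next
    case False
    then show ?thesis using reach_down[of \<alpha> i "nat (i - j)"] by (simp add: ij)
  qed
qed

lemma type_A_inf_inf: "type_A_inf_inf (cat (coset \<mu> \<alpha>) True)"
  unfolding type_A_inf_inf_def
proof (intro exI[of _ "L \<alpha>"] conjI allI impI)
  show "indecomposable (cat (coset \<mu> \<alpha>) True) (L \<alpha> i)" for i
    by (rule indecomposable_J) (simp add: jordan_blocks_def coset_mem)
  show "i = j" if "iso_obj (cat (coset \<mu> \<alpha>) True) (L \<alpha> i) (L \<alpha> j)" for i j
    using iso_J_imp_eq(2)[OF that] mu_nonzero by simp
  show "\<exists>i. iso_obj (cat (coset \<mu> \<alpha>) True) Y (L \<alpha> i)" if Y: "indecomposable (cat (coset \<mu> \<alpha>) True) Y" for Y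
  proof -
    obtain n z where nz: "(n, z) \<in> jordan_blocks (coset \<mu> \<alpha>) True" "iso_obj (cat (coset \<mu> \<alpha>) True) Y (J n z)"
      using Y by (rule indecomposable_imp_J)
    then obtain i :: int where "n = 1" "z = \<alpha> + of_int i * \<mu>"
      by (auto simp: jordan_blocks_def coset_def)
    with nz(2) show ?thesis by auto
  qed
  show "biproduct (cat (coset \<mu> \<alpha>) True) (Act (cat (coset \<mu> \<alpha>) True) natural_module (L \<alpha> i)) (L \<alpha> (i - 1)) (L \<alpha> (i + 1))" for i
    using natural_L[of \<alpha> i] by simp
qed

lemma semisimple_case:
  "locally_finitary sl2_mod (X_cat g \<mu> \<alpha>)" "simple_transitive sl2_mod (X_cat g \<mu> \<alpha>)"
  "type_A_inf_inf (X_cat g \<mu> \<alpha>)"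
  unfolding X_cat_eq
  by (rule locally_finitary simple_transitive_if_semisimple[OF reach_J] type_A_inf_inf TrueI | assumption)+

end

theorem proposition25:
  fixes g :: "complex mat"
  assumes "g \<in> sl2" and "g \<noteq> 0\<^sub>m 2 2"
  shows "(nilpotent_mat g \<or> semisimple_mat g) \<and>
    (nilpotent_mat g \<longrightarrow>
      (\<forall>\<alpha>. locally_finitary sl2_mod (Y_cat g \<alpha>) \<and>
           transitive_modcat sl2_mod (Y_cat g \<alpha>) \<and>
           type_A_inf (Y_cat g \<alpha>) \<and>
           simple_transitive_quotient sl2_mod (Y_cat g \<alpha>) (Y_tilde_cat g \<alpha>))) \<and>
    (\<forall>\<mu>. semisimple_mat g \<and> spectrum g = {\<mu>, - \<mu>} \<and> \<mu> \<noteq> 0 \<longrightarrow>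
      (\<forall>\<alpha>. locally_finitary sl2_mod (X_cat g \<mu> \<alpha>) \<and>
           simple_transitive sl2_mod (X_cat g \<mu> \<alpha>) \<and>
           type_A_inf_inf (X_cat g \<mu> \<alpha>)))"
proof -
  interpret line_element g by unfold_locales fact+
  show ?thesis
  proof (intro conjI impI allI)
    show "nilpotent_mat g \<or> semisimple_mat g"
      by (rule jordan_cases) (simp_all add: nilpotent_if semisimple_if)
  next
    fix \<alpha> assume "nilpotent_mat g"
    then obtain P Q where "similar_mat_wit g (jordan_block 2 0) P Q" by (rule nilpotent_imp)
    then interpret nilpotent_element g P Q by unfold_locales
    show "locally_finitary sl2_mod (Y_cat g \<alpha>)" "transitive_modcat sl2_mod (Y_cat g \<alpha>)"
      "type_A_inf (Y_cat g \<alpha>)" "simple_transitive_quotient sl2_mod (Y_cat g \<alpha>) (Y_tilde_cat g \<alpha>)"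
      by (rule nilpotent_case)+
  next
    fix \<mu> \<alpha> assume asm: "semisimple_mat g \<and> spectrum g = {\<mu>, - \<mu>} \<and> \<mu> \<noteq> 0"
    then have \<mu>: "spectrum g = {\<mu>, - \<mu>}" "\<mu> \<noteq> 0" by simp_all
    obtain a P Q where "a = \<mu> \<or> a = - \<mu>" "similar_mat_wit g (jordan_matrix [(1, a), (1, - a)]) P Q"
      by (rule semisimple_imp[OF \<mu>])
    then interpret semisimple_element g P Q \<mu> a using \<mu>(2) by unfold_locales
    show "locally_finitary sl2_mod (X_cat g \<mu> \<alpha>)" "simple_transitive sl2_mod (X_cat g \<mu> \<alpha>)"
      "type_A_inf_inf (X_cat g \<mu> \<alpha>)"
      by (rule semisimple_case)+
  qed
qed

end
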